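(* Let $n\ge1$ and let $a\in L^\infty(\mathrm{D}^{\mathrm{I}}_{n\times n})$ be a given symbol. Identifying functions that agree almost everywhere, the following conditions are equivalent. (1) The symbol $a$ is left (right, respectively) $\mathrm{U}(n)$-invariant. (2) The function $([U,V],x)\mapsto a\circ\widehat{\varphi}([U,V],x)=a(UD(x)V)$ defined on $(\mathrm{U}(n)\times\mathrm{U}(n))/\mathbb{T}^n\times\overrightarrow{(0,1)}^n$ is independent of $U$ (independent of $V$, respectively). (3) There is a measurable function $f$ defined on $(\mathbb{T}^n\backslash\mathrm{U}(n))\times\overrightarrow{(0,1)}^n$ (defined on $(\mathrm{U}(n)/\mathbb{T}^n)\times\overrightarrow{(0,1)}^n$, respectively) such that $a\circ\widehat{\varphi}=f\circ\rho$, where $\rho$ is given by $([U,V],x)\mapsto([V],x)$ (given by $([U,V],x)\mapsto([U],x)$, respectively). In particular, the assignment $f\mapsto f\circ\rho\circ\widehat{\varphi}^{-1}$ establishes a one-to-one correspondence between either $L^\infty((\mathbb{T}^n\backslash\mathrm{U}(n))\times\overrightarrow{(0,1)}^n)$ or $L^\infty((\mathrm{U}(n)/\mathbb{T}^n)\times\overrightarrow{(0,1)}^n)$, and the left $\mathrm{U}(n)$-invariant or right $\mathrm{U}(n)$-invariant symbols, respectively, where $\rho$ is $([U,V],x)\mapsto([V],x)$ or $([U,V],x)\mapsto([U],x)$, respectively.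
   Context: $\mathrm{D}^{\mathrm{I}}_{n\times n}=\{Z\in M_{n\times n}(\mathbb{C}): Z^*Z<I_n\}$. A symbol is a measurable, essentially bounded function on $\mathrm{D}^{\mathrm{I}}_{n\times n}$. It is left $\mathrm{U}(n)$-invariant if $a(UZ)=a(Z)$ for every $U\in\mathrm{U}(n)$, $Z\in\mathrm{D}^{\mathrm{I}}_{n\times n}$, and right $\mathrm{U}(n)$-invariant if $a(ZV)=a(Z)$ for every $V\in\mathrm{U}(n)$, $Z\in\mathrm{D}^{\mathrm{I}}_{n\times n}$. For $z\in\mathbb{C}^n$, $D(z)$ is the diagonal matrix with diagonal entries the components of $z$; $\mathbb{T}\subset\mathbb{C}$ is the unit circle and $\mathbb{T}^n$ is identified with the diagonal subgroup of $\mathrm{U}(n)$ via $t\mapsto D(t)$; $\mathbb{T}^n\backslash\mathrm{U}(n)$ and $\mathrm{U}(n)/\mathbb{T}^n$ are the quotients by left and right multiplication by this subgroup, respectively. $\overrightarrow{(0,1)}^n=\{x\in\mathbb{R}^n:1>x_1>\dots>x_n>0\}$. $(\mathrm{U}(n)\times\mathrm{U}(n))/\mathbb{T}^n$ is the quotient by the action $t\cdot(U,V)=(UD(\overline t),D(t)V)$, with classes $[U,V]$. $M_{n\times n}(\mathbb{C})^\times$ is the set of matrices $Z$ such that $ZZ^*$ is positive definite with all eigenvalues of multiplicity one; $\mathrm{D}^{\mathrm{I}}_{n\times n}\cap M_{n\times n}(\mathbb{C})^\times$ is open, dense and conull in $\mathrm{D}^{\mathrm{I}}_{n\times n}$. The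 map $\widehat{\varphi}:(\mathrm{U}(n)\times\mathrm{U}(n))/\mathbb{T}^n\times\overrightarrow{(0,1)}^n\to\mathrm{D}^{\mathrm{I}}_{n\times n}\cap M_{n\times n}(\mathbb{C})^\times$, $\widehat{\varphi}([U,V],x)=UD(x)V$, is a diffeomorphism. Null sets on these manifolds are taken with respect to the smooth measure class. *)

theory Defs
  imports "HOL-Analysis.Analysis" "HOL-Computational_Algebra.Computational_Algebra"
begin

(* n x n matrices are indexed by a finite linearly ordered type 'n with n = CARD('n).  The order
   is only needed to express the chamber 1 > x_1 > ... > x_n > 0. *)

type_synonym 'n cmat = "((complex, 'n) vec, 'n) vec"
type_synonym 'n rvec = "(real, 'n) vec"

definition adj :: "complex^'n^'n \<Rightarrow> complex^'n^'n" where
  "adj A = (\<chi> i j. cnj (A $ j $ i))"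

definition posdef :: "complex^'n^'n \<Rightarrow> bool" where
  "posdef A \<longleftrightarrow> adj A = A \<and> (\<forall>v. v \<noteq> 0 \<longrightarrow> 0 < Re (\<Sum>i\<in>UNIV. cnj (v $ i) * (A *v v) $ i))"

definition unitary_group :: "(complex^'n^'n) set" where
  "unitary_group = {U. adj U ** U = mat 1 \<and> U ** adj U = mat 1}"

definition diag :: "complex^'n \<Rightarrow> complex^'n^'n" where
  "diag z = (\<chi> i j. if i = j then z $ i else 0)"

definition diag_real :: "real^'n \<Rightarrow> complex^'n^'n" where
  "diag_real x = diag (\<chi> i. complex_of_real (x $ i))"

definition torus :: "(complex^'n) set" where
  "torus = {t. \<forall>i. norm (t $ i) = 1}"

definition conj_vec :: "complex^'n \<Rightarrow> complex^'n" where
  "conj_vec t = (\<chi> i. cnj (t $ i))"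

definition char_poly :: "complex^'n^'n \<Rightarrow> complex poly" where
  "char_poly A = det (\<chi> i j. (if i = j then [:0, 1:] else 0) - [:A $ i $ j:])"

definition matrix_ball :: "(complex^'n^'n) set" where
  "matrix_ball = {Z. posdef (mat 1 - adj Z ** Z)}"

definition regular_matrices :: "(complex^'n^'n) set" where
  "regular_matrices = {Z. posdef (Z ** adj Z) \<and>
     (\<forall>c. poly (char_poly (Z ** adj Z)) c = 0 \<longrightarrow> order c (char_poly (Z ** adj Z)) = 1)}"

definition chamber :: "(real^'n::{finite,linorder}) set" where
  "chamber = {x. (\<forall>i. 0 < x $ i \<and> x $ i < 1) \<and> (\<forall>i j. i < j \<longrightarrow> x $ i > x $ j)}"

definition left_torus_rel :: "(('n::finite) cmat \<times> 'n cmat) set" where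
  "left_torus_rel = {(V, V'). V \<in> unitary_group \<and> (\<exists>t\<in>torus. V' = diag t ** V)}"

definition right_torus_rel :: "(('n::finite) cmat \<times> 'n cmat) set" where
  "right_torus_rel = {(U, U'). U \<in> unitary_group \<and> (\<exists>t\<in>torus. U' = U ** diag t)}"

definition pair_torus_rel ::
  "((('n::finite) cmat \<times> 'n cmat) \<times> ('n cmat \<times> 'n cmat)) set" where
  "pair_torus_rel = {((U, V), (U', V')). U \<in> unitary_group \<and> V \<in> unitary_group \<and>
     (\<exists>t\<in>torus. U' = U ** diag (conj_vec t) \<and> V' = diag t ** V)}"

definition cls :: "('a \<times> 'a) set \<Rightarrow> 'a \<Rightarrow> 'a set" where
  "cls R s = R `` {s}"

definition polar_domain ::
  "(('n cmat \<times> 'n cmat) set \<times> ('n::{finite,linorder}) rvec) set" where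
  "polar_domain = ((unitary_group \<times> unitary_group) // pair_torus_rel) \<times> chamber"

(* U D(x) V is the same for all (U,V) in a class c (lemma polar_map_cls), so the image below
   is a singleton. *)
definition polar_map ::
  "(('n::finite) cmat \<times> 'n cmat) set \<times> 'n rvec \<Rightarrow> 'n cmat" where
  "polar_map = (\<lambda>(c, x). the_elem ((\<lambda>(U, V). U ** diag_real x ** V) ` c))"

definition polar_inv ::
  "'n cmat \<Rightarrow> ('n cmat \<times> 'n cmat) set \<times> ('n::{finite,linorder}) rvec" where
  "polar_inv = the_inv_into polar_domain polar_map"

(* A class [U,V] is a set of pairs; its projections to the second and first factor are exactly
   the orbits [V] and [U] (lemmas rho_left_cls and rho_right_cls). *)
definition rho_left ::
  "(('n::finite) cmat \<times> 'n cmat) set \<times> 'n rvec \<Rightarrow> 'n cmat set \<times> 'n rvec" where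
  "rho_left = (\<lambda>(c, x). (snd ` c, x))"

definition rho_right ::
  "(('n::finite) cmat \<times> 'n cmat) set \<times> 'n rvec \<Rightarrow> 'n cmat set \<times> 'n rvec" where
  "rho_right = (\<lambda>(c, x). (fst ` c, x))"

definition is_unitary_haar :: "('n::finite) cmat measure \<Rightarrow> bool" where
  "is_unitary_haar \<mu> \<longleftrightarrow> sets \<mu> = sets (restrict_space borel unitary_group) \<and>
     emeasure \<mu> unitary_group = 1 \<and>
     (\<forall>U\<in>unitary_group. distr \<mu> \<mu> (\<lambda>V. U ** V) = \<mu>)"

(* The normalized Haar measure of U(n); it exists and is unique, and it represents the smooth
   measure class of U(n). *)
definition unitary_haar :: "('n::finite) cmat measure" where
  "unitary_haar = (SOME \<mu>. is_unitary_haar \<mu>)"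

(* Borel sets of the quotient topology on S // R: the preimage in S of a set E of classes
   is the union of E. *)
definition quotient_borel :: "'a::topological_space set \<Rightarrow> ('a \<times> 'a) set \<Rightarrow> 'a set measure" where
  "quotient_borel S R = sigma (S // R) {E. E \<subseteq> S // R \<and> openin (top_of_set S) (\<Union>E)}"

(* For a free smooth action of a compact group, the orbit projection is a surjective submersion,
   hence the image of a finite measure in the smooth class is in the smooth class of the
   quotient manifold.  Completion turns Borel measurability into Lebesgue measurability. *)
definition polar_measure ::
  "(('n cmat \<times> 'n cmat) set \<times> ('n::{finite,linorder}) rvec) measure" where
  "polar_measure = completion
     (distr (unitary_haar \<Otimes>\<^sub>M unitary_haar)
            (quotient_borel (unitary_group \<times> unitary_group) pair_torus_rel) (cls pair_torus_rel)
      \<Otimes>\<^sub>M restrict_space lborel chamber)"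

definition left_quotient_measure ::
  "('n cmat set \<times> ('n::{finite,linorder}) rvec) measure" where
  "left_quotient_measure = completion
     (distr unitary_haar (quotient_borel unitary_group left_torus_rel) (cls left_torus_rel)
      \<Otimes>\<^sub>M restrict_space lborel chamber)"

definition right_quotient_measure ::
  "('n cmat set \<times> ('n::{finite,linorder}) rvec) measure" where
  "right_quotient_measure = completion
     (distr unitary_haar (quotient_borel unitary_group right_torus_rel) (cls right_torus_rel)
      \<Otimes>\<^sub>M restrict_space lborel chamber)"

abbreviation ball_measure :: "('n::finite) cmat measure" where
  "ball_measure \<equiv> lebesgue_on matrix_ball"

definition ess_bounded :: "'a measure \<Rightarrow> ('a \<Rightarrow> complex) set" where
  "ess_bounded M = {f \<in> borel_measurable M. \<exists>C::real. AE x in M. norm (f x) \<le> C}"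

definition ae_rel :: "'a measure \<Rightarrow> (('a \<Rightarrow> complex) \<times> ('a \<Rightarrow> complex)) set" where
  "ae_rel M = {(f, g). f \<in> ess_bounded M \<and> g \<in> ess_bounded M \<and> (AE x in M. f x = g x)}"

definition L_infty :: "'a measure \<Rightarrow> ('a \<Rightarrow> complex) set set" where
  "L_infty M = ess_bounded M // ae_rel M"

definition left_invariant :: "(('n::finite) cmat \<Rightarrow> complex) \<Rightarrow> bool" where
  "left_invariant a \<longleftrightarrow> (\<forall>U\<in>unitary_group. \<forall>Z\<in>matrix_ball. a (U ** Z) = a Z)"

definition right_invariant :: "(('n::finite) cmat \<Rightarrow> complex) \<Rightarrow> bool" where
  "right_invariant a \<longleftrightarrow> (\<forall>V\<in>unitary_group. \<forall>Z\<in>matrix_ball. a (Z ** V) = a Z)"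

definition independent_of_U ::
  "(('n cmat \<times> 'n cmat) set \<times> ('n::{finite,linorder}) rvec \<Rightarrow> complex) \<Rightarrow> bool" where
  "independent_of_U b \<longleftrightarrow>
     (\<forall>U\<in>unitary_group. \<forall>U'\<in>unitary_group. \<forall>V\<in>unitary_group. \<forall>x\<in>chamber.
        b (cls pair_torus_rel (U, V), x) = b (cls pair_torus_rel (U', V), x))"

definition independent_of_V ::
  "(('n cmat \<times> 'n cmat) set \<times> ('n::{finite,linorder}) rvec \<Rightarrow> complex) \<Rightarrow> bool" where
  "independent_of_V b \<longleftrightarrow>
     (\<forall>U\<in>unitary_group. \<forall>V\<in>unitary_group. \<forall>V'\<in>unitary_group. \<forall>x\<in>chamber.
        b (cls pair_torus_rel (U, V), x) = b (cls pair_torus_rel (U, V'), x))"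

(* The property P of functions, read for functions modulo equality almost everywhere. *)
definition holds_mod_ae :: "'a measure \<Rightarrow> (('a \<Rightarrow> complex) \<Rightarrow> bool) \<Rightarrow> ('a \<Rightarrow> complex) \<Rightarrow> bool" where
  "holds_mod_ae M P f \<longleftrightarrow> (\<exists>g. (f, g) \<in> ae_rel M \<and> P g)"

definition left_invariant_classes :: "(('n::finite) cmat \<Rightarrow> complex) set set" where
  "left_invariant_classes = {A \<in> L_infty ball_measure. \<exists>a\<in>A. left_invariant a}"

definition right_invariant_classes :: "(('n::finite) cmat \<Rightarrow> complex) set set" where
  "right_invariant_classes = {A \<in> L_infty ball_measure. \<exists>a\<in>A. right_invariant a}"

(* f o rho o polar_map^{-1} is only defined on the regular part of the ball, whose complement in
   the ball is null; the value 0 elsewhere is arbitrary. *)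
definition symbol_of ::
  "(('n cmat \<times> 'n cmat) set \<times> ('n::{finite,linorder}) rvec
      \<Rightarrow> 'n cmat set \<times> 'n rvec)
   \<Rightarrow> ('n cmat set \<times> 'n rvec \<Rightarrow> complex) \<Rightarrow> 'n cmat \<Rightarrow> complex" where
  "symbol_of \<rho> f Z =
     (if Z \<in> matrix_ball \<inter> regular_matrices then f (\<rho> (polar_inv Z)) else 0)"

lemma torus_conj: "t \<in> torus \<Longrightarrow> conj_vec t \<in> torus"
  by (simp add: torus_def conj_vec_def)

lemma conj_conj_vec: "conj_vec (conj_vec t) = t"
  by (simp add: conj_vec_def vec_eq_iff)

lemma ones_torus: "(\<chi> i. 1) \<in> torus"
  by (simp add: torus_def)

lemma diag_mult: "diag s ** diag t = diag (\<chi> i. s $ i * t $ i)"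
proof -
  have "(\<Sum>k\<in>UNIV. (if i = k then s $ i else 0) * (if k = j then t $ k else 0))
      = (\<Sum>k\<in>UNIV. if k = i then (if i = j then s $ i * t $ i else 0) else 0)" for i j
    by (rule sum.cong) auto
  then show ?thesis
    by (simp add: diag_def matrix_matrix_mult_def vec_eq_iff)
qed

lemma conj_torus_cancel:
  assumes "t \<in> torus"
  shows "diag (conj_vec t) ** diag_real x ** diag t = diag_real x"
proof -
  have "cnj (t $ i) * t $ i = 1" for i
    using assms complex_norm_square[of "t $ i"] by (simp add: torus_def mult.commute)
  then have *: "cnj (t $ i) * complex_of_real (x $ i) * t $ i = complex_of_real (x $ i)" for i
    by (metis mult.assoc mult.commute mult.right_neutral)
  have "diag (conj_vec t) ** diag_real x ** diag t
      = diag (\<chi> i. cnj (t $ i) * complex_of_real (x $ i) * t $ i)"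
    unfolding diag_real_def diag_mult conj_vec_def by simp
  then show ?thesis
    unfolding * diag_real_def .
qed

lemma cls_pair_torus_rel:
  assumes "U \<in> unitary_group" "V \<in> unitary_group"
  shows "cls pair_torus_rel (U, V) = (\<lambda>t. (U ** diag (conj_vec t), diag t ** V)) ` torus"
  using assms unfolding cls_def pair_torus_rel_def by blast

lemma polar_map_cls:
  fixes U V :: "complex^'n^'n"
  assumes "U \<in> unitary_group" "V \<in> unitary_group"
  shows "polar_map (cls pair_torus_rel (U, V), x) = U ** diag_real x ** V"
proof -
  have "U ** diag (conj_vec t) ** diag_real x ** (diag t ** V) = U ** diag_real x ** V"
    if "t \<in> torus" for t
    using conj_torus_cancel[OF that, of x] by (metis matrix_mul_assoc)
  then have "(\<lambda>(U, V). U ** diag_real x ** V) ` cls pair_torus_rel (U, V)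
      = (\<lambda>t::complex^'n. U ** diag_real x ** V) ` torus"
    by (simp add: cls_pair_torus_rel[OF assms] image_image)
  also have "\<dots> = {U ** diag_real x ** V}"
    using ones_torus by blast
  finally show ?thesis
    by (simp add: polar_map_def)
qed

lemma rho_left_cls:
  assumes "U \<in> unitary_group" "V \<in> unitary_group"
  shows "rho_left (cls pair_torus_rel (U, V), x) = (cls left_torus_rel V, x)"
proof -
  have "cls left_torus_rel V = (\<lambda>t. diag t ** V) ` torus"
    using assms unfolding cls_def left_torus_rel_def by blast
  then show ?thesis
    by (simp add: rho_left_def cls_pair_torus_rel[OF assms] image_image)
qed

lemma rho_right_cls:
  assumes "U \<in> unitary_group" "V \<in> unitary_group"
  shows "rho_right (cls pair_torus_rel (U, V), x) = (cls right_torus_rel U, x)"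
proof -
  have "conj_vec ` torus = torus"
    using torus_conj conj_conj_vec by (metis image_subsetI image_eqI subsetI subset_antisym)
  then have "(\<lambda>t. U ** diag (conj_vec t)) ` torus = (\<lambda>t. U ** diag t) ` torus"
    by (metis image_image)
  moreover have "cls right_torus_rel U = (\<lambda>t. U ** diag t) ` torus"
    using assms unfolding cls_def right_torus_rel_def by blast
  ultimately show ?thesis
    by (simp add: rho_right_def cls_pair_torus_rel[OF assms] image_image)
qed

end

theory Submission
  imports Defs
begin

text \<open>
  The proof has a geometric part and a measure-theoretic part.

  Geometry.  If all eigenvalues of \<open>Z ** adj Z\<close> are simple and positive, an orthonormal eigenbasis can be
  read off from the characteristic polynomial, and \<open>Z = U D(x) V\<close> with \<open>x\<close> in the chamber; the
  factors are unique up to the torus (\<open>svd_exists\<close>, \<open>svd_unique\<close>).  So \<open>polar_map\<close> is a bijection from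
  its domain onto the regular part of the ball.  That part is conull: a polynomial which does not vanish
  identically vanishes only on a null set (\<open>negligible_not_regular\<close>).

  Null sets.  The polar coordinates must be shown to respect null sets in both directions
  (\<open>AE_polar_base_iff\<close>).  Averaging Lebesgue measure over \<open>U(n) \<times> U(n)\<close> turns an arbitrary null set into
  one that depends on the singular values alone, and it remains to compare a set of singular values
  with the set of all matrices that have such singular values
  (\<open>negligible_svd_orbit_iff\<close>).  This comparison is local.  Near \<open>D(x)\<close> a chart built from two Cayley
  transforms has the singular values among its coordinates.  Its derivative at \<open>D(x)\<close> is injective
  since the \<open>x\<^sub>i\<close> are positive and distinct, so it is a local diffeomorphism, and null sets can be compared
  without the value of the Jacobian.

  Haar measure and quotients.  The Haar measure is introduced by a choice operator, so its
  existence has to be proved: it is the image of Lebesgue measure on the regular part of the ball under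
  \<open>U D(x) V \<mapsto> U V\<close>.  The Borel sets of the three torus quotients are handled
  through measurable sections, which normalise the phase of the first nonzero entry of each row.

  Invariant symbols.  For almost everywhere defined functions the conditions are linked in a
  cycle.  If \<open>a \<circ> polar_map\<close> is constant on the fibres of the projection \<open>\<rho>\<close>, then \<open>a\<close> is almost
  everywhere invariant under each single unitary matrix.  In that case the Haar average
  of \<open>a\<close> over the group orbits is invariant everywhere, and by Fubini it equals \<open>a\<close> almost
  everywhere; being invariant, it is a measurable function of \<open>\<rho>\<close>
  (\<open>ae_invariant_imp_factor\<close>).  A function of \<open>\<rho>\<close> gives back an invariant symbol, and an
  invariant symbol is constant on the fibres.  The argument and the resulting correspondence of
  \<open>L\<^sup>\<infinity>\<close> spaces use only a few properties of the action and the projection; they are stated once, in the locale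
  \<open>polar_quotient\<close>, which has the left and the right action as instances.
\<close>

no_notation fps_nth (infixl "$" 75)

section \<open>Matrices, unitary matrices and characteristic polynomials\<close>

lemma adj_nth [simp]: "adj A $ i $ j = cnj (A $ j $ i)"
  by (simp add: adj_def)

lemma adj_adj [simp]: "adj (adj A) = A"
  by (simp add: vec_eq_iff)

lemma adj_mult: "adj (A ** B) = adj B ** adj A"
  by (simp add: vec_eq_iff matrix_matrix_mult_def mult.commute)

lemma adj_mat_1 [simp]: "adj (mat 1) = mat 1"
  by (simp add: vec_eq_iff mat_def)

lemma adj_add: "adj (A + B) = adj A + adj B"
  by (simp add: vec_eq_iff)

lemma adj_diff: "adj (A - B) = adj A - adj B"
  by (simp add: vec_eq_iff)

lemma adj_diag: "adj (diag z) = diag (conj_vec z)"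
  by (simp add: vec_eq_iff diag_def conj_vec_def)

lemma conj_vec_nth [simp]: "conj_vec t $ i = cnj (t $ i)"
  by (simp add: conj_vec_def)

lemma adj_diag_real [simp]: "adj (diag_real x) = diag_real x"
  by (simp add: diag_real_def vec_eq_iff diag_def)

lemma diag_mult_left_nth [simp]: "(diag t ** A) $ i $ j = t $ i * A $ i $ j"
proof -
  have "(\<Sum>k\<in>UNIV. (if i = k then t $ i else 0) * A $ k $ j)
      = (\<Sum>k\<in>UNIV. if k = i then t $ i * A $ i $ j else 0)"
    by (rule sum.cong) auto
  then show ?thesis
    by (simp add: diag_def matrix_matrix_mult_def)
qed

lemma diag_mult_right_nth [simp]: "(A ** diag t) $ i $ j = A $ i $ j * t $ j"
proof -
  have "(\<Sum>k\<in>UNIV. A $ i $ k * (if k = j then t $ k else 0))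
      = (\<Sum>k\<in>UNIV. if k = j then A $ i $ j * t $ j else 0)"
    by (rule sum.cong) auto
  then show ?thesis
    by (simp add: diag_def matrix_matrix_mult_def)
qed

lemma diag_real_mult_left_nth [simp]: "(diag_real x ** A) $ i $ j = of_real (x $ i) * A $ i $ j"
  by (simp add: diag_real_def)

lemma diag_real_mult_right_nth [simp]: "(A ** diag_real x) $ i $ j = A $ i $ j * of_real (x $ j)"
  by (simp add: diag_real_def)

lemma diag_real_mult: "diag_real x ** diag_real y = diag_real (\<chi> i. x $ i * y $ i)"
  by (simp add: diag_real_def diag_mult)

lemma diag_1: "diag (\<chi> i. 1) = mat 1"
  by (auto simp: vec_eq_iff diag_def mat_def)

lemma diag_real_1: "diag_real (\<chi> i. 1) = mat 1"
  by (simp add: diag_real_def diag_1)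

lemma torus_cnj_mult:
  assumes "t \<in> torus"
  shows "cnj (t $ i) * t $ i = 1" "t $ i * cnj (t $ i) = 1"
  using assms complex_norm_square[of "t $ i"] by (simp_all add: torus_def mult.commute)

lemma diag_conj_cancel:
  assumes "t \<in> torus"
  shows "diag (conj_vec t) ** diag t = mat 1" "diag t ** diag (conj_vec t) = mat 1"
  by (simp_all add: diag_mult torus_cnj_mult[OF assms] diag_1)

lemma unitary_iff: "U \<in> unitary_group \<longleftrightarrow> adj U ** U = mat 1 \<and> U ** adj U = mat 1"
  by (simp add: unitary_group_def)

lemma unitaryI1:
  assumes "adj U ** U = mat 1" shows "U \<in> unitary_group"
  using assms matrix_left_right_inverse by (auto simp only: unitary_iff)

lemma unitaryI2:
  assumes "U ** adj U = mat 1" shows "U \<in> unitary_group"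
  using assms matrix_left_right_inverse by (auto simp only: unitary_iff)

lemma unitary_adj_left [simp]: "U \<in> unitary_group \<Longrightarrow> adj U ** U = mat 1"
  and unitary_adj_right [simp]: "U \<in> unitary_group \<Longrightarrow> U ** adj U = mat 1"
  by (simp_all only: unitary_iff)

lemma unitary_adj_left_assoc [simp]: "U \<in> unitary_group \<Longrightarrow> adj U ** (U ** A) = A"
  and unitary_adj_right_assoc [simp]: "U \<in> unitary_group \<Longrightarrow> U ** (adj U ** A) = A"
  by (simp_all add: matrix_mul_assoc)

lemma unitary_adj_left_assoc' [simp]: "U \<in> unitary_group \<Longrightarrow> A ** adj U ** U = A"
  and unitary_adj_right_assoc' [simp]: "U \<in> unitary_group \<Longrightarrow> A ** U ** adj U = A"
  by (simp_all flip: matrix_mul_assoc)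

lemma unitary_adj [simp]: "U \<in> unitary_group \<Longrightarrow> adj U \<in> unitary_group"
  by (simp only: unitary_iff adj_adj simp_thms conj_commute)

lemma unitary_1 [simp]: "mat 1 \<in> unitary_group"
  by (rule unitaryI1) simp

lemma unitary_mult [simp]:
  assumes "U \<in> unitary_group" "V \<in> unitary_group" shows "U ** V \<in> unitary_group"
proof (rule unitaryI1)
  have "adj (U ** V) ** (U ** V) = adj V ** (adj U ** (U ** V))"
    by (simp add: adj_mult matrix_mul_assoc)
  then show "adj (U ** V) ** (U ** V) = mat 1"
    using assms by simp
qed

lemma unitary_diag [simp]: "t \<in> torus \<Longrightarrow> diag t \<in> unitary_group"
  by (rule unitaryI1) (simp add: adj_diag diag_conj_cancel)

lemma unitary_transpose [simp]:
  assumes "U \<in> unitary_group" shows "transpose U \<in> unitary_group"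
proof (rule unitaryI1)
  have "adj (transpose U) ** transpose U = transpose (U ** adj U)"
    by (simp add: vec_eq_iff matrix_matrix_mult_def transpose_def mult.commute)
  then show "adj (transpose U) ** transpose U = mat 1"
    using assms by simp
qed

lemma norm_matrix_eq_trace: "complex_of_real ((norm A)\<^sup>2) = trace (A ** adj A)"
proof -
  have "complex_of_real ((norm A)\<^sup>2) = (\<Sum>i\<in>UNIV. \<Sum>j\<in>UNIV. of_real ((norm (A $ i $ j))\<^sup>2))"
    by (simp add: norm_vec_def L2_set_def sum_nonneg)
  also have "\<dots> = trace (A ** adj A)"
    by (simp only: complex_norm_square trace_def matrix_matrix_mult_def adj_nth vec_lambda_beta)
  finally show ?thesis .
qed

lemma norm_unitary_right [simp]:
  fixes A V :: "complex^'n^'n"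
  assumes "V \<in> unitary_group" shows "norm (A ** V) = norm A"
proof -
  have "(A ** V) ** adj (A ** V) = A ** adj A"
    using assms by (simp add: adj_mult matrix_mul_assoc)
  then have "complex_of_real ((norm (A ** V))\<^sup>2) = of_real ((norm A)\<^sup>2)"
    by (simp only: norm_matrix_eq_trace)
  then show ?thesis by (simp del: of_real_power)
qed

lemma norm_unitary_left [simp]:
  fixes A U :: "complex^'n^'n"
  assumes "U \<in> unitary_group" shows "norm (U ** A) = norm A"
proof -
  have "adj (U ** A) ** (U ** A) = adj A ** A"
    using assms by (simp add: adj_mult flip: matrix_mul_assoc)
  then have "complex_of_real ((norm (U ** A))\<^sup>2) = of_real ((norm A)\<^sup>2)"
    by (simp only: norm_matrix_eq_trace trace_mul_sym[of _ "adj _"])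
  then show ?thesis by (simp del: of_real_power)
qed

lemma adj_conj_diag: "adj (W ** diag_real y ** adj W) = W ** diag_real y ** adj W"
  by (simp add: adj_mult matrix_mul_assoc)

definition herm_form :: "complex^'n^'n \<Rightarrow> complex^'n \<Rightarrow> complex" where
  "herm_form A v = (\<Sum>i\<in>UNIV. cnj (v $ i) * (A *v v) $ i)"

lemma cinner_adj: "(\<Sum>i\<in>UNIV. cnj (u $ i) * (A *v v) $ i) = (\<Sum>i\<in>UNIV. cnj ((adj A *v u) $ i) * v $ i)"
proof -
  have "(\<Sum>i\<in>UNIV. cnj (u $ i) * (A *v v) $ i) = (\<Sum>i\<in>UNIV. \<Sum>j\<in>UNIV. cnj (u $ i) * (A $ i $ j * v $ j))"
    by (simp add: matrix_vector_mult_def sum_distrib_left)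
  also have "\<dots> = (\<Sum>j\<in>UNIV. \<Sum>i\<in>UNIV. cnj (u $ i) * (A $ i $ j * v $ j))"
    by (rule sum.swap)
  also have "\<dots> = (\<Sum>i\<in>UNIV. cnj ((adj A *v u) $ i) * v $ i)"
    by (simp add: matrix_vector_mult_def sum_distrib_right sum_distrib_left mult_ac)
  finally show ?thesis .
qed

lemma diag_real_vec: "diag_real y *v v = (\<chi> i. of_real (y $ i) * v $ i)"
proof -
  have "(\<Sum>j\<in>UNIV. (if i = j then complex_of_real (y $ i) else 0) * v $ j)
     = (\<Sum>j\<in>UNIV. if j = i then of_real (y $ i) * v $ i else 0)" for i
    by (rule sum.cong) auto
  moreover have "diag_real y $ i $ j = (if i = j then complex_of_real (y $ i) else 0)" for i j
    by (auto simp: diag_real_def diag_def)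
  ultimately show ?thesis
    by (simp add: matrix_vector_mult_def vec_eq_iff)
qed

text \<open>
  The values of the form in the orthonormal basis of the columns of \<open>W\<close>; positivity of
  \<open>Z ** adj Z\<close> and of \<open>1 - adj Z ** Z\<close> is read off from it.
\<close>

lemma herm_form_conj_diag:
  "herm_form (W ** diag_real y ** adj W) v = of_real (\<Sum>i\<in>UNIV. y $ i * (norm ((adj W *v v) $ i))\<^sup>2)"
proof -
  define w where "w = adj W *v v"
  have "herm_form (W ** diag_real y ** adj W) v = (\<Sum>i\<in>UNIV. cnj (v $ i) * (W *v (diag_real y *v w)) $ i)"
    by (simp add: herm_form_def w_def matrix_vector_mul_assoc matrix_mul_assoc)
  also have "\<dots> = (\<Sum>i\<in>UNIV. cnj (w $ i) * (diag_real y *v w) $ i)"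
    by (simp only: cinner_adj w_def)
  also have "\<dots> = (\<Sum>i\<in>UNIV. of_real (y $ i * (norm (w $ i))\<^sup>2))"
    by (rule sum.cong) (auto simp: diag_real_vec complex_norm_square simp del: of_real_power)
  finally show ?thesis by (simp add: w_def)
qed

lemma posdef_conj_diag:
  assumes W: "W \<in> unitary_group"
  shows "posdef (W ** diag_real y ** adj W) \<longleftrightarrow> (\<forall>i. 0 < y $ i)"
proof
  assume p: "posdef (W ** diag_real y ** adj W)"
  show "\<forall>i. 0 < y $ i"
  proof
    fix i
    define v where "v = W *v axis i 1"
    have v: "adj W *v v = axis i 1"
      using W by (simp add: v_def matrix_vector_mul_assoc)
    then have "v \<noteq> 0" by (metis axis_eq_0_iff matrix_vector_mult_0_right zero_neq_one)
    then have "0 < Re (herm_form (W ** diag_real y ** adj W) v)"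
      using p by (simp add: posdef_def herm_form_def)
    then have "0 < (\<Sum>j\<in>UNIV. y $ j * (norm ((axis i 1 :: complex^'a) $ j))\<^sup>2)"
      by (simp only: herm_form_conj_diag v Re_complex_of_real)
    also have "\<dots> = (\<Sum>j\<in>UNIV. if j = i then y $ i else 0)"
      by (rule sum.cong) (auto simp: axis_def)
    finally show "0 < y $ i" by simp
  qed
next
  assume y: "\<forall>i. 0 < y $ i"
  have "0 < Re (herm_form (W ** diag_real y ** adj W) v)" if "v \<noteq> 0" for v
  proof -
    have "adj W *v v \<noteq> 0"
      using W that by (metis matrix_vector_mul_assoc matrix_vector_mul_lid matrix_vector_mult_0_right unitary_adj_right)
    then obtain i where "(adj W *v v) $ i \<noteq> 0" by (metis vec_eq_iff zero_index)
    then have "0 < y $ i * (norm ((adj W *v v) $ i))\<^sup>2" using y by simp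
    also have "\<dots> \<le> (\<Sum>i\<in>UNIV. y $ i * (norm ((adj W *v v) $ i))\<^sup>2)"
      by (rule member_le_sum) (use y in \<open>auto simp: less_imp_le\<close>)
    finally show ?thesis by (simp only: herm_form_conj_diag Re_complex_of_real)
  qed
  then show "posdef (W ** diag_real y ** adj W)"
    by (simp add: posdef_def adj_conj_diag herm_form_def)
qed

lemma poly_det:
  fixes M :: "complex poly^'n^'n"
  shows "poly (det M) c = det (\<chi> i j. poly (M $ i $ j) c)"
  by (simp add: det_def poly_sum poly_prod)

lemma poly_char_poly: "poly (char_poly A) c = det (diag (\<chi> i. c) - A)"
  unfolding char_poly_def poly_det by (rule arg_cong[of _ _ det]) (simp add: vec_eq_iff diag_def)

lemma linear_mult: "[:a, b:] * q = smult a q + pCons 0 (smult b (q :: complex poly))"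
  by simp

text \<open>
  Used for the entries of \<open>t - A\<close>, all of degree at most one: their top coefficients form the
  identity matrix, so the characteristic polynomial inherits the leading coefficient
  \<open>det 1 = 1\<close>.
\<close>

lemma coeff_prod_linear:
  fixes f :: "'i \<Rightarrow> complex poly"
  assumes "finite I" "\<And>i. i \<in> I \<Longrightarrow> degree (f i) \<le> 1"
  shows "degree (\<Prod>i\<in>I. f i) \<le> card I \<and> coeff (\<Prod>i\<in>I. f i) (card I) = (\<Prod>i\<in>I. coeff (f i) 1)"
  using assms
proof (induction I rule: finite_induct)
  case (insert i I)
  let ?p = "\<Prod>i\<in>I. f i"
  have IH: "degree ?p \<le> card I" "coeff ?p (card I) = (\<Prod>i\<in>I. coeff (f i) 1)"
    using insert by auto
  have d: "degree (f i) \<le> 1" using insert by auto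
  have "f i = [:coeff (f i) 0, coeff (f i) 1:]"
    using d by (intro poly_eqI) (auto simp: coeff_pCons coeff_eq_0 split: nat.split)
  then have "f i * ?p = smult (coeff (f i) 0) ?p + pCons 0 (smult (coeff (f i) 1) ?p)"
    by (metis linear_mult)
  then have "coeff (f i * ?p) (1 + card I) = coeff (f i) 0 * coeff ?p (Suc (card I)) + coeff (f i) 1 * coeff ?p (card I)"
    by simp
  then have "coeff (f i * ?p) (1 + card I) = coeff (f i) 1 * coeff ?p (card I)"
    using IH(1) by (simp add: coeff_eq_0)
  moreover have "degree (f i * ?p) \<le> 1 + card I"
    by (rule order_trans[OF degree_mult_le]) (use IH d in linarith)
  ultimately show ?case using insert IH by simp
qed simp

lemma degree_char_poly: "degree (char_poly (A :: complex^'n^'n)) = CARD('n)"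
proof -
  define M :: "complex poly^'n^'n" where "M = (\<chi> i j. (if i = j then [:0, 1:] else 0) - [:A $ i $ j:])"
  have M_nth: "M $ i $ j = [:- A $ i $ j, if i = j then 1 else 0:]" for i j
    by (auto simp: M_def)
  have deg: "degree (M $ i $ j) \<le> 1" for i j
    by (simp only: M_nth degree_pCons_eq_if) simp
  have lead: "coeff (M $ i $ j) 1 = (mat 1 :: complex^'n^'n) $ i $ j" for i j
    by (simp add: M_nth mat_def)
  have pr: "\<And>p. degree (\<Prod>i\<in>UNIV. M $ i $ p i) \<le> CARD('n)"
      "\<And>p. coeff (\<Prod>i\<in>UNIV. M $ i $ p i) CARD('n) = (\<Prod>i\<in>UNIV. (mat 1 :: complex^'n^'n) $ i $ p i)"
    using coeff_prod_linear[OF finite_class.finite_UNIV, of "\<lambda>i. M $ i $ _ i"] deg lead by (simp_all only:)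
  have sgn: "of_int z * p = smult (of_int z) p" for z and p :: "complex poly"
    by (simp only: of_int_poly mult_pCons_left mult_zero_left pCons_0_0 add_0_right)
  have le: "degree (det M) \<le> CARD('n)"
    unfolding det_def sgn
    by (rule degree_sum_le) (auto simp: finite_permutations pr(1))
  have "coeff (det M) CARD('n) = det (mat 1 :: complex^'n^'n)"
    unfolding det_def sgn coeff_sum coeff_smult pr ..
  then have "coeff (det M) CARD('n) \<noteq> 0" by simp
  then have "CARD('n) \<le> degree (det M)" by (rule le_degree)
  with le show ?thesis by (simp add: char_poly_def M_def)
qed

lemma det_diag: "det (diag z) = (\<Prod>i\<in>UNIV. z $ i)"
  by (subst det_diagonal) (auto simp: diag_def)

lemma det_unitary_conj:
  assumes "W \<in> unitary_group" shows "det (W ** A ** adj W) = det A"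
proof -
  have "det W * det (adj W) = 1"
    using assms by (simp only: unitary_adj_right det_I flip: det_mul)
  moreover have "det (W ** A ** adj W) = (det W * det (adj W)) * det A"
    by (simp only: det_mul mult_ac)
  ultimately show ?thesis by simp
qed

lemma matrix_diff_ldistrib: "(A :: complex^'n^'n) ** (B - C) = A ** B - A ** C"
  by (simp add: vec_eq_iff matrix_matrix_mult_def algebra_simps sum_subtractf)

lemma matrix_diff_rdistrib: "((B :: complex^'n^'n) - C) ** A = B ** A - C ** A"
  by (simp add: vec_eq_iff matrix_matrix_mult_def algebra_simps sum_subtractf)

lemma scalar_diag_commute: "diag (\<chi> i. c) ** A = A ** diag (\<chi> i. c)"
  by (simp add: vec_eq_iff)

lemma char_poly_conj_diag:
  assumes W: "W \<in> unitary_group"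
  shows "char_poly (W ** diag_real y ** adj W) = (\<Prod>i\<in>UNIV. [:- of_real (y $ i), 1:])"
proof (subst poly_eq_poly_eq_iff[symmetric], rule ext)
  fix c
  have "diag (\<chi> i. c) - W ** diag_real y ** adj W = W ** (diag (\<chi> i. c) - diag_real y) ** adj W"
    using W by (simp add: matrix_diff_ldistrib matrix_diff_rdistrib scalar_diag_commute[of c W, symmetric])
  then have "poly (char_poly (W ** diag_real y ** adj W)) c = det (diag (\<chi> i. c) - diag_real y)"
    using W by (simp add: poly_char_poly det_unitary_conj)
  also have "diag (\<chi> i. c) - diag_real y = diag (\<chi> i. c - of_real (y $ i))"
    by (simp add: vec_eq_iff diag_def diag_real_def)
  finally show "poly (char_poly (W ** diag_real y ** adj W)) c = poly (\<Prod>i\<in>UNIV. [:- of_real (y $ i), 1:]) c"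
    by (simp add: det_diag poly_prod)
qed

section \<open>Singular value decomposition of regular matrices\<close>

lemma det_0_imp_kernel:
  fixes A :: "complex^'n^'n"
  assumes "det A = 0"
  obtains v where "v \<noteq> 0" "A *v v = 0"
proof -
  have "\<not> invertible A" using assms invertible_det_nz by blast
  then have "\<not> (\<exists>B. B ** A = mat 1)" by (simp add: invertible_left_inverse)
  then show ?thesis using matrix_left_invertible_ker[of A] that by blast
qed

lemma kernel_imp_det_0:
  fixes A :: "complex^'n^'n"
  assumes "v \<noteq> 0" "A *v v = 0"
  shows "det A = 0"
proof (rule ccontr)
  assume "det A \<noteq> 0"
  then have "\<exists>B. B ** A = mat 1" using invertible_det_nz invertible_left_inverse by blast
  then show False using matrix_left_invertible_ker[of A] assms by blast
qed

lemma scalar_diag_vec: "diag (\<chi> i. c) *v v = c *s v"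
proof -
  have "(\<Sum>j\<in>UNIV. (if i = j then c else 0) * v $ j) = (\<Sum>j\<in>UNIV. if j = i then c * v $ i else 0)" for i
    by (rule sum.cong) auto
  moreover have "diag (\<chi> i. c) $ i $ j = (if i = j then c else 0)" for i j :: 'a
    by (auto simp: diag_def)
  ultimately show ?thesis by (simp add: vec_eq_iff matrix_vector_mult_def)
qed

lemma char_poly_root_iff_eigenvalue:
  "poly (char_poly A) c = 0 \<longleftrightarrow> (\<exists>v. v \<noteq> 0 \<and> A *v v = c *s v)"
proof -
  have "(diag (\<chi> i. c) - A) *v v = 0 \<longleftrightarrow> A *v v = c *s v" for v
    by (auto simp: matrix_vector_mult_diff_rdistrib scalar_diag_vec)
  then show ?thesis
    unfolding poly_char_poly by (metis det_0_imp_kernel kernel_imp_det_0)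
qed

text \<open>
  Lists the eigenvalues in the order that the chamber prescribes: \<open>i\<close> receives the element of
  \<open>L\<close> that is exceeded by as many elements of \<open>L\<close> as \<open>i\<close> has predecessors.
\<close>

lemma decreasing_enumeration:
  fixes L :: "real set"
  assumes "finite L" "card L = CARD('n::{finite,linorder})"
  obtains f :: "'n::{finite,linorder} \<Rightarrow> real" where "\<And>i j. i < j \<Longrightarrow> f j < f i" "range f = L"
proof -
  define r where "r i = card {k. k < i}" for i :: 'n
  have r_mono: "r i < r j" if "i < j" for i j
    unfolding r_def using that by (intro psubset_card_mono) auto
  have r_less: "r i < CARD('n)" for i
    unfolding r_def by (intro psubset_card_mono) auto
  define ys where "ys = rev (sorted_list_of_set L)"
  have len: "length ys = CARD('n)" using assms by (simp add: ys_def)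
  have dec: "ys ! b < ys ! a" if "a < b" "b < length ys" for a b
  proof -
    have "sorted_wrt (<) (sorted_list_of_set L)" by (rule strict_sorted_list_of_set)
    then have "sorted_wrt (>) ys" by (simp add: ys_def sorted_wrt_rev)
    then show ?thesis using that sorted_wrt_nth_less by blast
  qed
  define f where "f i = ys ! r i" for i
  have f_dec: "f j < f i" if "i < j" for i j
    unfolding f_def by (rule dec) (use r_mono[OF that] r_less len in auto)
  have "f i \<in> L" for i
  proof -
    have "f i \<in> set ys" using r_less len by (simp add: f_def)
    then show ?thesis using assms by (simp add: ys_def)
  qed
  then have sub: "range f \<subseteq> L" by auto
  have "inj f"
    by (rule linorder_injI) (use f_dec in force)
  then have "card (range f) = card L" using assms by (simp add: card_image)
  then have "range f = L" using sub assms card_subset_eq by blast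
  with f_dec show ?thesis by (rule that)
qed

text \<open>
  The position of a value is the number of larger values, which depends on the range alone.
\<close>

lemma decreasing_enumeration_unique:
  fixes f g :: "'n::{finite,linorder} \<Rightarrow> real"
  assumes f: "\<And>i j. i < j \<Longrightarrow> f j < f i" and g: "\<And>i j. i < j \<Longrightarrow> g j < g i" and r: "range f = range g"
  shows "f = g"
proof -
  have inj: "inj f" "inj g" by (rule linorder_injI, use f g in force)+
  have rank: "card {y \<in> range h. h i < y} = card {k. k < i}" if h: "\<And>i j. i < j \<Longrightarrow> h j < h i" "inj h"
    for h :: "'n \<Rightarrow> real" and i
  proof -
    have "h i < h k \<longleftrightarrow> k < i" for k
      using h(1) by (metis less_asym linorder_neqE)
    then have "{y \<in> range h. h i < y} = h ` {k. k < i}" by auto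
    then show ?thesis using h(2) by (simp add: card_image inj_on_subset)
  qed
  have r_inj: "i = j" if "card {k. k < i} = card {k. k < j}" for i j :: 'n
  proof (rule ccontr)
    assume "i \<noteq> j"
    then consider "i < j" | "j < i" by fastforce
    then show False
    proof cases
      case 1 then have "{k. k < i} \<subset> {k. k < j}" by auto
      then show False using that psubset_card_mono[of "{k. k < j}" "{k. k < i}"] by simp
    next
      case 2 then have "{k. k < j} \<subset> {k. k < i}" by auto
      then show False using that psubset_card_mono[of "{k. k < i}" "{k. k < j}"] by simp
    qed
  qed
  show ?thesis
  proof
    fix i
    obtain j where j: "f i = g j" using r by (metis rangeE rangeI)
    have "card {k. k < i} = card {k. k < j}"
      using rank[OF f inj(1), of i] rank[OF g inj(2), of j] r j by simp
    then show "f i = g i" using r_inj j by blast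
  qed
qed

lemma chamber_inj: "x \<in> chamber \<Longrightarrow> x $ i = x $ j \<Longrightarrow> i = j"
  by (cases i j rule: linorder_cases) (force simp: chamber_def)+

lemma order_prod_linear_factors:
  fixes y :: "'n::finite \<Rightarrow> complex"
  assumes "inj y" "poly (\<Prod>i\<in>UNIV. [:- y i, 1:]) c = 0"
  shows "order c (\<Prod>i\<in>UNIV. [:- y i, 1:]) = 1"
proof -
  obtain j where j: "y j = c" using assms(2) by (auto simp: poly_prod)
  define Q where "Q = (\<Prod>i\<in>UNIV - {j}. [:- y i, 1:])"
  have P: "(\<Prod>i\<in>UNIV. [:- y i, 1:]) = [:- c, 1:] * Q"
    unfolding Q_def j[symmetric] by (rule prod.remove) auto
  have "poly Q c \<noteq> 0"
    using assms(1) j by (auto simp: Q_def poly_prod inj_eq)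
  then have "order c Q = 0" by (rule order_0I)
  moreover have "Q \<noteq> 0" using \<open>poly Q c \<noteq> 0\<close> by auto
  moreover have "order c [:- c, 1:] = 1" using order_power_n_n[of c 1] by simp
  moreover have "[:- c, 1:] * Q \<noteq> 0" using \<open>Q \<noteq> 0\<close> by (simp only: mult_eq_0_iff) simp
  ultimately show ?thesis unfolding P by (metis order_mult add.right_neutral)
qed

lemma svd_mult_adj:
  assumes "U \<in> unitary_group" "V \<in> unitary_group"
  shows "(U ** diag_real x ** V) ** adj (U ** diag_real x ** V) = U ** diag_real (\<chi> i. (x $ i)\<^sup>2) ** adj U"
    "mat 1 - adj (U ** diag_real x ** V) ** (U ** diag_real x ** V)
      = adj V ** diag_real (\<chi> i. 1 - (x $ i)\<^sup>2) ** adj (adj V)"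
proof -
  have "(U ** diag_real x ** V) ** adj (U ** diag_real x ** V) = U ** (diag_real x ** diag_real x) ** adj U"
    using assms by (simp add: adj_mult matrix_mul_assoc)
  then show "(U ** diag_real x ** V) ** adj (U ** diag_real x ** V) = U ** diag_real (\<chi> i. (x $ i)\<^sup>2) ** adj U"
    by (simp add: diag_real_mult power2_eq_square)
  have "adj (U ** diag_real x ** V) ** (U ** diag_real x ** V) = adj V ** (diag_real x ** diag_real x) ** V"
    using assms by (simp add: adj_mult flip: matrix_mul_assoc)
  then have 1: "adj (U ** diag_real x ** V) ** (U ** diag_real x ** V) = adj V ** diag_real (\<chi> i. (x $ i)\<^sup>2) ** V"
    by (simp add: diag_real_mult power2_eq_square)
  have "diag_real (\<chi> i. 1 - (x $ i)\<^sup>2) = mat 1 - diag_real (\<chi> i. (x $ i)\<^sup>2)"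
    by (simp add: vec_eq_iff diag_real_def diag_def mat_def)
  then show "mat 1 - adj (U ** diag_real x ** V) ** (U ** diag_real x ** V)
      = adj V ** diag_real (\<chi> i. 1 - (x $ i)\<^sup>2) ** adj (adj V)"
    using assms by (simp add: 1 matrix_diff_ldistrib matrix_diff_rdistrib)
qed

definition regular_ball :: "('n::{finite,linorder}) cmat set" where
  "regular_ball = matrix_ball \<inter> regular_matrices"

lemma svd_in_regular_ball:
  assumes U: "U \<in> unitary_group" and V: "V \<in> unitary_group" and x: "x \<in> chamber"
  shows "U ** diag_real x ** V \<in> regular_ball"
proof -
  have x01: "0 < x $ i" "x $ i < 1" for i using x by (auto simp: chamber_def)
  have "posdef (adj V ** diag_real (\<chi> i. 1 - (x $ i)\<^sup>2) ** adj (adj V))"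
    using V x01 by (subst posdef_conj_diag) (auto simp: abs_square_less_1 abs_less_iff intro: less_trans[of _ 0])
  then have 1: "U ** diag_real x ** V \<in> matrix_ball"
    unfolding matrix_ball_def mem_Collect_eq svd_mult_adj[OF U V] .
  have inj: "inj (\<lambda>i. complex_of_real ((\<chi> i. (x $ i)\<^sup>2) $ i))"
  proof (rule injI)
    fix i j assume "complex_of_real ((\<chi> i. (x $ i)\<^sup>2) $ i) = complex_of_real ((\<chi> i. (x $ i)\<^sup>2) $ j)"
    then have "(x $ i)\<^sup>2 = (x $ j)\<^sup>2" by (simp del: of_real_power)
    then have "x $ i = x $ j" using x01 by (simp add: power2_eq_iff_nonneg less_imp_le)
    then show "i = j" using chamber_inj x by blast
  qed
  have "posdef (U ** diag_real (\<chi> i. (x $ i)\<^sup>2) ** adj U)"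
    using U x01(1) less_imp_neq by (subst posdef_conj_diag) fastforce+
  then have "U ** diag_real x ** V \<in> regular_matrices"
    unfolding regular_matrices_def mem_Collect_eq svd_mult_adj[OF U V] char_poly_conj_diag[OF U]
    using order_prod_linear_factors[OF inj] by blast
  with 1 show ?thesis by (simp add: regular_ball_def)
qed

lemma inner_eigenvectors:
  fixes A :: "complex^'n^'n"
  assumes "adj A = A" "A *v v = c *s v" "A *v w = d *s w"
  shows "d * (\<Sum>i\<in>UNIV. cnj (v $ i) * w $ i) = cnj c * (\<Sum>i\<in>UNIV. cnj (v $ i) * w $ i)"
proof -
  have "(\<Sum>i\<in>UNIV. cnj (v $ i) * (A *v w) $ i) = (\<Sum>i\<in>UNIV. cnj ((A *v v) $ i) * w $ i)"
    using cinner_adj[of v A w] assms(1) by simp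
  then show ?thesis
    unfolding assms(2,3) by (simp add: sum_distrib_left mult_ac)
qed

lemma cinner_self: "(\<Sum>i\<in>UNIV. cnj (v $ i) * v $ i) = complex_of_real ((norm v)\<^sup>2)"
proof -
  have "complex_of_real ((norm v)\<^sup>2) = (\<Sum>i\<in>UNIV. of_real ((norm (v $ i))\<^sup>2))"
    by (simp add: norm_vec_def L2_set_def sum_nonneg)
  then show ?thesis by (simp only: complex_norm_square mult.commute)
qed

lemma hermitian_eigenvalue_real:
  fixes A :: "complex^'n^'n"
  assumes "adj A = A" "A *v v = c *s v" "v \<noteq> 0"
  shows "c \<in> \<real>"
proof -
  have "(\<Sum>i\<in>UNIV. cnj (v $ i) * v $ i) \<noteq> 0"
    using assms(3) by (simp add: cinner_self)
  then have "c = cnj c" using inner_eigenvectors[OF assms(1,2,2)] by simp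
  then show ?thesis by (simp add: Reals_cnj_iff)
qed

text \<open>
  With \<open>n\<close> distinct roots there are \<open>n\<close> eigenvectors, and for a Hermitian matrix eigenvectors
  to different eigenvalues are orthogonal.  So the simplicity of the spectrum replaces the
  spectral theorem.
\<close>

lemma hermitian_simple_spectrum_diagonalizable:
  fixes A :: "('n::{finite,linorder}) cmat"
  assumes herm: "adj A = A"
    and simple: "\<And>c. poly (char_poly A) c = 0 \<Longrightarrow> order c (char_poly A) = 1"
  obtains U f where "U \<in> unitary_group" "A = U ** diag_real f ** adj U" "\<And>i j. i < j \<Longrightarrow> f $ j < f $ i"
proof -
  define p where "p = char_poly A"
  define R where "R = {c. poly p c = 0}"
  have deg: "degree p = CARD('n)" by (simp add: p_def degree_char_poly)
  then have p0: "p \<noteq> 0" by auto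
  have "degree p = size (proots p)" by (simp add: size_proots_complex)
  also have "\<dots> = (\<Sum>c\<in>R. order c p)"
    using p0 by (simp add: size_multiset_overloaded_eq R_def)
  also have "\<dots> = card R"
    using simple by (simp add: R_def p_def)
  finally have cardR: "card R = CARD('n)" using deg by simp
  have finR: "finite R" using p0 by (simp add: R_def poly_roots_finite)
  have eig: "\<exists>v. v \<noteq> 0 \<and> A *v v = c *s v" if "c \<in> R" for c
    using that by (simp add: R_def p_def char_poly_root_iff_eigenvalue)
  have real: "c \<in> \<real>" if "c \<in> R" for c
    using eig[OF that] hermitian_eigenvalue_real[OF herm] by blast
  have "inj_on Re R" using real by (metis inj_onI of_real_Re)
  then have "card (Re ` R) = CARD('n)" using cardR by (simp add: card_image)
  then obtain f :: "'n \<Rightarrow> real" where f: "\<And>i j. i < j \<Longrightarrow> f j < f i" "range f = Re ` R"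
    using decreasing_enumeration finR by (metis finite_imageI)
  have fR: "of_real (f i) \<in> R" for i
  proof -
    have "f i \<in> Re ` R" using f(2) by blast
    then show ?thesis using real by (metis imageE of_real_Re)
  qed
  define w where "w i = (SOME v. v \<noteq> 0 \<and> A *v v = of_real (f i) *s v)" for i
  have w: "w i \<noteq> 0" "A *v w i = of_real (f i) *s w i" for i
    using someI_ex[OF eig[OF fR]] by (auto simp: w_def)
  define u where "u i = of_real (inverse (norm (w i))) *s w i" for i
  have u: "A *v u i = of_real (f i) *s u i" for i
    by (simp add: u_def vector_scalar_commute w mult.commute)
  have u_norm: "(\<Sum>k\<in>UNIV. cnj (u i $ k) * u i $ k) = 1" for i
  proof -
    have "(\<Sum>k\<in>UNIV. cnj (u i $ k) * u i $ k)
      = of_real ((inverse (norm (w i)))\<^sup>2) * (\<Sum>k\<in>UNIV. cnj (w i $ k) * w i $ k)"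
      by (simp add: u_def sum_distrib_left power2_eq_square mult_ac)
    also have "\<dots> = of_real ((inverse (norm (w i)))\<^sup>2 * (norm (w i))\<^sup>2)"
      by (simp only: cinner_self of_real_mult)
    also have "\<dots> = 1" using w(1)[of i] by (simp add: field_simps)
    finally show ?thesis .
  qed
  have orth: "(\<Sum>k\<in>UNIV. cnj (u i $ k) * u j $ k) = 0" if "i \<noteq> j" for i j
  proof -
    have "f i \<noteq> f j" using f(1) that by (metis linorder_neqE order_less_irrefl)
    moreover have "of_real (f j) * (\<Sum>k\<in>UNIV. cnj (u i $ k) * u j $ k)
        = cnj (of_real (f i)) * (\<Sum>k\<in>UNIV. cnj (u i $ k) * u j $ k)"
      by (rule inner_eigenvectors[OF herm u u])
    ultimately show ?thesis by auto
  qed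
  define U where "U = (\<chi> r i. u i $ r)"
  have "adj U ** U = mat 1"
    by (auto simp: vec_eq_iff matrix_matrix_mult_def U_def mat_def u_norm orth)
  then have U: "U \<in> unitary_group" by (rule unitaryI1)
  have "A ** U = U ** diag_real (\<chi> i. f i)"
  proof -
    have "(A ** U) $ r $ i = (A *v u i) $ r" for r i
      by (simp add: matrix_matrix_mult_def matrix_vector_mult_def U_def)
    then show ?thesis by (simp add: vec_eq_iff u U_def mult.commute)
  qed
  then have "A = U ** diag_real (\<chi> i. f i) ** adj U"
    using U by (metis unitary_adj_right_assoc')
  then show ?thesis using that U f(1) by (metis vec_lambda_beta)
qed

text \<open>
  Diagonalise \<open>Z ** adj Z = U D(x\<^sup>2) adj U\<close> and put \<open>V = D(x)\<^sup>-\<^sup>1 adj U Z\<close>; this matrix is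
  unitary, and membership in the ball says \<open>1 - x\<^sup>2 > 0\<close>.
\<close>

lemma svd_exists:
  fixes Z :: "('n::{finite,linorder}) cmat"
  assumes Z: "Z \<in> regular_ball"
  obtains U V x where "U \<in> unitary_group" "V \<in> unitary_group" "x \<in> chamber" "Z = U ** diag_real x ** V"
proof -
  have pd: "posdef (Z ** adj Z)"
    and simple: "\<And>c. poly (char_poly (Z ** adj Z)) c = 0 \<Longrightarrow> order c (char_poly (Z ** adj Z)) = 1"
    using Z by (auto simp: regular_ball_def regular_matrices_def)
  have "adj (Z ** adj Z) = Z ** adj Z" by (simp add: adj_mult)
  then obtain U f where U: "U \<in> unitary_group" and A: "Z ** adj Z = U ** diag_real f ** adj U"
    and f: "\<And>i j. i < j \<Longrightarrow> f $ j < f $ i"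
    using hermitian_simple_spectrum_diagonalizable simple by metis
  have fpos: "0 < f $ i" for i using pd U by (simp add: A posdef_conj_diag)
  define x where "x = (\<chi> i. sqrt (f $ i))"
  have xpos: "0 < x $ i" for i using fpos by (simp add: x_def)
  have xsq: "(x $ i)\<^sup>2 = f $ i" for i using fpos[of i] by (simp add: x_def)
  \<comment> \<open>\<open>D(y)\<close> is the inverse of \<open>D(x)\<close>.\<close>
  define y where "y = (\<chi> i. inverse (x $ i))"
  have xy: "diag_real x ** diag_real y = mat 1" "diag_real y ** diag_real x = mat 1"
    using xpos by (simp_all add: diag_real_mult y_def less_imp_neq[symmetric] flip: diag_real_1)
  define V where "V = diag_real y ** adj U ** Z"
  have "V ** adj V = diag_real y ** adj U ** (Z ** adj Z) ** U ** diag_real y"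
    by (simp add: V_def adj_mult matrix_mul_assoc)
  also have "\<dots> = diag_real y ** (adj U ** U) ** diag_real f ** (adj U ** U) ** diag_real y"
    by (simp only: A matrix_mul_assoc)
  also have "\<dots> = diag_real y ** diag_real f ** diag_real y"
    using U by simp
  also have "diag_real f = diag_real x ** diag_real x"
    by (simp add: diag_real_mult x_def fpos less_imp_le)
  also have "diag_real y ** (diag_real x ** diag_real x) ** diag_real y = mat 1"
    by (metis matrix_mul_assoc matrix_mul_lid xy)
  finally have V: "V \<in> unitary_group" by (rule unitaryI2)
  have "U ** diag_real x ** V = U ** (diag_real x ** diag_real y) ** adj U ** Z"
    by (simp add: V_def matrix_mul_assoc)
  also have "\<dots> = Z" using U by (simp add: xy)
  finally have eq: "Z = U ** diag_real x ** V" ..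
  have "posdef (mat 1 - adj Z ** Z)" using Z by (simp add: regular_ball_def matrix_ball_def)
  then have "posdef (adj V ** diag_real (\<chi> i. 1 - (x $ i)\<^sup>2) ** adj (adj V))"
    unfolding eq svd_mult_adj[OF U V] .
  then have "0 < 1 - (x $ i)\<^sup>2" for i using V posdef_conj_diag[of "adj V"] by simp
  then have "x $ i < 1" for i
    using xpos[of i] by (smt (verit) one_le_power)
  then have "x \<in> chamber" using xpos f by (auto simp: chamber_def x_def)
  then show ?thesis using that U V eq by blast
qed

text \<open>
  The eigenvalues of \<open>Z ** adj Z\<close> determine \<open>x\<close>.  Then \<open>adj U ** U'\<close> commutes with a diagonal
  matrix that has distinct entries, hence is itself diagonal, and unitary.
\<close>

lemma svd_unique:
  fixes x x' :: "real^'n::{finite,linorder}"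
  assumes U: "U \<in> unitary_group" and V: "V \<in> unitary_group" and U': "U' \<in> unitary_group" and V': "V' \<in> unitary_group"
    and x: "x \<in> chamber" and x': "x' \<in> chamber"
    and eq: "U ** diag_real x ** V = U' ** diag_real x' ** V'"
  obtains t where "x = x'" "t \<in> torus" "U' = U ** diag (conj_vec t)" "V' = diag t ** V"
proof -
  define y where "y = (\<chi> i. (x $ i)\<^sup>2)"
  define y' where "y' = (\<chi> i. (x' $ i)\<^sup>2)"
  have A: "U ** diag_real y ** adj U = U' ** diag_real y' ** adj U'"
    using svd_mult_adj(1)[OF U V, of x] svd_mult_adj(1)[OF U' V', of x'] eq by (simp add: y_def y'_def)
  have xpos: "0 < x $ i" "0 < x' $ i" for i using x x' by (auto simp: chamber_def)
  have dec: "y $ j < y $ i" "y' $ j < y' $ i" if "i < j" for i j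
    using that x x' xpos by (auto simp: y_def y'_def chamber_def intro!: power_strict_mono less_imp_le)
  have "range (\<lambda>i. complex_of_real (y $ i)) = {c. poly (char_poly (U ** diag_real y ** adj U)) c = 0}"
    using U by (auto simp: char_poly_conj_diag poly_prod)
  also have "\<dots> = range (\<lambda>i. complex_of_real (y' $ i))"
    unfolding A using U' by (auto simp: char_poly_conj_diag poly_prod)
  finally have "Re ` range (\<lambda>i. complex_of_real (y $ i)) = Re ` range (\<lambda>i. complex_of_real (y' $ i))" by simp
  then have "range (\<lambda>i. y $ i) = range (\<lambda>i. y' $ i)" by (simp add: image_image)
  then have "(\<lambda>i. y $ i) = (\<lambda>i. y' $ i)" by (rule decreasing_enumeration_unique[rotated 2]) (use dec in auto)
  then have yy: "y = y'" by (simp add: vec_eq_iff fun_eq_iff)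
  then have "(x $ i)\<^sup>2 = (x' $ i)\<^sup>2" for i by (simp add: y_def y'_def vec_eq_iff)
  then have xx: "x = x'" using xpos by (simp add: vec_eq_iff power2_eq_iff_nonneg less_imp_le)
  define T where "T = adj U ** U'"
  have T: "T \<in> unitary_group" using U U' by (simp add: T_def)
  have "T ** diag_real y = adj U ** (U' ** diag_real y ** adj U') ** U'"
    using U' by (simp add: T_def flip: matrix_mul_assoc)
  also have "\<dots> = adj U ** (U ** diag_real y ** adj U) ** U'" using A yy by simp
  also have "\<dots> = diag_real y ** T"
    using U by (simp add: T_def flip: matrix_mul_assoc)
  finally have comm: "T ** diag_real y = diag_real y ** T" .
  define s where "s = (\<chi> i. T $ i $ i)"
  have Tij: "T $ i $ j = 0" if "i \<noteq> j" for i j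
  proof -
    have "(T ** diag_real y) $ i $ j = (diag_real y ** T) $ i $ j" by (simp only: comm)
    then have "T $ i $ j * of_real (y $ j) = of_real (y $ i) * T $ i $ j" by simp
    moreover have "y $ i \<noteq> y $ j" using dec that by (metis linorder_neqE order_less_irrefl)
    ultimately show ?thesis by auto
  qed
  have Ts: "T = diag s"
    using Tij by (auto simp: vec_eq_iff diag_def s_def)
  have "norm (s $ i) = 1" for i
  proof -
    have "(adj T ** T) $ i $ i = cnj (s $ i) * s $ i"
      unfolding Ts adj_diag diag_mult by (simp add: diag_def)
    then have "cnj (s $ i) * s $ i = 1" using T by (simp add: mat_def)
    then have "(norm (s $ i))\<^sup>2 = 1"
      by (metis complex_norm_square mult.commute of_real_eq_1_iff)
    then show ?thesis by (metis norm_ge_zero one_power2 power2_eq_iff_nonneg zero_le_one)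
  qed
  then have s: "s \<in> torus" by (simp add: torus_def)
  have U'eq: "U' = U ** diag s"
    using U by (simp add: T_def flip: Ts)
  have "diag_real x ** V = adj U ** (U ** diag_real x ** V)"
    using U by (simp flip: matrix_mul_assoc)
  also have "\<dots> = diag s ** diag_real x ** V'"
    using U unfolding eq xx[symmetric] U'eq by (simp flip: matrix_mul_assoc)
  finally have DV: "diag_real x ** V = diag s ** diag_real x ** V'" .
  have "V $ i $ j = s $ i * V' $ i $ j" for i j
  proof -
    have "(diag_real x ** V) $ i $ j = (diag s ** diag_real x ** V') $ i $ j" by (simp only: DV)
    then have "of_real (x $ i) * V $ i $ j = of_real (x $ i) * (s $ i * V' $ i $ j)"
      by (simp add: mult_ac flip: matrix_mul_assoc)
    then show ?thesis using xpos(1)[of i] by simp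
  qed
  then have "V = diag s ** V'" by (simp add: vec_eq_iff)
  then have "V' = diag (conj_vec s) ** V"
    by (simp add: diag_conj_cancel[OF s] matrix_mul_assoc)
  then show ?thesis
    using that[of "conj_vec s"] xx s U'eq by (simp add: torus_conj conj_conj_vec)
qed

section \<open>Torus orbits and polar coordinates\<close>

text \<open>
  All three relations are orbit relations of the torus; this gives the three equivalence proofs
  at once.
\<close>

lemma equiv_torus_orbits:
  fixes act :: "complex^'n \<Rightarrow> 'a \<Rightarrow> 'a"
  assumes closed: "\<And>t s. t \<in> torus \<Longrightarrow> s \<in> S \<Longrightarrow> act t s \<in> S"
    and one: "\<And>s. s \<in> S \<Longrightarrow> act (\<chi> i. 1) s = s"
    and mult: "\<And>t u s. t \<in> torus \<Longrightarrow> u \<in> torus \<Longrightarrow> s \<in> S \<Longrightarrow> act t (act u s) = act (\<chi> i. t $ i * u $ i) s"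
  shows "equiv S {(s, s'). s \<in> S \<and> (\<exists>t\<in>torus. s' = act t s)}"
proof (rule equivI)
  show "{(s, s'). s \<in> S \<and> (\<exists>t\<in>torus. s' = act t s)} \<subseteq> S \<times> S"
    using closed by blast
  show "refl_on S {(s, s'). s \<in> S \<and> (\<exists>t\<in>torus. s' = act t s)}"
    by (rule refl_onI) (use one ones_torus in force)
  show "sym {(s, s'). s \<in> S \<and> (\<exists>t\<in>torus. s' = act t s)}"
  proof (rule symI)
    fix s s' assume "(s, s') \<in> {(s, s'). s \<in> S \<and> (\<exists>t\<in>torus. s' = act t s)}"
    then obtain t where s: "s \<in> S" and t: "t \<in> torus" and s': "s' = act t s" by blast
    have "act (conj_vec t) s' = s"
      unfolding s' mult[OF torus_conj[OF t] t s] by (simp add: torus_cnj_mult[OF t] one s)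
    then have "s = act (conj_vec t) s'" ..
    moreover have "s' \<in> S" using closed[OF t s] s' by simp
    ultimately show "(s', s) \<in> {(s, s'). s \<in> S \<and> (\<exists>t\<in>torus. s' = act t s)}"
      using torus_conj[OF t] by blast
  qed
  show "trans {(s, s'). s \<in> S \<and> (\<exists>t\<in>torus. s' = act t s)}"
  proof (rule transI)
    fix s s' s'' assume "(s, s') \<in> {(s, s'). s \<in> S \<and> (\<exists>t\<in>torus. s' = act t s)}"
      "(s', s'') \<in> {(s, s'). s \<in> S \<and> (\<exists>t\<in>torus. s' = act t s)}"
    then obtain t u where s: "s \<in> S" and tu: "t \<in> torus" "u \<in> torus" and s'': "s'' = act t (act u s)" by blast
    have "(\<chi> i. t $ i * u $ i) \<in> torus" using tu by (simp add: torus_def norm_mult)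
    then show "(s, s'') \<in> {(s, s'). s \<in> S \<and> (\<exists>t\<in>torus. s' = act t s)}"
      using s mult[OF tu s] s'' by blast
  qed
qed

lemma equiv_pair_torus_rel: "equiv (unitary_group \<times> unitary_group)
  (pair_torus_rel :: ((('n::finite) cmat \<times> 'n cmat) \<times> ('n cmat \<times> 'n cmat)) set)"
proof -
  define act :: "complex^'n \<Rightarrow> 'n cmat \<times> 'n cmat \<Rightarrow> 'n cmat \<times> 'n cmat"
    where "act t p = (fst p ** diag (conj_vec t), diag t ** snd p)" for t p
  have "equiv (unitary_group \<times> unitary_group) {(s, s'). s \<in> unitary_group \<times> unitary_group \<and> (\<exists>t\<in>torus. s' = act t s)}"
  proof (rule equiv_torus_orbits)
    show "act t p \<in> unitary_group \<times> unitary_group" if "t \<in> torus" "p \<in> unitary_group \<times> unitary_group" for t p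
      using that by (auto simp: act_def torus_conj)
    show "act (\<chi> i. 1) p = p" for p
      by (simp add: act_def prod_eq_iff vec_eq_iff)
    show "act t (act u p) = act (\<chi> i. t $ i * u $ i) p" for t u p
      by (simp add: act_def prod_eq_iff vec_eq_iff)
  qed
  moreover have "{(s, s'). s \<in> unitary_group \<times> unitary_group \<and> (\<exists>t\<in>torus. s' = act t s)} = pair_torus_rel"
    by (auto simp: pair_torus_rel_def act_def)
  ultimately show ?thesis by simp
qed

lemma equiv_left_torus_rel: "equiv unitary_group (left_torus_rel :: (('n::finite) cmat \<times> 'n cmat) set)"
proof -
  have "equiv unitary_group {(s, s'). s \<in> unitary_group \<and> (\<exists>t\<in>torus. s' = diag t ** (s :: 'n cmat))}"
    by (rule equiv_torus_orbits) (simp_all add: vec_eq_iff)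
  then show ?thesis by (simp add: left_torus_rel_def)
qed

lemma equiv_right_torus_rel: "equiv unitary_group (right_torus_rel :: (('n::finite) cmat \<times> 'n cmat) set)"
proof -
  have "equiv unitary_group {(s, s'). s \<in> unitary_group \<and> (\<exists>t\<in>torus. s' = (s :: 'n cmat) ** diag t)}"
    by (rule equiv_torus_orbits) (simp_all add: vec_eq_iff)
  then show ?thesis by (simp add: right_torus_rel_def)
qed

lemma polar_domainI:
  "U \<in> unitary_group \<Longrightarrow> V \<in> unitary_group \<Longrightarrow> x \<in> chamber \<Longrightarrow> (cls pair_torus_rel (U, V), x) \<in> polar_domain"
  unfolding polar_domain_def cls_def by (auto intro: quotientI)

lemma polar_domainE:
  assumes "p \<in> polar_domain"
  obtains U V x where "U \<in> unitary_group" "V \<in> unitary_group" "x \<in> chamber" "p = (cls pair_torus_rel (U, V), x)"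
  using assms unfolding polar_domain_def cls_def by (auto elim!: quotientE)

lemma bij_betw_polar_map: "bij_betw polar_map polar_domain (regular_ball :: ('n::{finite,linorder}) cmat set)"
proof (rule bij_betw_imageI)
  show "inj_on polar_map (polar_domain :: ((('n cmat \<times> 'n cmat) set) \<times> 'n rvec) set)"
  proof (rule inj_onI)
    fix p q :: "(('n cmat \<times> 'n cmat) set) \<times> 'n rvec"
    assume p: "p \<in> polar_domain" and q: "q \<in> polar_domain" and eq: "polar_map p = polar_map q"
    obtain U V x where p: "U \<in> unitary_group" "V \<in> unitary_group" "x \<in> chamber" "p = (cls pair_torus_rel (U, V), x)"
      using p by (rule polar_domainE)
    obtain U' V' x' where q: "U' \<in> unitary_group" "V' \<in> unitary_group" "x' \<in> chamber" "q = (cls pair_torus_rel (U', V'), x')"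
      using q by (rule polar_domainE)
    have "U ** diag_real x ** V = U' ** diag_real x' ** V'"
      using eq p q by (simp add: polar_map_cls)
    then obtain t where t: "x = x'" "t \<in> torus" "U' = U ** diag (conj_vec t)" "V' = diag t ** V"
      using svd_unique p q by metis
    then have "((U, V), (U', V')) \<in> pair_torus_rel"
      using p by (auto simp: pair_torus_rel_def)
    then have "cls pair_torus_rel (U, V) = cls pair_torus_rel (U', V')"
      unfolding cls_def by (rule equiv_class_eq[OF equiv_pair_torus_rel])
    then show "p = q" using p q t by simp
  qed
  show "polar_map ` polar_domain = (regular_ball :: 'n cmat set)"
  proof (intro subset_antisym subsetI)
    fix Z :: "'n cmat" assume "Z \<in> polar_map ` polar_domain"
    then show "Z \<in> regular_ball"
      by (auto elim!: polar_domainE simp: polar_map_cls dest: svd_in_regular_ball)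
  next
    fix Z :: "'n cmat" assume "Z \<in> regular_ball"
    then obtain U V x where "U \<in> unitary_group" "V \<in> unitary_group" "x \<in> chamber" "Z = U ** diag_real x ** V"
      by (rule svd_exists)
    then show "Z \<in> polar_map ` polar_domain"
      by (metis imageI polar_domainI polar_map_cls)
  qed
qed

lemma polar_map_in: "p \<in> polar_domain \<Longrightarrow> polar_map p \<in> regular_ball"
  using bij_betw_polar_map bij_betwE by blast

lemma polar_inv_in: "Z \<in> regular_ball \<Longrightarrow> polar_inv Z \<in> polar_domain"
  unfolding polar_inv_def using bij_betw_polar_map by (metis bij_betw_def order_refl the_inv_into_into)

lemma polar_inv_polar_map: "p \<in> polar_domain \<Longrightarrow> polar_inv (polar_map p) = p"
  unfolding polar_inv_def using bij_betw_polar_map by (metis bij_betw_def the_inv_into_f_f)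

lemma polar_map_polar_inv: "Z \<in> regular_ball \<Longrightarrow> polar_map (polar_inv Z) = Z"
  unfolding polar_inv_def using bij_betw_polar_map by (metis bij_betw_def f_the_inv_into_f)

lemma regular_ball_unitary:
  fixes Z :: "('n::{finite,linorder}) cmat"
  assumes "Z \<in> regular_ball" "U \<in> unitary_group" "V \<in> unitary_group"
  shows "U ** Z ** V \<in> regular_ball"
proof -
  obtain U' V' x where Z: "U' \<in> unitary_group" "V' \<in> unitary_group" "x \<in> chamber" "Z = U' ** diag_real x ** V'"
    using assms(1) by (rule svd_exists)
  then have "U ** Z ** V = (U ** U') ** diag_real x ** (V' ** V)"
    by (simp add: matrix_mul_assoc)
  then show ?thesis using svd_in_regular_ball[of "U ** U'" "V' ** V" x] Z assms by simp
qed

section \<open>Isometries and slices of Lebesgue null sets\<close>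

lemma nn_integral_lborel_plus:
  fixes c :: "'a::euclidean_space"
  assumes [measurable]: "h \<in> borel_measurable borel"
  shows "(\<integral>\<^sup>+x. h (c + x) \<partial>lborel) = (\<integral>\<^sup>+x. h x \<partial>lborel)"
proof -
  have "(\<integral>\<^sup>+x. h x \<partial>lborel) = (\<integral>\<^sup>+x. h x \<partial>distr lborel borel ((+) c))"
    by (simp only: lborel_distr_plus)
  also have "\<dots> = (\<integral>\<^sup>+x. h (c + x) \<partial>lborel)"
    by (rule nn_integral_distr) auto
  finally show ?thesis ..
qed

lemma nn_integral_lborel_minus:
  fixes c :: "'a::euclidean_space"
  assumes [measurable]: "h \<in> borel_measurable borel"
  shows "(\<integral>\<^sup>+x. h (c - x) \<partial>lborel) = (\<integral>\<^sup>+x. h x \<partial>lborel)"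
proof -
  have "lborel = distr lborel borel (\<lambda>x. c + (-1) *\<^sub>R x)"
    using lborel_affine[of "-1" c] by (simp add: density_1)
  then have "(\<integral>\<^sup>+x. h x \<partial>lborel) = (\<integral>\<^sup>+x. h x \<partial>distr lborel borel (\<lambda>x. c + (-1) *\<^sub>R x))"
    by (rule arg_cong)
  also have "\<dots> = (\<integral>\<^sup>+x. h (c - x) \<partial>lborel)"
    by (subst nn_integral_distr) auto
  finally show ?thesis ..
qed

text \<open>
  Uniqueness of translation invariant measures, specialised.  With \<open>B\<close> the unit ball, Fubini
  and translation invariance give \<open>\<lambda>(f\<^sup>-\<^sup>1 A) \<lambda>(B) = \<lambda>(f\<^sup>-\<^sup>1 B) \<lambda>(A)\<close>, and \<open>f\<^sup>-\<^sup>1 B = B\<close>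
  because \<open>f\<close> is an isometry.
\<close>

lemma emeasure_lborel_linear_isometry:
  fixes f :: "'a::euclidean_space \<Rightarrow> 'a"
  assumes f: "linear f" and iso: "\<And>x. norm (f x) = norm x" and A [measurable]: "A \<in> sets borel"
  shows "emeasure lborel (f -` A) = emeasure lborel A"
proof -
  have inj: "inj f"
    using f iso by (metis linear_injective_0 norm_eq_zero)
  then have "surj f" using f by (simp add: linear_injective_imp_surjective)
  then have fg: "f (inv f y) = y" for y by (simp add: surj_f_inv_f)
  have fm [measurable]: "f \<in> borel_measurable borel"
    using f by (simp add: borel_measurable_continuous_onI linear_continuous_on linear_conv_bounded_linear)
  define B :: "'a set" where "B = ball 0 1"
  have [measurable]: "B \<in> sets borel" by (simp add: B_def)
  let ?I = "\<lambda>S x. indicator S x :: ennreal"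
  have "emeasure lborel (f -` A) * emeasure lborel B = (\<integral>\<^sup>+x. ?I A (f x) * (\<integral>\<^sup>+y. ?I B (f x + y) \<partial>lborel) \<partial>lborel)"
  proof -
    have "(\<integral>\<^sup>+y. ?I B (f x + y) \<partial>lborel) = emeasure lborel B" for x
      by (subst nn_integral_lborel_plus) auto
    moreover have "(\<integral>\<^sup>+x. ?I A (f x) \<partial>lborel) = emeasure lborel (f -` A)"
    proof -
      have "?I A (f x) = ?I (f -` A) x" for x by (simp add: indicator_def)
      then show ?thesis using measurable_sets[OF fm A] by (simp only: nn_integral_indicator) simp
    qed
    ultimately show ?thesis by (simp add: nn_integral_multc)
  qed
  also have "\<dots> = (\<integral>\<^sup>+x. \<integral>\<^sup>+y. ?I A (f x) * ?I B (f x + y) \<partial>lborel \<partial>lborel)"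
    by (simp add: nn_integral_cmult)
  also have "\<dots> = (\<integral>\<^sup>+y. \<integral>\<^sup>+x. ?I A (f x) * ?I B (f x + y) \<partial>lborel \<partial>lborel)"
    by (rule lborel_pair.Fubini'[symmetric]) simp
  also have "\<dots> = (\<integral>\<^sup>+y. \<integral>\<^sup>+x. ?I A (f x - y) * ?I B (f x) \<partial>lborel \<partial>lborel)"
  proof (rule nn_integral_cong)
    fix y
    have "(\<integral>\<^sup>+x. ?I A (f x) * ?I B (f x + y) \<partial>lborel)
        = (\<integral>\<^sup>+x. ?I A (f (- inv f y + x)) * ?I B (f (- inv f y + x) + y) \<partial>lborel)"
      by (rule nn_integral_lborel_plus[symmetric]) simp
    then show "(\<integral>\<^sup>+x. ?I A (f x) * ?I B (f x + y) \<partial>lborel) = (\<integral>\<^sup>+x. ?I A (f x - y) * ?I B (f x) \<partial>lborel)"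
      using f by (simp add: linear_add linear_neg linear_diff fg)
  qed
  also have "\<dots> = (\<integral>\<^sup>+x. \<integral>\<^sup>+y. ?I A (f x - y) * ?I B (f x) \<partial>lborel \<partial>lborel)"
    by (rule lborel_pair.Fubini') simp
  also have "\<dots> = (\<integral>\<^sup>+x. emeasure lborel A * ?I B (f x) \<partial>lborel)"
  proof (rule nn_integral_cong)
    fix x
    have "(\<integral>\<^sup>+y. ?I A (f x - y) \<partial>lborel) = emeasure lborel A"
      by (subst nn_integral_lborel_minus) auto
    then show "(\<integral>\<^sup>+y. ?I A (f x - y) * ?I B (f x) \<partial>lborel) = emeasure lborel A * ?I B (f x)"
      by (simp add: nn_integral_multc)
  qed
  also have "\<dots> = emeasure lborel A * emeasure lborel B"
  proof -
    have "?I B (f x) = ?I B x" for x using iso by (simp add: B_def indicator_def)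
    then show ?thesis by (simp add: nn_integral_cmult)
  qed
  finally have eq: "emeasure lborel (f -` A) * emeasure lborel B = emeasure lborel A * emeasure lborel B" .
  have "emeasure lborel B \<noteq> \<infinity>" using emeasure_bounded_finite[of B] by (simp add: B_def)
  moreover have "emeasure lborel B \<noteq> 0"
    using open_not_negligible[of B] by (auto simp: B_def negligible_iff_null_sets null_sets_def)
  ultimately show ?thesis
    using eq by (simp add: mult.commute[of _ "emeasure lborel B"] ennreal_mult_cancel_left)
qed

lemma negligible_iff_borel_null: "negligible S \<longleftrightarrow> (\<exists>N\<in>null_sets lborel. S \<subseteq> N)"
  unfolding negligible_iff_null_sets null_sets_completion_iff2 ..

text \<open>
  Fubini without coordinates: every translate \<open>S - D s\<close> has the measure of \<open>S\<close>, so integrating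
  over \<open>s\<close> measures all slices of \<open>S\<close> along the range of \<open>D\<close>.
\<close>

lemma null_iff_slices_null:
  fixes D :: "'b::euclidean_space \<Rightarrow> 'a::euclidean_space"
  assumes [measurable]: "D \<in> borel_measurable borel" "S \<in> sets borel"
  shows "S \<in> null_sets lborel \<longleftrightarrow> (AE Z in lborel. {s. Z + D s \<in> S} \<in> null_sets lborel)"
proof -
  have m: "{s. Z + D s \<in> S} \<in> sets borel" for Z by measurable
  let ?I = "\<lambda>S x. indicator S x :: ennreal"
  have "(\<integral>\<^sup>+Z. emeasure lborel {s. Z + D s \<in> S} \<partial>lborel) = (\<integral>\<^sup>+Z. \<integral>\<^sup>+s. ?I S (Z + D s) \<partial>lborel \<partial>lborel)"
    using m by (intro nn_integral_cong) (simp flip: nn_integral_indicator add: indicator_def)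
  also have "\<dots> = (\<integral>\<^sup>+s. \<integral>\<^sup>+Z. ?I S (Z + D s) \<partial>lborel \<partial>lborel)"
    by (rule lborel_pair.Fubini'[symmetric]) simp
  also have "\<dots> = (\<integral>\<^sup>+s. emeasure lborel S \<partial>(lborel :: 'b measure))"
    by (intro nn_integral_cong) (subst add.commute, subst nn_integral_lborel_plus, auto)
  also have "\<dots> = 0 \<longleftrightarrow> emeasure lborel S = 0" by simp
  finally have "emeasure lborel S = 0 \<longleftrightarrow> (\<integral>\<^sup>+Z. emeasure lborel {s. Z + D s \<in> S} \<partial>lborel) = 0" by simp
  also have "\<dots> \<longleftrightarrow> (AE Z in lborel. emeasure lborel {s. Z + D s \<in> S} = 0)"
  proof (rule nn_integral_0_iff_AE)
    have "(\<lambda>Z. \<integral>\<^sup>+s. ?I S (Z + D s) \<partial>lborel) \<in> borel_measurable lborel" by measurable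
    then show "(\<lambda>Z. emeasure lborel {s. Z + D s \<in> S}) \<in> borel_measurable lborel"
      using m by (simp flip: nn_integral_indicator add: indicator_def)
  qed
  finally show ?thesis using m by (simp add: null_sets_def)
qed

lemma negligible_imp_slices_negligible:
  fixes D :: "'b::euclidean_space \<Rightarrow> 'a::euclidean_space"
  assumes "D \<in> borel_measurable borel" "negligible S"
  shows "AE Z in lborel. negligible {s. Z + D s \<in> S}"
proof -
  obtain N where N: "N \<in> null_sets lborel" "S \<subseteq> N" using assms(2) negligible_iff_borel_null by blast
  then have "N \<in> sets borel" by (auto dest: null_setsD2)
  then have "AE Z in lborel. {s. Z + D s \<in> N} \<in> null_sets lborel"
    using null_iff_slices_null[OF assms(1)] N(1) by blast
  then show ?thesis
  proof eventually_elim
    case (elim Z)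
    moreover have "{s. Z + D s \<in> S} \<subseteq> {s. Z + D s \<in> N}" using N(2) by blast
    ultimately show ?case unfolding negligible_iff_borel_null by blast
  qed
qed

section \<open>Almost every matrix is regular\<close>

text \<open>
  Complex polynomials in one real parameter.  They describe determinants along a line \<open>Z + s W\<close>
  in matrix space, where conjugated entries are still polynomial in \<open>s\<close>.
\<close>

definition polyfun :: "(real \<Rightarrow> complex) \<Rightarrow> bool" where
  "polyfun f \<longleftrightarrow> (\<exists>p. \<forall>s. f s = poly p (of_real s))"

lemma polyfun_const [intro, simp]: "polyfun (\<lambda>s. c)"
  unfolding polyfun_def by (rule exI[of _ "[:c:]"]) simp

lemma polyfun_of_real [intro, simp]: "polyfun of_real"
  unfolding polyfun_def by (rule exI[of _ "[:0, 1:]"]) simp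

lemma polyfun_add [intro]: "polyfun f \<Longrightarrow> polyfun g \<Longrightarrow> polyfun (\<lambda>s. f s + g s)"
  unfolding polyfun_def by (metis poly_add)

lemma polyfun_mult [intro]: "polyfun f \<Longrightarrow> polyfun g \<Longrightarrow> polyfun (\<lambda>s. f s * g s)"
  unfolding polyfun_def by (metis poly_mult)

lemma polyfun_sum [intro]: "(\<And>i. i \<in> I \<Longrightarrow> polyfun (f i)) \<Longrightarrow> polyfun (\<lambda>s. \<Sum>i\<in>I. f i s)"
  by (induction I rule: infinite_finite_induct) auto

lemma polyfun_prod [intro]: "(\<And>i. i \<in> I \<Longrightarrow> polyfun (f i)) \<Longrightarrow> polyfun (\<lambda>s. \<Prod>i\<in>I. f i s)"
  by (induction I rule: infinite_finite_induct) auto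

lemma polyfun_det: "(\<And>i j. polyfun (\<lambda>s. M s $ i $ j)) \<Longrightarrow> polyfun (\<lambda>s. det (M s))"
  unfolding det_def by (intro polyfun_sum polyfun_mult polyfun_prod) auto

lemma polyfun_finite_zeros:
  assumes "polyfun f" "f s0 \<noteq> 0" shows "finite {s. f s = 0}"
proof -
  obtain p where p: "\<And>s. f s = poly p (of_real s)" using assms(1) polyfun_def by blast
  then have "p \<noteq> 0" using assms(2) by auto
  then have "finite (complex_of_real -` {z. poly p z = 0})"
    by (intro finite_vimageI poly_roots_finite) (auto simp: inj_def)
  then show ?thesis by (simp add: p vimage_def)
qed

text \<open>
  The elements of the index type serve as the exponents \<open>0, ..., n - 1\<close>.
\<close>

definition pos_index :: "'n::{finite,linorder} \<Rightarrow> nat" where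
  "pos_index i = card {k. k < i}"

lemma inj_pos_index: "inj (pos_index :: 'n::{finite,linorder} \<Rightarrow> nat)"
proof (rule linorder_injI)
  fix i j :: 'n assume "i < j"
  then have "{k. k < i} \<subset> {k. k < j}" by auto
  then have "pos_index i < pos_index j" unfolding pos_index_def by (intro psubset_card_mono) auto
  then show "pos_index i \<noteq> pos_index j" by simp
qed

lemma pos_index_less: "pos_index (i :: 'n::{finite,linorder}) < CARD('n)"
  unfolding pos_index_def by (intro psubset_card_mono) auto

definition krylov_vec :: "complex^'n^'n \<Rightarrow> nat \<Rightarrow> complex^'n" where
  "krylov_vec A k = ((\<lambda>w. A *v w) ^^ k) (\<chi> i. 1)"

lemma krylov_vec_simps [simp]: "krylov_vec A 0 = (\<chi> i. 1)" "krylov_vec A (Suc k) = A *v krylov_vec A k"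
  by (simp_all add: krylov_vec_def)

definition krylov :: "('n::{finite,linorder}) cmat \<Rightarrow> 'n cmat" where
  "krylov A = (\<chi> r i. krylov_vec A (pos_index i) $ r)"

text \<open>
  Such a \<open>w\<close> is orthogonal to \<open>1\<close>, the vector of ones, hence to every \<open>A\<^sup>k 1\<close>, because \<open>A\<close> is
  Hermitian and \<open>w\<close> an eigenvector.  If the \<open>A\<^sup>k 1\<close> span, then \<open>w\<close> vanishes.
\<close>

lemma krylov_eigenvector:
  assumes herm: "adj A = A" and c: "c \<in> \<real>" and K: "det (krylov A) \<noteq> 0"
    and w: "A *v w = c *s w" and 0: "(\<Sum>i\<in>UNIV. w $ i) = 0"
  shows "w = 0"
proof -
  have cnj: "cnj c = c" using c by (simp add: Reals_cnj_iff)
  have *: "(\<Sum>r\<in>UNIV. cnj (w $ r) * krylov_vec A k $ r) = c ^ k * (\<Sum>r\<in>UNIV. cnj (w $ r))" for k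
  proof (induction k)
    case (Suc k)
    have "(\<Sum>r\<in>UNIV. cnj (w $ r) * krylov_vec A (Suc k) $ r)
        = (\<Sum>r\<in>UNIV. cnj ((A *v w) $ r) * krylov_vec A k $ r)"
      using cinner_adj[of w A "krylov_vec A k"] herm by simp
    then show ?case using Suc by (simp add: w cnj mult.assoc flip: sum_distrib_left)
  qed simp
  have "(\<Sum>r\<in>UNIV. cnj (w $ r)) = 0" using 0 by (metis cnj_sum complex_cnj_zero)
  then have "transpose (krylov A) *v (\<chi> r. cnj (w $ r)) = 0"
    using * by (simp add: vec_eq_iff matrix_vector_mult_def transpose_def krylov_def mult.commute)
  then have "(\<chi> r. cnj (w $ r)) = 0"
    using K kernel_imp_det_0 by (metis det_transpose)
  then show ?thesis by (simp add: vec_eq_iff)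
qed

lemma det_replace_column:
  fixes x :: "complex^'n"
  shows "det (mat 1 + (\<chi> i j. if j = k then x $ i else 0)) = 1 + x $ k"
proof -
  have "mat 1 + (\<chi> i j. if j = k then x $ i else 0)
      = (\<chi> i j. if j = k then (mat 1 *v (axis k 1 + x)) $ i else (mat 1 :: complex^'n^'n) $ i $ j)"
    unfolding matrix_vector_mul_lid by (auto simp: vec_eq_iff mat_def axis_def)
  then show ?thesis using cramer_lemma[where A = "mat 1 :: complex^'n^'n" and x = "axis k 1 + x" and k = k] by (simp add: axis_def)
qed

text \<open>
  Let \<open>u\<close> be an eigenvector for \<open>c\<close> with \<open>u\<^sub>k \<noteq> 0\<close>, and let \<open>P\<close> be the rank one matrix with
  column \<open>k\<close> equal to \<open>u\<close>.  A rank one update of the determinant gives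
  \<open>q(t) (t - c) = p(t) (t - c + u\<^sub>k)\<close> for the characteristic polynomials \<open>p\<close> of \<open>A\<close> and \<open>q\<close> of
  \<open>A - P\<close>.  Since the eigenspace of \<open>c\<close> is a line, \<open>q(c) \<noteq> 0\<close>, so \<open>c\<close> is a simple root of \<open>p\<close>.
\<close>

lemma krylov_imp_simple_spectrum:
  fixes A :: "('n::{finite,linorder}) cmat"
  assumes herm: "adj A = A" and K: "det (krylov A) \<noteq> 0" and root: "poly (char_poly A) c = 0"
  shows "order c (char_poly A) = 1"
proof -
  obtain u where u: "u \<noteq> 0" "A *v u = c *s u"
    using root char_poly_root_iff_eigenvalue by blast
  have c: "c \<in> \<real>" using hermitian_eigenvalue_real[OF herm u(2,1)] .
  obtain k where k: "u $ k \<noteq> 0" using u(1) by (metis vec_eq_iff zero_index)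
  define P :: "'n cmat" where "P = (\<chi> i j. if j = k then u $ i else 0)"
  define p where "p = char_poly A"
  define q where "q = char_poly (A - P)"
  have Pv: "P *v w = w $ k *s u" for w
  proof -
    have "(\<Sum>j\<in>UNIV. (if j = k then u $ i else 0) * w $ j) = (\<Sum>j\<in>UNIV. if j = k then u $ i * w $ k else 0)" for i
      by (rule sum.cong) auto
    then show ?thesis by (simp add: P_def matrix_vector_mult_def vec_eq_iff mult.commute)
  qed
  have pq: "poly q t * (t - c) = poly p t * (t - c + u $ k)" if "t \<noteq> c" for t
  proof -
    define x where "x = inverse (t - c) *s u"
    define X :: "'n cmat" where "X = (\<chi> i j. if j = k then x $ i else 0)"
    have "((diag (\<chi> i. t) - A) ** X) $ i $ j = P $ i $ j" for i j
    proof (cases "j = k")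
      case True
      have "((diag (\<chi> i. t) - A) ** X) $ i $ j = ((diag (\<chi> i. t) - A) *v x) $ i"
        using True by (simp add: matrix_matrix_mult_def matrix_vector_mult_def X_def)
      also have "\<dots> = ((t - c) *s x) $ i"
        by (simp add: matrix_vector_mult_diff_rdistrib scalar_diag_vec x_def vector_scalar_commute u algebra_simps)
      also have "\<dots> = P $ i $ j" using that True by (simp add: x_def P_def)
      finally show ?thesis .
    next
      case False
      then show ?thesis by (simp add: matrix_matrix_mult_def X_def P_def)
    qed
    then have "(diag (\<chi> i. t) - A) ** X = P" by (simp add: vec_eq_iff)
    then have "(diag (\<chi> i. t) - A) ** (mat 1 + X) = diag (\<chi> i. t) - (A - P)"
      by (simp add: matrix_add_ldistrib algebra_simps)
    then have "poly q t = poly p t * det (mat 1 + X)"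
      unfolding q_def p_def poly_char_poly by (metis det_mul)
    also have "det (mat 1 + X) = 1 + inverse (t - c) * u $ k"
      unfolding X_def det_replace_column x_def by simp
    finally show ?thesis using that by (simp add: field_simps)
  qed
  have eq: "q * [:- c, 1:] = p * [:u $ k - c, 1:]"
  proof -
    have "poly ([:- c, 1:] * (q * [:- c, 1:] - p * [:u $ k - c, 1:])) t = 0" for t
    proof (cases "t = c")
      case False
      have "poly (q * [:- c, 1:]) t = poly q t * (t - c)" "poly (p * [:u $ k - c, 1:]) t = poly p t * (t - c + u $ k)"
        by (simp_all add: algebra_simps)
      then show ?thesis using pq[OF False] by simp
    qed simp
    then have "[:- c, 1:] * (q * [:- c, 1:] - p * [:u $ k - c, 1:]) = 0"
      using poly_all_0_iff_0 by blast
    then show ?thesis by (simp only: mult_eq_0_iff) auto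
  qed
  have "det (diag (\<chi> i. c) - (A - P)) \<noteq> 0"
  proof
    assume "det (diag (\<chi> i. c) - (A - P)) = 0"
    then obtain w where w: "w \<noteq> 0" "(diag (\<chi> i. c) - (A - P)) *v w = 0"
      using det_0_imp_kernel by blast
    then have w2: "A *v w = c *s w + w $ k *s u"
      by (simp add: matrix_vector_mult_diff_rdistrib scalar_diag_vec Pv algebra_simps)
    have "(\<Sum>i\<in>UNIV. cnj (u $ i) * (A *v w) $ i) = c * (\<Sum>i\<in>UNIV. cnj (u $ i) * w $ i)"
      using cinner_adj[of u A w] herm c by (simp add: u sum_distrib_left mult_ac Reals_cnj_iff)
    moreover have "(\<Sum>i\<in>UNIV. cnj (u $ i) * (A *v w) $ i)
        = c * (\<Sum>i\<in>UNIV. cnj (u $ i) * w $ i) + w $ k * (\<Sum>i\<in>UNIV. cnj (u $ i) * u $ i)"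
      unfolding w2 by (simp add: sum_distrib_left algebra_simps sum.distrib)
    ultimately have "w $ k * (\<Sum>i\<in>UNIV. cnj (u $ i) * u $ i) = 0" by simp
    then have wk: "w $ k = 0" using u(1) by (simp add: cinner_self)
    then have Aw: "A *v w = c *s w" using w2 by simp
    \<comment> \<open>The combination of \<open>u\<close> and \<open>w\<close> whose entries sum to zero: it is an eigenvector and must vanish.\<close>
    define z where "z = (\<Sum>i\<in>UNIV. w $ i) *s u - (\<Sum>i\<in>UNIV. u $ i) *s w"
    have "A *v z = c *s z"
      by (simp add: z_def matrix_vector_mult_diff_distrib vector_scalar_commute u Aw vec_eq_iff algebra_simps)
    moreover have "(\<Sum>i\<in>UNIV. z $ i) = 0"
      by (simp add: z_def sum_subtractf flip: sum_distrib_left)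
    ultimately have "z = 0" using krylov_eigenvector[OF herm c K] by blast
    then have "z $ k = 0" by simp
    then have "(\<Sum>i\<in>UNIV. w $ i) = 0" using wk k by (simp add: z_def)
    then have "w = 0" using krylov_eigenvector[OF herm c K Aw] by blast
    then show False using w by simp
  qed
  then have qc: "poly q c \<noteq> 0" by (simp add: q_def poly_char_poly)
  then have "order c q = 0" by (rule order_0I)
  moreover have "order c [:u $ k - c, 1:] = 0" using k by (intro order_0I) simp
  moreover have "order c [:- c, 1:] = 1" using order_power_n_n[of c 1] by simp
  moreover have nz: "q * [:- c, 1:] \<noteq> 0" using qc by (auto simp only: mult_eq_0_iff) simp_all
  moreover have "p * [:u $ k - c, 1:] \<noteq> 0" using nz unfolding eq .
  ultimately have "order c p = 1"
    using order_mult[of q "[:- c, 1:]" c] order_mult[of p "[:u $ k - c, 1:]" c] unfolding eq by simp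
  then show ?thesis by (simp add: p_def)
qed

text \<open>
  A homogeneous polynomial in the entries of \<open>Z\<close> and their conjugates whose zero set contains
  all matrices that are not regular.
\<close>

definition regularity_witness :: "('n::{finite,linorder}) cmat \<Rightarrow> complex" where
  "regularity_witness Z = det (Z ** adj Z) * det (krylov (Z ** adj Z))"

lemma regularity_witness_imp_regular:
  assumes "regularity_witness Z \<noteq> 0" shows "Z \<in> regular_matrices"
proof -
  have d: "det (Z ** adj Z) \<noteq> 0" and K: "det (krylov (Z ** adj Z)) \<noteq> 0"
    using assms by (auto simp: regularity_witness_def)
  have herm: "adj (Z ** adj Z) = Z ** adj Z" by (simp add: adj_mult)
  have "0 < Re (\<Sum>i\<in>UNIV. cnj (v $ i) * (Z ** adj Z *v v) $ i)" if "v \<noteq> 0" for v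
  proof -
    have "adj Z *v v \<noteq> 0"
    proof
      assume "adj Z *v v = 0"
      then have "Z ** adj Z *v v = 0" by (simp flip: matrix_vector_mul_assoc)
      then show False using d that kernel_imp_det_0 by blast
    qed
    moreover have "(\<Sum>i\<in>UNIV. cnj (v $ i) * (Z ** adj Z *v v) $ i) = complex_of_real ((norm (adj Z *v v))\<^sup>2)"
      unfolding cinner_self[symmetric] matrix_vector_mul_assoc[symmetric] by (rule cinner_adj)
    ultimately show ?thesis by simp
  qed
  then show ?thesis
    using herm krylov_imp_simple_spectrum[OF herm K] by (simp add: regular_matrices_def posdef_def)
qed

lemma scaleR_nth_nth: "(s *\<^sub>R W) $ i $ j = of_real s * (W $ i $ j :: complex)"
  unfolding vector_scaleR_component by (rule scaleR_conv_of_real)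

lemma polyfun_regularity_witness: "polyfun (\<lambda>s. regularity_witness (Z + s *\<^sub>R W))"
proof -
  have A: "polyfun (\<lambda>s. ((Z + s *\<^sub>R W) ** adj (Z + s *\<^sub>R W)) $ i $ j)" for i j
    by (auto simp: matrix_matrix_mult_def scaleR_nth_nth simp del: vector_scaleR_component intro!: polyfun_sum polyfun_mult polyfun_add)
  have "polyfun (\<lambda>s. krylov_vec ((Z + s *\<^sub>R W) ** adj (Z + s *\<^sub>R W)) k $ r)" for k r
    using A by (induction k arbitrary: r) (auto simp: matrix_vector_mult_def intro!: polyfun_sum polyfun_mult)
  then show ?thesis
    unfolding regularity_witness_def using A by (intro polyfun_mult polyfun_det) (auto simp: krylov_def)
qed

lemma regularity_witness_scaleR:
  assumes "s \<noteq> 0" shows "regularity_witness (s *\<^sub>R Z) = 0 \<longleftrightarrow> regularity_witness Z = 0"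
proof -
  define A where "A = Z ** adj Z"
  define c where "c = complex_of_real (s\<^sup>2)"
  have c: "c \<noteq> 0" using assms by (simp add: c_def)
  have "adj (s *\<^sub>R Z) = s *\<^sub>R adj Z" by (simp add: vec_eq_iff scaleR_nth_nth del: vector_scaleR_component)
  then have 1: "(s *\<^sub>R Z) ** adj (s *\<^sub>R Z) = diag (\<chi> i. c) ** A"
    unfolding vec_eq_iff diag_mult_left_nth
    by (simp add: A_def c_def power2_eq_square scaleR_nth_nth matrix_matrix_mult_def sum_distrib_left mult_ac del: vector_scaleR_component)
  have "krylov_vec (diag (\<chi> i. c) ** A) k = c ^ k *s krylov_vec A k" for k
    by (induction k) (simp, simp only: krylov_vec_simps matrix_vector_mul_assoc[symmetric]
      vector_scalar_commute scalar_diag_vec vector_smult_assoc power_Suc2)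
  then have "krylov (diag (\<chi> i. c) ** A) = krylov A ** diag (\<chi> i. c ^ pos_index i)"
    by (simp add: krylov_def vec_eq_iff mult.commute)
  then show ?thesis
    unfolding regularity_witness_def 1 A_def[symmetric] using c by (simp add: det_mul det_diag)
qed

text \<open>
  Here the Krylov matrix is a Vandermonde matrix: a vector in its kernel is the list of
  coefficients of a polynomial of degree less than \<open>n\<close> with \<open>n\<close> different roots.
\<close>

lemma regularity_witness_diag: "regularity_witness (diag_real (\<chi> i. real (Suc (pos_index i)))) \<noteq> 0"
proof -
  define w where "w i = (real (Suc (pos_index i)))\<^sup>2" for i :: 'a
  define A where "A = diag_real (\<chi> i. w i)"
  have 1: "diag_real (\<chi> i. real (Suc (pos_index i))) ** adj (diag_real (\<chi> i. real (Suc (pos_index i)))) = A"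
    by (simp add: A_def diag_real_mult w_def power2_eq_square)
  have "det A = (\<Prod>i\<in>UNIV. complex_of_real (w i))" by (simp add: A_def diag_real_def det_diag)
  moreover have "w i \<noteq> 0" for i by (simp add: w_def)
  ultimately have dA: "det A \<noteq> 0" by simp
  have inj_w: "inj (\<lambda>i. complex_of_real (w i))"
  proof (rule injI)
    fix i j assume "complex_of_real (w i) = complex_of_real (w j)"
    then have "(real (Suc (pos_index i)))\<^sup>2 = (real (Suc (pos_index j)))\<^sup>2"
      unfolding of_real_eq_iff w_def .
    then have "real (Suc (pos_index i)) = real (Suc (pos_index j))"
      by (rule power2_eq_imp_eq) auto
    then show "i = j" by (simp add: inj_eq[OF inj_pos_index])
  qed
  have kv: "krylov_vec A k = (\<chi> i. complex_of_real (w i) ^ k)" for k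
    by (induction k) (simp_all add: A_def diag_real_vec)
  have "det (krylov A) \<noteq> 0"
  proof
    assume "det (krylov A) = 0"
    then obtain v where v: "v \<noteq> 0" "krylov A *v v = 0" using det_0_imp_kernel by blast
    define p where "p = (\<Sum>i\<in>UNIV. monom (v $ i) (pos_index i))"
    have coeff: "coeff p (pos_index j) = v $ j" for j
    proof -
      have "coeff p (pos_index j) = (\<Sum>i\<in>UNIV. if i = j then v $ j else 0)"
        unfolding p_def coeff_sum by (intro sum.cong) (auto simp: inj_eq[OF inj_pos_index])
      then show ?thesis by simp
    qed
    obtain j where "v $ j \<noteq> 0" using v(1) by (metis vec_eq_iff zero_index)
    then have "p \<noteq> 0" using coeff[of j] by auto
    have "degree (monom (v $ i) (pos_index i)) \<le> CARD('a) - 1" for i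
      using degree_monom_le[of "v $ i" "pos_index i"] pos_index_less[of i] by linarith
    then have "degree p \<le> CARD('a) - 1"
      unfolding p_def by (intro degree_sum_le) auto
    moreover have "0 < CARD('a)" by simp
    ultimately have deg: "degree p < CARD('a)" by linarith
    have "poly p (of_real (w r)) = 0" for r
    proof -
      have "(krylov A *v v) $ r = (\<Sum>i\<in>UNIV. of_real (w r) ^ pos_index i * v $ i)"
        by (simp add: matrix_vector_mult_def krylov_def kv)
      then show ?thesis unfolding v(2) by (simp add: p_def poly_sum poly_monom mult.commute)
    qed
    then have "range (\<lambda>r. complex_of_real (w r)) \<subseteq> {z. poly p z = 0}" by auto
    then have "card (range (\<lambda>r. complex_of_real (w r))) \<le> card {z. poly p z = 0}"
      using \<open>p \<noteq> 0\<close> by (intro card_mono poly_roots_finite)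
    also have "\<dots> \<le> degree p" using \<open>p \<noteq> 0\<close> by (rule card_poly_roots_bound)
    finally show False using deg inj_w by (simp add: card_image)
  qed
  then show ?thesis unfolding regularity_witness_def 1 using dA by simp
qed

lemma continuous_on_det:
  fixes M :: "'a::topological_space \<Rightarrow> complex^'n^'n"
  shows "(\<And>i j. continuous_on S (\<lambda>x. M x $ i $ j)) \<Longrightarrow> continuous_on S (\<lambda>x. det (M x))"
  unfolding det_def by (intro continuous_on_sum continuous_on_mult continuous_on_prod continuous_on_const) auto

lemma continuous_regularity_witness: "continuous_on UNIV regularity_witness"
proof -
  have A: "continuous_on UNIV (\<lambda>Z. (Z ** adj Z) $ i $ j)" for i j :: 'a
    by (auto simp: matrix_matrix_mult_def intro!: continuous_intros)
  have "continuous_on UNIV (\<lambda>Z. krylov_vec (Z ** adj Z) k $ r)" for k and r :: 'a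
    using A by (induction k arbitrary: r) (auto simp: matrix_vector_mult_def intro!: continuous_on_sum continuous_on_mult)
  then show ?thesis
    unfolding regularity_witness_def[abs_def] using A
    by (intro continuous_on_mult continuous_on_det) (auto simp: krylov_def)
qed

text \<open>
  Along every line in the direction of a matrix \<open>W\<close> with nonzero witness, the witness is a
  polynomial.  It is not zero because, by homogeneity, its value at a large parameter can be
  compared with the value at \<open>W\<close>.  So all slices of the zero set are finite.
\<close>

lemma negligible_not_regular: "negligible (- regular_matrices :: ('n::{finite,linorder}) cmat set)"
proof -
  define W :: "'n cmat" where "W = diag_real (\<chi> i. real (Suc (pos_index i)))"
  define S :: "'n cmat set" where "S = {Z. regularity_witness Z = 0}"
  have "closed S"
    unfolding S_def using continuous_closed_vimage[of "{0}" regularity_witness] continuous_regularity_witness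
    by (auto simp: vimage_def continuous_on_eq_continuous_at)
  then have S [measurable]: "S \<in> sets borel" by simp
  have "finite {s. Z + s *\<^sub>R W \<in> S}" for Z
  proof -
    have "finite {r. regularity_witness (W + r *\<^sub>R Z) = 0}"
      using polyfun_finite_zeros[OF polyfun_regularity_witness, of W 0 Z] regularity_witness_diag by (simp add: W_def)
    then have "finite (insert 0 {r. regularity_witness (W + r *\<^sub>R Z) = 0})" by simp
    \<comment> \<open>The parameter \<open>r\<close> near the direction \<open>W\<close> corresponds to the parameter \<open>1 / r\<close> on the line through \<open>Z\<close>.\<close>
    then obtain r where r: "r \<notin> insert 0 {r. regularity_witness (W + r *\<^sub>R Z) = 0}"
      using ex_new_if_finite infinite_UNIV_char_0 by blast
    have "inverse r *\<^sub>R (W + r *\<^sub>R Z) = Z + inverse r *\<^sub>R W"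
      using r by (simp add: scaleR_add_right add.commute)
    then have "regularity_witness (Z + inverse r *\<^sub>R W) \<noteq> 0"
      using r regularity_witness_scaleR[of "inverse r" "W + r *\<^sub>R Z"] by simp
    then show ?thesis
      using polyfun_finite_zeros[OF polyfun_regularity_witness] by (simp add: S_def)
  qed
  then have "AE Z in lborel. {s. Z + s *\<^sub>R W \<in> S} \<in> null_sets lborel"
    by (intro AE_I2 finite_imp_null_set_lborel)
  then have "S \<in> null_sets lborel"
    by (subst null_iff_slices_null[of "\<lambda>s. s *\<^sub>R W"]) auto
  moreover have "- regular_matrices \<subseteq> S"
    using regularity_witness_imp_regular by (auto simp: S_def)
  ultimately show ?thesis using negligible_iff_borel_null by blast
qed

section \<open>Cayley transform\<close>

lemma matrix_add_rdistrib: "((B :: complex^'n^'n) + C) ** A = B ** A + C ** A"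
  by (simp add: vec_eq_iff matrix_matrix_mult_def algebra_simps sum.distrib)

lemma bounded_bilinear_matrix_mult: "bounded_bilinear ((**) :: complex^'n^'n \<Rightarrow> complex^'n^'n \<Rightarrow> complex^'n^'n)"
proof (subst bilinear_conv_bounded_bilinear[symmetric])
  have "linear (\<lambda>B :: complex^'n^'n. A ** B)" for A :: "complex^'n^'n"
    by (rule linearI) (simp_all add: vec_eq_iff matrix_matrix_mult_def scaleR_nth_nth
        sum_distrib_left sum.distrib algebra_simps del: vector_scaleR_component)
  moreover have "linear (\<lambda>A :: complex^'n^'n. A ** B)" for B :: "complex^'n^'n"
    by (rule linearI) (simp_all add: vec_eq_iff matrix_matrix_mult_def scaleR_nth_nth
        sum_distrib_left sum.distrib algebra_simps del: vector_scaleR_component)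
  ultimately show "bilinear ((**) :: complex^'n^'n \<Rightarrow> complex^'n^'n \<Rightarrow> complex^'n^'n)"
    by (simp add: bilinear_def)
qed

lemmas continuous_on_matrix_mult [continuous_intros] =
  bounded_bilinear.continuous_on[OF bounded_bilinear_matrix_mult]

text \<open>
  The inverse of \<open>1 - A\<close>, which exists for skew Hermitian \<open>A\<close>.  The Cayley transform
  \<open>(1 + A) (1 - A)\<^sup>-\<^sup>1\<close> equals twice this inverse minus the identity.
\<close>

definition cayley_resolvent :: "complex^'n^'n \<Rightarrow> complex^'n^'n" where
  "cayley_resolvent A = (SOME B. (mat 1 - A) ** B = mat 1)"

definition cayley :: "complex^'n^'n \<Rightarrow> complex^'n^'n" where
  "cayley A = cayley_resolvent A + cayley_resolvent A - mat 1"

lemma resolvent_inverse: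
  assumes skew: "adj A = - A"
  shows "(mat 1 - A) ** cayley_resolvent A = mat 1" "cayley_resolvent A ** (mat 1 - A) = mat 1"
proof -
  have "det (mat 1 - A) \<noteq> 0"
  proof
    assume "det (mat 1 - A) = 0"
    then obtain v where v: "v \<noteq> 0" "(mat 1 - A) *v v = 0" using det_0_imp_kernel by blast
    then have Av: "A *v v = v" by (simp add: matrix_vector_mult_diff_rdistrib)
    have "(\<Sum>i\<in>UNIV. cnj (v $ i) * v $ i) = (\<Sum>i\<in>UNIV. cnj ((adj A *v v) $ i) * v $ i)"
      using cinner_adj[of v A v] Av by simp
    also have "adj A *v v = - v"
      using matrix_vector_mult_diff_rdistrib[of 0 A v] by (simp add: skew Av)
    finally have "(\<Sum>i\<in>UNIV. cnj (v $ i) * v $ i) = 0"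
      by (simp add: sum_negf)
    then show False using v(1) by (simp add: cinner_self)
  qed
  then have "invertible (mat 1 - A)" by (simp add: invertible_det_nz)
  then have "\<exists>B. (mat 1 - A) ** B = mat 1" by (auto simp: invertible_def)
  then show 1: "(mat 1 - A) ** cayley_resolvent A = mat 1"
    unfolding cayley_resolvent_def by (rule someI_ex)
  then show "cayley_resolvent A ** (mat 1 - A) = mat 1"
    using matrix_left_right_inverse by blast
qed

lemma resolvent_0: "cayley_resolvent 0 = mat 1"
  using resolvent_inverse(1)[of 0] by (simp add: vec_eq_iff)

lemma cayley_0: "cayley 0 = mat 1"
  by (simp add: cayley_def resolvent_0)

lemma unitary_cayley:
  assumes skew: "adj A = - A" shows "cayley A \<in> unitary_group"
proof (rule unitaryI2)
  define C where "C = cayley_resolvent A"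
  have adjX: "adj (mat 1 - A) = mat 1 + A" by (simp add: adj_diff skew)
  have 1: "C ** (mat 1 - A) = mat 1" "(mat 1 + A) ** adj C = mat 1"
    using resolvent_inverse[OF skew] by (simp_all add: C_def flip: adjX adj_mult)
  have "C ** (mat 1 + A) ** adj C + C ** (mat 1 - A) ** adj C = C ** adj C + C ** adj C"
    by (simp add: matrix_add_ldistrib matrix_diff_ldistrib matrix_add_rdistrib matrix_diff_rdistrib)
  moreover have "C ** (mat 1 + A) ** adj C = C" unfolding matrix_mul_assoc[symmetric] 1 by simp
  moreover have "C ** (mat 1 - A) ** adj C = adj C" unfolding 1 by simp
  ultimately have h: "C ** adj C + C ** adj C = C + adj C" by simp
  have "cayley A ** adj (cayley A)
      = (C ** adj C + C ** adj C) + (C ** adj C + C ** adj C) - (C + adj C) - (C + adj C) + mat 1"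
    by (simp only: cayley_def C_def[symmetric] adj_add adj_diff adj_mat_1 matrix_add_ldistrib matrix_diff_ldistrib
        matrix_add_rdistrib matrix_diff_rdistrib matrix_mul_lid matrix_mul_rid) (simp only: algebra_simps)
  then show "cayley A ** adj (cayley A) = mat 1"
    unfolding h by simp
qed

lemma resolvent_identity:
  assumes "adj A = - A" "adj B = - B"
  shows "cayley_resolvent A - cayley_resolvent B = cayley_resolvent A ** (A - B) ** cayley_resolvent B"
proof -
  have "A - B = (mat 1 - B) - (mat 1 - A)" by simp
  then have "cayley_resolvent A ** (A - B) ** cayley_resolvent B
     = cayley_resolvent A ** ((mat 1 - B) ** cayley_resolvent B)
       - (cayley_resolvent A ** (mat 1 - A)) ** cayley_resolvent B"
    by (simp only: matrix_diff_ldistrib matrix_diff_rdistrib matrix_mul_assoc)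
  then show ?thesis using assms by (simp add: resolvent_inverse)
qed

text \<open>
  Unitary matrices all have the norm of the identity, which bounds the resolvent uniformly.
\<close>

lemma norm_resolvent:
  fixes A :: "complex^'n^'n"
  assumes "adj A = - A"
  shows "norm (cayley_resolvent A) \<le> norm (mat 1 :: complex^'n^'n)"
proof -
  have "2 *\<^sub>R cayley_resolvent A = cayley A + mat 1" by (simp add: cayley_def scaleR_2)
  then have "2 * norm (cayley_resolvent A) = norm (cayley A + mat 1)"
    by (metis abs_numeral norm_scaleR)
  also have "\<dots> \<le> norm (cayley A) + norm (mat 1 :: complex^'n^'n)" by (rule norm_triangle_ineq)
  also have "norm (cayley A) = norm (mat 1 :: complex^'n^'n)"
    using norm_unitary_left[OF unitary_cayley[OF assms], of "mat 1"] by simp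
  finally show ?thesis by simp
qed

text \<open>
  Both claims rest on the resolvent identity \<open>C(A) - C(B) = C(A) (A - B) C(B)\<close> together with
  the uniform bound.
\<close>

lemma resolvent_linear_family:
  fixes s :: "'a::real_normed_vector \<Rightarrow> complex^'n^'n"
  assumes s: "bounded_linear s" and skew: "\<And>W. adj (s W) = - s W"
  shows continuous_resolvent: "continuous_on UNIV (\<lambda>W. cayley_resolvent (s W))" (is ?C)
    and has_derivative_resolvent: "((\<lambda>W. cayley_resolvent (s W)) has_derivative
      (\<lambda>H. cayley_resolvent (s W) ** s H ** cayley_resolvent (s W))) (at W)" (is ?D)
proof -
  interpret s: bounded_linear s by (rule s)
  interpret m: bounded_bilinear "(**) :: complex^'n^'n \<Rightarrow> complex^'n^'n \<Rightarrow> complex^'n^'n"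
    by (rule bounded_bilinear_matrix_mult)
  let ?f = "\<lambda>W. cayley_resolvent (s W)"
  let ?I = "norm (mat 1 :: complex^'n^'n)"
  obtain K where "K > 0 \<and> (\<forall>(A :: complex^'n^'n) (B :: complex^'n^'n). norm (A ** B) \<le> norm A * norm B * K)"
    using m.pos_bounded by metis
  then have K: "\<And>(A :: complex^'n^'n) (B :: complex^'n^'n). norm (A ** B) \<le> norm A * norm B * K" "K > 0" by auto
  obtain L where "L > 0 \<and> (\<forall>H. norm (s H) \<le> norm H * L)"
    using s.pos_bounded by metis
  then have L: "\<And>H. norm (s H) \<le> norm H * L" "L > 0" by auto
  have diff: "?f V - ?f W = ?f V ** s (V - W) ** ?f W" for V W
    using resolvent_identity[OF skew skew] by (simp add: s.diff)
  have bd: "norm (?f W) \<le> ?I" for W using norm_resolvent[OF skew] .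
  define M where "M = ?I * L * K * ?I * K"
  have lip: "norm (?f V - ?f W) \<le> M * norm (V - W)" for V W
  proof -
    have "norm (?f V - ?f W) \<le> norm (?f V ** s (V - W)) * norm (?f W) * K"
      unfolding diff by (rule K)
    also have "\<dots> \<le> (norm (?f V) * norm (s (V - W)) * K) * norm (?f W) * K"
      using K by (intro mult_right_mono) auto
    also have "\<dots> \<le> (?I * (norm (V - W) * L) * K) * ?I * K"
      using K L bd by (intro mult_right_mono mult_mono) (auto intro!: mult_nonneg_nonneg)
    finally show ?thesis by (simp add: M_def mult_ac)
  qed
  have "M \<ge> 0" using K L by (simp add: M_def)
  have at: "isCont ?f W" for W
    unfolding isCont_def
  proof -
    have "((\<lambda>V. V - W) \<longlongrightarrow> 0) (at W)"
      by (rule LIM_zero) (rule tendsto_ident_at)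
    then have "((\<lambda>V. M * norm (V - W)) \<longlongrightarrow> 0) (at W)"
      by (rule tendsto_mult_right_zero[OF tendsto_norm_zero])
    then have "((\<lambda>V. ?f V - ?f W) \<longlongrightarrow> 0) (at W)"
      by (rule Lim_null_comparison[rotated]) (rule always_eventually, rule allI, rule lip)
    then show "(?f \<longlongrightarrow> ?f W) (at W)" by (rule LIM_zero_cancel)
  qed
  then show ?C by (intro continuous_at_imp_continuous_on ballI)
  show ?D
  proof (rule has_derivativeI_sandwich[where e = 1 and H = "\<lambda>V. norm (?f V - ?f W) * (L * K * ?I * K)"])
    show "bounded_linear (\<lambda>H. ?f W ** s H ** ?f W)"
      by (intro bounded_linear_compose[OF m.bounded_linear_left] bounded_linear_compose[OF m.bounded_linear_right] s)
    have "((\<lambda>V. ?f V - ?f W) \<longlongrightarrow> 0) (at W)"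
      using at[of W] unfolding isCont_def by (rule LIM_zero)
    then show "((\<lambda>V. norm (?f V - ?f W) * (L * K * ?I * K)) \<longlongrightarrow> 0) (at W)"
      by (rule tendsto_mult_left_zero[OF tendsto_norm_zero])
    fix V assume "V \<noteq> W"
    then have pos: "norm (V - W) > 0" by simp
    have "?f V - ?f W - ?f W ** s (V - W) ** ?f W = (?f V - ?f W) ** s (V - W) ** ?f W"
      unfolding diff[of V W] by (simp add: matrix_diff_rdistrib flip: diff)
    then have "norm (?f V - ?f W - ?f W ** s (V - W) ** ?f W) \<le> norm ((?f V - ?f W) ** s (V - W)) * norm (?f W) * K"
      using K by simp
    also have "\<dots> \<le> (norm (?f V - ?f W) * norm (s (V - W)) * K) * norm (?f W) * K"
      using K by (intro mult_right_mono) auto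
    also have "\<dots> \<le> (norm (?f V - ?f W) * (norm (V - W) * L) * K) * ?I * K"
      using K L bd by (intro mult_right_mono mult_mono) (auto intro!: mult_nonneg_nonneg)
    finally show "norm (?f V - ?f W - ?f W ** s (V - W) ** ?f W) / norm (V - W)
        \<le> norm (?f V - ?f W) * (L * K * ?I * K)"
      using pos by (simp add: divide_le_eq mult_ac)
  qed auto
qed

section \<open>Null sets of singular values\<close>

text \<open>
  The matrix \<open>W\<close> packs the coordinates of the chart: the entries above and below the diagonal,
  in two different ways, give the two skew Hermitian matrices \<open>chart_left W\<close> and
  \<open>chart_right W\<close>; the imaginary parts of the diagonal go to \<open>chart_right\<close> and the real parts
  are the singular values.  Leaving the diagonal of \<open>chart_left\<close> zero removes the torus
  ambiguity and makes the dimensions agree.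
\<close>

definition chart_left :: "('n::{finite,linorder}) cmat \<Rightarrow> 'n cmat" where
  "chart_left W = (\<chi> i j. if i < j then W $ i $ j else if j < i then - cnj (W $ j $ i) else 0)"

definition chart_right :: "('n::{finite,linorder}) cmat \<Rightarrow> 'n cmat" where
  "chart_right W = (\<chi> i j. if i < j then - cnj (W $ j $ i) else if j < i then W $ i $ j else \<i> * Im (W $ i $ i))"

definition chart_diag :: "complex^'n^'n \<Rightarrow> real^'n" where
  "chart_diag W = (\<chi> i. Re (W $ i $ i))"

definition svd_chart :: "('n::{finite,linorder}) cmat \<Rightarrow> 'n cmat" where
  "svd_chart W = cayley (chart_left W) ** diag_real (chart_diag W) ** cayley (chart_right W)"

lemma chart_skew: "adj (chart_left W) = - chart_left W" "adj (chart_right W) = - chart_right W"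
  by (auto simp: vec_eq_iff chart_left_def chart_right_def)

lemma bounded_linear_chart:
  "bounded_linear (chart_left :: ('n::{finite,linorder}) cmat \<Rightarrow> _)"
  "bounded_linear (chart_right :: ('n::{finite,linorder}) cmat \<Rightarrow> _)"
  by (subst linear_conv_bounded_linear[symmetric], rule linearI;
    auto simp: vec_eq_iff chart_left_def chart_right_def scaleR_nth_nth algebra_simps simp del: vector_scaleR_component)+

lemma bounded_linear_chart_diag: "bounded_linear (chart_diag :: complex^'n^'n \<Rightarrow> _)"
  by (subst linear_conv_bounded_linear[symmetric], rule linearI) (auto simp: vec_eq_iff chart_diag_def)

lemma diag_real_nth: "diag_real x $ i $ j = (if i = j then of_real (x $ i) else 0)"
  by (auto simp: diag_real_def diag_def)

lemma bounded_linear_diag_real: "bounded_linear (diag_real :: real^'n \<Rightarrow> complex^'n^'n)"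
proof (subst linear_conv_bounded_linear[symmetric], rule linearI)
  fix r and x y :: "real^'n"
  show "diag_real (x + y) = diag_real x + diag_real y" by (simp add: vec_eq_iff diag_real_nth)
  have "diag_real (r *\<^sub>R x) $ i $ j = (r *\<^sub>R diag_real x) $ i $ j" for i j
    unfolding scaleR_nth_nth by (simp add: diag_real_nth)
  then show "diag_real (r *\<^sub>R x) = r *\<^sub>R diag_real x" by (simp only: vec_eq_iff) blast
qed

lemma chart_diag_0 [simp]: "chart_diag 0 = 0"
  by (simp add: vec_eq_iff chart_diag_def)

lemma chart_diag_add: "chart_diag (A + B) = chart_diag A + chart_diag B"
  by (simp add: chart_diag_def vec_eq_iff)

lemma chart_diag_real [simp]: "chart_left (diag_real x) = 0" "chart_right (diag_real x) = 0"
  by (auto simp: vec_eq_iff chart_left_def chart_right_def diag_real_nth)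

lemma chart_diag_diag_real [simp]: "chart_diag (diag_real x) = x"
  by (simp add: vec_eq_iff chart_diag_def diag_real_nth)

definition svd_chart_deriv :: "('n::{finite,linorder}) cmat \<Rightarrow> 'n cmat \<Rightarrow> 'n cmat" where
  "svd_chart_deriv W H =
     (let A = cayley_resolvent (chart_left W); B = cayley_resolvent (chart_right W) in
       cayley (chart_left W) ** diag_real (chart_diag W) ** (B ** chart_right H ** B + B ** chart_right H ** B)
       + (cayley (chart_left W) ** diag_real (chart_diag H)
         + (A ** chart_left H ** A + A ** chart_left H ** A) ** diag_real (chart_diag W)) ** cayley (chart_right W))"

lemma has_derivative_svd_chart: "(svd_chart has_derivative svd_chart_deriv W) (at W)"
proof -
  note mult = bounded_bilinear.FDERIV[OF bounded_bilinear_matrix_mult]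
  have 1: "((\<lambda>W. cayley (chart_left W)) has_derivative
      (\<lambda>H. cayley_resolvent (chart_left W) ** chart_left H ** cayley_resolvent (chart_left W)
         + cayley_resolvent (chart_left W) ** chart_left H ** cayley_resolvent (chart_left W))) (at W)"
    unfolding cayley_def
    by (rule has_derivative_eq_rhs, (rule derivative_intros has_derivative_resolvent bounded_linear_chart chart_skew)+) simp
  have 2: "((\<lambda>W. cayley (chart_right W)) has_derivative
      (\<lambda>H. cayley_resolvent (chart_right W) ** chart_right H ** cayley_resolvent (chart_right W)
         + cayley_resolvent (chart_right W) ** chart_right H ** cayley_resolvent (chart_right W))) (at W)"
    unfolding cayley_def
    by (rule has_derivative_eq_rhs, (rule derivative_intros has_derivative_resolvent bounded_linear_chart chart_skew)+) simp
  have 3: "((\<lambda>W :: 'a cmat. diag_real (chart_diag W)) has_derivative (\<lambda>H. diag_real (chart_diag H))) (at W)"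
    by (intro bounded_linear_imp_has_derivative bounded_linear_compose[OF bounded_linear_diag_real] bounded_linear_chart_diag)
  show ?thesis
    unfolding svd_chart_def[abs_def] svd_chart_deriv_def[abs_def] Let_def
    by (rule mult[OF mult[OF 1 3] 2])
qed

lemma continuous_on_chart_diag: "continuous_on S chart_diag"
  using bounded_linear_chart_diag by (rule linear_continuous_on)

lemma continuous_svd_chart_deriv: "continuous_on UNIV (\<lambda>W. svd_chart_deriv W H)"
proof -
  have "continuous_on UNIV (\<lambda>W. cayley_resolvent (chart_left W))" "continuous_on UNIV (\<lambda>W. cayley_resolvent (chart_right W))"
    by (intro continuous_resolvent bounded_linear_chart chart_skew)+
  moreover have "continuous_on UNIV (\<lambda>W. diag_real (chart_diag W))"
    by (intro linear_continuous_on bounded_linear_compose[OF bounded_linear_diag_real] bounded_linear_chart_diag)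
  ultimately show ?thesis
    unfolding svd_chart_deriv_def Let_def cayley_def by (intro continuous_intros)
qed

text \<open>
  For \<open>i < j\<close> the two entries of \<open>H\<close> at \<open>(i, j)\<close> and \<open>(j, i)\<close> satisfy a linear system with
  determinant \<open>x\<^sub>j\<^sup>2 - x\<^sub>i\<^sup>2 \<noteq> 0\<close>; on the diagonal, real and imaginary part are separated by
  \<open>x\<^sub>i > 0\<close>.
\<close>

lemma svd_chart_deriv_at_diag:
  assumes x: "x \<in> chamber" and 0: "svd_chart_deriv (diag_real x) H = 0"
  shows "H = 0"
proof -
  have pos: "x $ i > 0" for i using x by (simp add: chamber_def)
  have E: "diag_real x ** (chart_right H + chart_right H)
    + (diag_real (chart_diag H) + (chart_left H + chart_left H) ** diag_real x) = 0"
    using 0 by (simp add: svd_chart_deriv_def cayley_0 resolvent_0)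
  have E': "of_real (x $ i) * (chart_right H $ i $ j + chart_right H $ i $ j)
    + (diag_real (chart_diag H) $ i $ j + (chart_left H $ i $ j + chart_left H $ i $ j) * of_real (x $ j)) = 0" for i j
  proof -
    have "(diag_real x ** (chart_right H + chart_right H)
      + (diag_real (chart_diag H) + (chart_left H + chart_left H) ** diag_real x)) $ i $ j = 0"
      unfolding E by simp
    then show ?thesis by simp
  qed
  have off: "H $ i $ j = 0 \<and> H $ j $ i = 0" if "i < j" for i j
  proof -
    define a where "a = H $ i $ j"
    define b where "b = cnj (H $ j $ i)"
    have "of_real (x $ i) * (- b + - b) + (a + a) * of_real (x $ j) = 0"
      using E'[of i j] that less_imp_neq[OF that] by (simp add: a_def b_def chart_left_def chart_right_def diag_real_nth)
    then have 1: "of_real (x $ j) * a = of_real (x $ i) * b" by (simp add: algebra_simps)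
    have "of_real (x $ j) * (cnj b + cnj b) + (- cnj a + - cnj a) * of_real (x $ i) = 0"
      using E'[of j i] that less_imp_neq[OF that] less_imp_not_less[OF that]
      by (simp add: a_def b_def chart_left_def chart_right_def diag_real_nth)
    then have "cnj (of_real (x $ j) * b) = cnj (of_real (x $ i) * a)" by (simp add: algebra_simps)
    then have 2: "of_real (x $ j) * b = of_real (x $ i) * a" by (simp only: complex_cnj_cancel_iff)
    have "of_real (x $ j) * (of_real (x $ j) * a) = of_real (x $ i) * (of_real (x $ i) * a)"
      unfolding 1 by (simp add: mult.left_commute 2)
    then have "(of_real (x $ j * x $ j) - of_real (x $ i * x $ i)) * a = 0" by (simp add: algebra_simps)
    moreover have "x $ j * x $ j < x $ i * x $ i"
      using that x pos by (intro mult_strict_mono) (auto simp: chamber_def less_imp_le)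
    ultimately have "a = 0" by (simp del: of_real_mult)
    then have "b = 0" using 2 pos[of j] by simp
    then show ?thesis using \<open>a = 0\<close> by (simp add: a_def b_def)
  qed
  have diag: "H $ i $ i = 0" for i
  proof -
    have "of_real (x $ i) * (\<i> * Im (H $ i $ i) + \<i> * Im (H $ i $ i)) + of_real (Re (H $ i $ i)) = 0"
      using E'[of i i] by (simp add: chart_left_def chart_right_def diag_real_nth chart_diag_def)
    then show ?thesis using pos[of i] by (auto simp: complex_eq_iff)
  qed
  have "H $ i $ j = 0" for i j
    using off diag by (cases i j rule: linorder_cases) auto
  then show ?thesis by (simp add: vec_eq_iff)
qed

lemma open_chamber: "open (chamber :: ('n::{finite,linorder}) rvec set)"
proof -
  have "chamber = (\<Inter>i. {x. 0 < x $ i} \<inter> {x. x $ i < 1}) \<inter> (\<Inter>i. \<Inter>j\<in>{j. i < j}. {x :: 'n rvec. x $ j < x $ i})"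
    by (auto simp: chamber_def)
  moreover have "open ((\<Inter>i. {x. 0 < x $ i} \<inter> {x. x $ i < 1}) \<inter> (\<Inter>i. \<Inter>j\<in>{j. i < j}. {x :: 'n rvec. x $ j < x $ i}))"
    by (auto intro!: open_Int open_INT open_Collect_less continuous_intros)
  ultimately show ?thesis by simp
qed

definition svd_orbit :: "(real^'n::{finite,linorder}) set \<Rightarrow> 'n cmat set" where
  "svd_orbit E = {U ** diag_real x ** V | U x V. U \<in> unitary_group \<and> V \<in> unitary_group \<and> x \<in> E}"

text \<open>
  The inverse function theorem for the chart.  By uniqueness of singular values, a matrix in
  the image of the chart has singular values in \<open>E\<close> if and only if its chart coordinate
  \<open>chart_diag\<close> lies in \<open>E\<close>.
\<close>

lemma svd_local_chart:
  fixes x0 :: "real^'n::{finite,linorder}"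
  assumes x0: "x0 \<in> chamber"
  obtains S T g where "open S" "diag_real x0 \<in> S" "open T" "diag_real x0 \<in> T"
    "svd_chart differentiable_on S" "g differentiable_on T"
    "\<And>E. E \<subseteq> chamber \<Longrightarrow> svd_orbit E \<inter> T = svd_chart ` (S \<inter> chart_diag -` E)"
    "\<And>E. E \<subseteq> chamber \<Longrightarrow> g ` (svd_orbit E \<inter> T) = S \<inter> chart_diag -` E"
proof -
  define S0 :: "'n cmat set" where "S0 = chart_diag -` chamber"
  have "open S0" unfolding S0_def using open_chamber continuous_on_chart_diag by (rule open_vimage)
  define f' where "f' W = Blinfun (svd_chart_deriv W)" for W :: "'n cmat"
  have bl: "bounded_linear (svd_chart_deriv W)" for W :: "'n cmat"
    using has_derivative_svd_chart by (rule has_derivative_bounded_linear)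
  then have f': "blinfun_apply (f' W) = svd_chart_deriv W" for W
    unfolding f'_def by (rule bounded_linear_Blinfun_apply)
  have "inj (svd_chart_deriv (diag_real x0))"
    using svd_chart_deriv_at_diag[OF x0] bl by (auto simp: linear_injective_0 bounded_linear.linear)
  then obtain h where h: "linear h" "h \<circ> svd_chart_deriv (diag_real x0) = id"
    using linear_injective_left_inverse bl bounded_linear.linear by blast
  then have hb: "bounded_linear h" by (simp add: linear_conv_bounded_linear)
  have inv: "Blinfun h o\<^sub>L f' (diag_real x0) = id_blinfun"
    using h(2) by (intro blinfun_eqI) (simp add: f' bounded_linear_Blinfun_apply[OF hb] fun_eq_iff)
  have der: "\<And>W. W \<in> S0 \<Longrightarrow> (svd_chart has_derivative blinfun_apply (f' W)) (at W)"
    unfolding f' by (rule has_derivative_svd_chart)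
  have cont: "continuous_on S0 f'"
    by (rule continuous_on_blinfun_componentwise)
      (unfold f', rule continuous_on_subset[OF continuous_svd_chart_deriv], simp)
  have x0S: "diag_real x0 \<in> S0" using x0 by (simp add: S0_def)
  obtain S T g g' where S: "open S" "S \<subseteq> S0" "diag_real x0 \<in> S" and T: "open T" "svd_chart (diag_real x0) \<in> T"
    and hom: "homeomorphism S T svd_chart g" and g: "\<And>y. y \<in> T \<Longrightarrow> (g has_derivative g' y) (at y)"
    and "\<And>y. y \<in> T \<Longrightarrow> g' y = inv (blinfun_apply (f' (g y)))"
    and "\<And>y. y \<in> T \<Longrightarrow> bij (blinfun_apply (f' (g y)))"
    by (rule inverse_function_theorem[OF \<open>open S0\<close> der cont x0S inv]) (assumption | rule that)+
  have img: "svd_orbit E \<inter> T = svd_chart ` (S \<inter> chart_diag -` E)" if E: "E \<subseteq> chamber" for E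
  proof (intro subset_antisym subsetI)
    fix Z assume Z: "Z \<in> svd_orbit E \<inter> T"
    then have gZ: "g Z \<in> S" "svd_chart (g Z) = Z"
      using hom by (auto simp: homeomorphism_def)
    obtain U V x where UV: "U \<in> unitary_group" "V \<in> unitary_group" "x \<in> E" "Z = U ** diag_real x ** V"
      using Z by (auto simp: svd_orbit_def)
    have "U ** diag_real x ** V = cayley (chart_left (g Z)) ** diag_real (chart_diag (g Z)) ** cayley (chart_right (g Z))"
      using gZ(2) UV by (simp add: svd_chart_def)
    moreover have "chart_diag (g Z) \<in> chamber" using gZ S by (auto simp: S0_def)
    ultimately have "x = chart_diag (g Z)"
      using svd_unique[of U V "cayley (chart_left (g Z))" "cayley (chart_right (g Z))" x "chart_diag (g Z)"] UV E
        unitary_cayley chart_skew by blast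
    then show "Z \<in> svd_chart ` (S \<inter> chart_diag -` E)"
      using gZ UV by (metis IntI image_eqI vimageI2)
  next
    fix Z assume "Z \<in> svd_chart ` (S \<inter> chart_diag -` E)"
    then obtain W where W: "W \<in> S" "chart_diag W \<in> E" "Z = svd_chart W" by auto
    then have "Z \<in> T" using hom by (auto simp: homeomorphism_def)
    moreover have "Z \<in> svd_orbit E"
      using W unitary_cayley[OF chart_skew(1)] unitary_cayley[OF chart_skew(2)]
      unfolding svd_orbit_def svd_chart_def by blast
    ultimately show "Z \<in> svd_orbit E \<inter> T" by blast
  qed
  have "g ` (svd_orbit E \<inter> T) = S \<inter> chart_diag -` E" if "E \<subseteq> chamber" for E
  proof -
    have "g (svd_chart W) = W" if "W \<in> S" for W using hom that by (auto simp: homeomorphism_def)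
    then have "(\<lambda>W. g (svd_chart W)) ` (S \<inter> chart_diag -` E) = S \<inter> chart_diag -` E" by (auto simp: image_iff)
    then show ?thesis unfolding img[OF that] by (simp add: image_image)
  qed
  moreover have "svd_chart (diag_real x0) = diag_real x0"
    by (simp add: svd_chart_def cayley_0)
  moreover have "svd_chart differentiable_on S"
    unfolding differentiable_on_def differentiable_def
    using has_derivative_svd_chart has_derivative_at_withinI by blast
  moreover have "g differentiable_on T"
    unfolding differentiable_on_def differentiable_def
    using g has_derivative_at_withinI by blast
  ultimately show ?thesis using that[of S T g] S T img by simp
qed

lemma negligible_vimage_chart_diag:
  fixes E :: "(real^'n) set"
  assumes "negligible E" shows "negligible (chart_diag -` E)"
proof -
  obtain N where N: "N \<in> null_sets lborel" "E \<subseteq> N" using assms negligible_iff_borel_null by blast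
  then have Nb [measurable]: "N \<in> sets borel" by (auto dest: null_setsD2)
  have d [measurable]: "(chart_diag :: _ \<Rightarrow> real^'n) \<in> borel_measurable borel"
      "(diag_real :: real^'n \<Rightarrow> _) \<in> borel_measurable borel"
    using bounded_linear_chart_diag bounded_linear_diag_real
    by (auto intro!: borel_measurable_continuous_onI linear_continuous_on)
  have "{s. Z + diag_real s \<in> chart_diag -` N} \<in> null_sets lborel" for Z
  proof -
    have "{s. Z + diag_real s \<in> chart_diag -` N} = (\<lambda>s. chart_diag Z + s) -` N"
      by (auto simp: chart_diag_add)
    moreover have "emeasure lborel ((\<lambda>s. chart_diag Z + s) -` N) = emeasure (distr lborel borel ((+) (chart_diag Z))) N"
      by (subst emeasure_distr) auto
    ultimately show ?thesis
      using N measurable_sets[of "(+) (chart_diag Z)" borel borel N] by (simp add: lborel_distr_plus null_sets_def)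
  qed
  moreover have "chart_diag -` N \<in> sets borel" using measurable_sets[OF d(1) Nb] by simp
  ultimately have "chart_diag -` N \<in> null_sets lborel"
    using null_iff_slices_null[OF d(2)] by simp
  then show ?thesis using N negligible_iff_borel_null by blast
qed

lemma linear_unitary_mult:
  fixes U V :: "complex^'n^'n"
  shows "linear (\<lambda>Z. U ** Z ** V)"
proof -
  have "bounded_linear (\<lambda>X :: complex^'n^'n. X ** V)"
    by (rule bounded_bilinear.bounded_linear_left[OF bounded_bilinear_matrix_mult])
  moreover have "bounded_linear (\<lambda>Z :: complex^'n^'n. U ** Z)"
    by (rule bounded_bilinear.bounded_linear_right[OF bounded_bilinear_matrix_mult])
  ultimately have "bounded_linear (\<lambda>Z. U ** Z ** V)" by (rule bounded_linear_compose)
  then show ?thesis by (rule bounded_linear.linear)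
qed

lemma negligible_linear_image_same:
  fixes f :: "'a::euclidean_space \<Rightarrow> 'a"
  assumes "linear f" "negligible S" shows "negligible (f ` S)"
  by (rule negligible_differentiable_image_negligible[OF order_refl assms(2) linear_imp_differentiable_on[OF assms(1)]])

text \<open>
  Both directions are local by Lindelof.  In a chart, the orbit set becomes the cylinder over
  \<open>E\<close>, and differentiable maps between spaces of equal dimension preserve null sets.  Unitary
  invariance moves the chart from \<open>D(x)\<close> to every matrix with these singular values.
  Conversely, a null cylinder has a null slice, which contains a translate of a piece of \<open>E\<close>.
\<close>

lemma negligible_svd_orbit_iff:
  assumes E: "E \<subseteq> chamber"
  shows "negligible (svd_orbit E) \<longleftrightarrow> negligible E"
proof
  assume neg: "negligible E"
  show "negligible (svd_orbit E)"
  proof (subst locally_negligible_alt, rule ballI)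
    fix Z assume "Z \<in> svd_orbit E"
    then obtain U V x0 where UV: "U \<in> unitary_group" "V \<in> unitary_group" "x0 \<in> E" and Z: "Z = U ** diag_real x0 ** V"
      by (auto simp: svd_orbit_def)
    obtain S T g where S: "open S" and T: "open T" "diag_real x0 \<in> T"
      and diff: "svd_chart differentiable_on S"
      and img: "\<And>E. E \<subseteq> chamber \<Longrightarrow> svd_orbit E \<inter> T = svd_chart ` (S \<inter> chart_diag -` E)"
      using svd_local_chart[of x0] UV E by (metis subsetD)
    have "negligible (S \<inter> chart_diag -` E)"
      using negligible_vimage_chart_diag[OF neg] by (rule negligible_subset) auto
    then have neg': "negligible (svd_orbit E \<inter> T)"
      unfolding img[OF E]
      by (rule negligible_differentiable_image_negligible[OF order_refl _ differentiable_on_subset[OF diff]]) auto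
    \<comment> \<open>The chart domain, moved from \<open>D(x0)\<close> to \<open>Z\<close>.\<close>
    define O' where "O' = (\<lambda>Z. adj U ** Z ** adj V) -` T"
    have "open O'"
      unfolding O'_def using T(1) by (rule open_vimage) (intro continuous_intros)
    have "adj U ** Z ** adj V = (adj U ** U) ** diag_real x0 ** (V ** adj V)"
      by (simp only: Z matrix_mul_assoc)
    then have "Z \<in> O'" using UV T by (simp add: O'_def)
    have "svd_orbit E \<inter> O' \<subseteq> (\<lambda>Z. U ** Z ** V) ` (svd_orbit E \<inter> T)"
    proof
      fix Y assume Y: "Y \<in> svd_orbit E \<inter> O'"
      have "Y = U ** (adj U ** Y ** adj V) ** V" using UV by (simp add: matrix_mul_assoc)
      moreover obtain U' V' x where Y': "U' \<in> unitary_group" "V' \<in> unitary_group" "x \<in> E" "Y = U' ** diag_real x ** V'"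
        using Y by (auto simp: svd_orbit_def)
      have "adj U ** Y ** adj V = (adj U ** U') ** diag_real x ** (V' ** adj V)"
        by (simp only: Y' matrix_mul_assoc)
      then have "adj U ** Y ** adj V \<in> svd_orbit E"
        unfolding svd_orbit_def using UV Y' by (metis (mono_tags, lifting) mem_Collect_eq unitary_adj unitary_mult)
      ultimately show "Y \<in> (\<lambda>Z. U ** Z ** V) ` (svd_orbit E \<inter> T)"
        using Y by (auto simp: O'_def)
    qed
    then have "negligible (svd_orbit E \<inter> O')"
      using negligible_linear_image_same[OF linear_unitary_mult neg'] negligible_subset by blast
    then show "\<exists>U. openin (top_of_set (svd_orbit E)) U \<and> Z \<in> U \<and> negligible U"
      using \<open>open O'\<close> \<open>Z \<in> O'\<close> \<open>Z \<in> svd_orbit E\<close> by (meson IntI openin_open_Int)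
  qed
next
  assume neg: "negligible (svd_orbit E)"
  show "negligible E"
  proof (subst locally_negligible_alt, rule ballI)
    fix x0 assume "x0 \<in> E"
    then obtain S T g where S: "open S" "diag_real x0 \<in> S" and T: "open T"
      and diff: "g differentiable_on T"
      and img: "\<And>E. E \<subseteq> chamber \<Longrightarrow> g ` (svd_orbit E \<inter> T) = S \<inter> chart_diag -` E"
      using svd_local_chart[of x0] E by (metis subsetD)
    have "negligible (svd_orbit E \<inter> T)" using neg by (rule negligible_subset) auto
    then have neg': "negligible (S \<inter> chart_diag -` E)"
      unfolding img[OF E, symmetric]
      by (rule negligible_differentiable_image_negligible[OF order_refl _ differentiable_on_subset[OF diff]]) auto
    have "open ((\<lambda>(Z, s). Z + diag_real s) -` S)"
      unfolding case_prod_beta using S(1)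
      by (rule open_vimage) (intro continuous_on_add bounded_linear.continuous_on[OF bounded_linear_diag_real]
          continuous_on_fst continuous_on_snd continuous_on_id)
    moreover have "(0, x0) \<in> (\<lambda>(Z, s). Z + diag_real s) -` S" using S(2) by simp
    ultimately obtain P Q where "open P" "open Q" "(0, x0) \<in> P \<times> Q" "P \<times> Q \<subseteq> (\<lambda>(Z, s). Z + diag_real s) -` S"
      by (rule open_prod_elim)
    then have PQ: "open P" "open Q" "0 \<in> P" "x0 \<in> Q" "P \<times> Q \<subseteq> (\<lambda>(Z, s). Z + diag_real s) -` S"
      by auto
    obtain \<delta> where \<delta>: "\<delta> > 0" "ball x0 \<delta> \<subseteq> Q" using PQ open_contains_ball by blast
    \<comment> \<open>Base points \<open>Z\<close> for the slices, close enough to zero that the slice still meets the chart domain and is hardly shifted.\<close>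
    define P' where "P' = P \<inter> chart_diag -` ball 0 (\<delta>/2)"
    have "open P'" unfolding P'_def using PQ continuous_on_chart_diag by (intro open_Int open_vimage) auto
    moreover have "0 \<in> P'" using PQ \<delta> by (simp add: P'_def)
    ultimately have nn: "\<not> negligible P'" using open_not_negligible by blast
    have "diag_real \<in> borel_measurable borel"
      using bounded_linear_diag_real by (auto intro!: borel_measurable_continuous_onI linear_continuous_on)
    then have "AE Z in lborel. negligible {s. Z + diag_real s \<in> S \<inter> chart_diag -` E}"
      using neg' by (rule negligible_imp_slices_negligible)
    then obtain N where "N \<in> null_sets lborel" "{Z. \<not> negligible {s. Z + diag_real s \<in> S \<inter> chart_diag -` E}} \<subseteq> N"
      unfolding eventually_ae_filter by auto
    then obtain Z where Z: "Z \<in> P'" "negligible {s. Z + diag_real s \<in> S \<inter> chart_diag -` E}"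
      using nn negligible_iff_borel_null by blast
    have "E \<inter> ball x0 (\<delta>/2) \<subseteq> (+) (chart_diag Z) ` {s. Z + diag_real s \<in> S \<inter> chart_diag -` E}"
    proof
      fix y assume y: "y \<in> E \<inter> ball x0 (\<delta>/2)"
      define s where "s = y - chart_diag Z"
      have "norm (x0 - y) < \<delta>/2" "norm (chart_diag Z) < \<delta>/2" using y Z(1) by (auto simp: P'_def dist_norm)
      then have "norm ((x0 - y) + chart_diag Z) < \<delta>"
        using norm_triangle_ineq[of "x0 - y" "chart_diag Z"] by linarith
      then have "s \<in> Q" using \<delta> by (auto simp: s_def dist_norm algebra_simps)
      then have "Z + diag_real s \<in> S" using PQ(5) Z(1) by (auto simp: P'_def)
      moreover have "chart_diag (Z + diag_real s) = y" by (simp add: chart_diag_add s_def)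
      ultimately show "y \<in> (+) (chart_diag Z) ` {s. Z + diag_real s \<in> S \<inter> chart_diag -` E}"
        using y by (intro image_eqI[of _ _ s]) (auto simp: s_def)
    qed
    then have "negligible (E \<inter> ball x0 (\<delta>/2))"
      using negligible_translation[OF Z(2)] negligible_subset by blast
    then show "\<exists>U. openin (top_of_set E) U \<and> x0 \<in> U \<and> negligible U"
      using \<open>x0 \<in> E\<close> \<delta>(1) by (intro exI[of _ "E \<inter> ball x0 (\<delta>/2)"]) (auto intro: openin_open_Int)
  qed
qed

section \<open>Compactness and measurability\<close>

lemma continuous_on_adj [continuous_intros]:
  "continuous_on S f \<Longrightarrow> continuous_on S (\<lambda>x. adj (f x))"
  unfolding adj_def by (intro continuous_on_vec_lambda continuous_on_cnj continuous_on_component)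

lemma compact_unitary_group: "compact (unitary_group :: (complex^'n^'n) set)"
proof -
  have "closed {U :: complex^'n^'n. adj U ** U = mat 1}" "closed {U :: complex^'n^'n. U ** adj U = mat 1}"
    by (intro closed_Collect_eq continuous_intros)+
  then have "closed (unitary_group :: (complex^'n^'n) set)"
    unfolding unitary_group_def Collect_conj_eq by (rule closed_Int)
  moreover have "norm U = norm (mat 1 :: complex^'n^'n)" if "U \<in> unitary_group" for U :: "complex^'n^'n"
    using norm_unitary_left[OF that, of "mat 1"] by simp
  then have "bounded (unitary_group :: (complex^'n^'n) set)"
    unfolding bounded_iff by (metis order_refl)
  ultimately show ?thesis by (simp add: compact_eq_bounded_closed)
qed

definition svd_map :: "((('n::finite) cmat \<times> 'n cmat) \<times> 'n rvec) \<Rightarrow> 'n cmat" where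
  "svd_map = (\<lambda>((U, V), x). U ** diag_real x ** V)"

lemma continuous_on_svd_map: "continuous_on S svd_map"
  unfolding svd_map_def case_prod_beta
  by (intro continuous_intros bounded_linear.continuous_on[OF bounded_linear_diag_real])

text \<open>
  The chamber is a countable union of compact sets and the unitary group is compact, so the
  image is a countable union of compact sets.  All Borel measurability of the inverse of the
  polar map comes from this fact.
\<close>

lemma svd_map_closed_borel:
  fixes G :: "((('n::{finite,linorder}) cmat \<times> 'n cmat) \<times> 'n rvec) set"
  assumes "closed G"
  shows "svd_map ` (((unitary_group \<times> unitary_group) \<times> chamber) \<inter> G) \<in> sets borel"
proof -
  obtain C :: "nat \<Rightarrow> 'n rvec set" where C: "\<And>n. compact (C n)" "(\<Union>n. C n) = chamber"
    using open_Union_compact_subsets[OF open_chamber] by metis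
  have "compact (svd_map ` (((unitary_group \<times> unitary_group) \<times> C n) \<inter> G))" for n
    using assms C by (intro compact_continuous_image continuous_on_svd_map compact_Int_closed compact_Times compact_unitary_group)
  then have "(\<Union>n. svd_map ` (((unitary_group \<times> unitary_group) \<times> C n) \<inter> G)) \<in> sets borel"
    by (intro sets.countable_UN) (auto intro: borel_compact)
  moreover have "(\<Union>n. svd_map ` (((unitary_group \<times> unitary_group) \<times> C n) \<inter> G))
      = svd_map ` (((unitary_group \<times> unitary_group) \<times> chamber) \<inter> G)"
    unfolding C(2)[symmetric] by blast
  ultimately show ?thesis by simp
qed

lemma regular_ball_eq: "regular_ball = svd_map ` ((unitary_group \<times> unitary_group) \<times> chamber)"
  (is "_ = ?R")
proof (intro subset_antisym subsetI)
  fix Z :: "'a cmat" assume "Z \<in> regular_ball"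
  then obtain U V x where "U \<in> unitary_group" "V \<in> unitary_group" "x \<in> chamber" "Z = U ** diag_real x ** V"
    by (rule svd_exists)
  then show "Z \<in> ?R" unfolding svd_map_def by (intro image_eqI[of _ _ "((U, V), x)"]) auto
next
  fix Z :: "'a cmat" assume "Z \<in> ?R"
  then show "Z \<in> regular_ball" by (auto simp: svd_map_def dest: svd_in_regular_ball)
qed

lemma svd_orbit_chamber: "svd_orbit chamber = regular_ball"
  unfolding regular_ball_eq svd_orbit_def svd_map_def image_def by fastforce

lemma borel_regular_ball [measurable]: "regular_ball \<in> sets borel"
  using svd_map_closed_borel[OF closed_UNIV] by (simp add: regular_ball_eq)

lemma emeasure_regular_ball:
  "emeasure lborel (regular_ball :: ('n::{finite,linorder}) cmat set) \<noteq> 0"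
  "emeasure lborel (regular_ball :: ('n::{finite,linorder}) cmat set) \<noteq> \<infinity>"
proof -
  have mono: "pos_index i < pos_index j" if "i < j" for i j :: 'n
  proof -
    have "{k. k < i} \<subset> {k. k < j}" using that by auto
    then show ?thesis unfolding pos_index_def by (intro psubset_card_mono) auto
  qed
  have "(\<chi> i. 1 / (real (pos_index i) + 2)) \<in> (chamber :: 'n rvec set)"
    using mono by (auto simp: chamber_def intro!: divide_strict_left_mono)
  then have "\<not> negligible (chamber :: 'n rvec set)"
    using open_chamber open_not_negligible by blast
  then have "\<not> negligible (regular_ball :: 'n cmat set)"
    using negligible_svd_orbit_iff[of "chamber :: 'n rvec set"] by (simp add: svd_orbit_chamber)
  then have "(regular_ball :: 'n cmat set) \<notin> null_sets lborel"
    using negligible_iff_borel_null by blast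
  then show "emeasure lborel (regular_ball :: 'n cmat set) \<noteq> 0"
    using borel_regular_ball by (simp add: null_sets_def)
  have "(chamber :: 'n rvec set) \<subseteq> cbox 0 (\<chi> i. 1)"
    by (auto simp: chamber_def mem_box_cart less_imp_le)
  then have "(regular_ball :: 'n cmat set) \<subseteq> svd_map ` ((unitary_group \<times> unitary_group) \<times> cbox 0 (\<chi> i. 1))"
    unfolding regular_ball_eq by blast
  moreover have "compact (svd_map ` ((unitary_group \<times> unitary_group) \<times> cbox (0 :: 'n rvec) (\<chi> i. 1)))"
    by (intro compact_continuous_image continuous_on_svd_map compact_Times compact_unitary_group compact_cbox)
  ultimately have "bounded (regular_ball :: 'n cmat set)"
    using bounded_subset compact_imp_bounded by blast
  then show "emeasure lborel (regular_ball :: 'n cmat set) \<noteq> \<infinity>"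
    using emeasure_bounded_finite by (metis infinity_ennreal_def less_irrefl)
qed

lemma borel_measurable_matrix_mult [measurable (raw)]:
  fixes f g :: "'a \<Rightarrow> complex^'n^'n"
  assumes "f \<in> borel_measurable M" "g \<in> borel_measurable M"
  shows "(\<lambda>x. f x ** g x) \<in> borel_measurable M"
  using assms by (rule borel_measurable_continuous_Pair) (intro continuous_intros)

lemma borel_measurable_adj [measurable (raw)]:
  assumes "f \<in> borel_measurable M"
  shows "(\<lambda>x. adj (f x)) \<in> borel_measurable M"
  by (rule borel_measurable_continuous_on[OF _ assms]) (intro continuous_intros)

lemma borel_measurable_diag_real [measurable (raw)]:
  assumes "f \<in> borel_measurable M"
  shows "(\<lambda>x. diag_real (f x)) \<in> borel_measurable M"
  by (rule borel_measurable_continuous_on[OF _ assms])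
    (intro linear_continuous_on bounded_linear_diag_real)

section \<open>Haar measure of the unitary group\<close>

text \<open>
  The unitary factor \<open>U V\<close> of \<open>Z = U D(x) V\<close>, which does not depend on the decomposition and is
  equivariant under left multiplication.
\<close>

definition polar_part :: "('n::{finite,linorder}) cmat \<Rightarrow> 'n cmat" where
  "polar_part Z = (if Z \<in> regular_ball then
     (SOME W. \<exists>U V x. U \<in> unitary_group \<and> V \<in> unitary_group \<and> x \<in> chamber \<and> Z = U ** diag_real x ** V \<and> W = U ** V)
     else mat 1)"

lemma polar_part_svd:
  assumes U: "U \<in> unitary_group" and V: "V \<in> unitary_group" and x: "x \<in> chamber"
  shows "polar_part (U ** diag_real x ** V) = U ** V"
proof -
  define P where "P W \<longleftrightarrow> (\<exists>U' V' x'. U' \<in> unitary_group \<and> V' \<in> unitary_group \<and> x' \<in> chamber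
      \<and> U ** diag_real x ** V = U' ** diag_real x' ** V' \<and> W = U' ** V')" for W
  have "P (U ** V)" unfolding P_def using assms by blast
  then have "P (SOME W. P W)" by (rule someI)
  then obtain U' V' x' where *: "U' \<in> unitary_group" "V' \<in> unitary_group" "x' \<in> chamber"
      "U ** diag_real x ** V = U' ** diag_real x' ** V'" "(SOME W. P W) = U' ** V'"
    unfolding P_def by blast
  obtain t where t: "t \<in> torus" "U' = U ** diag (conj_vec t)" "V' = diag t ** V"
    using svd_unique[OF U V *(1,2) x *(3,4)] by metis
  have "U' ** V' = U ** (diag (conj_vec t) ** diag t) ** V" by (simp only: t matrix_mul_assoc)
  also have "\<dots> = U ** V" by (simp add: diag_conj_cancel[OF t(1)])
  finally have "(SOME W. P W) = U ** V" using * by simp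
  then show ?thesis
    using svd_in_regular_ball[OF assms] unfolding polar_part_def P_def by (simp only: if_True)
qed

lemma polar_part_unitary: "polar_part Z \<in> unitary_group"
proof (cases "Z \<in> regular_ball")
  case True
  then obtain U V x where "U \<in> unitary_group" "V \<in> unitary_group" "x \<in> chamber" "Z = U ** diag_real x ** V"
    by (rule svd_exists)
  then show ?thesis by (simp add: polar_part_svd)
qed (simp add: polar_part_def)

lemma polar_part_mult:
  assumes "Z \<in> regular_ball" "W \<in> unitary_group"
  shows "polar_part (W ** Z) = W ** polar_part Z"
proof -
  obtain U V x where *: "U \<in> unitary_group" "V \<in> unitary_group" "x \<in> chamber" "Z = U ** diag_real x ** V"
    using assms(1) by (rule svd_exists)
  have "W ** Z = (W ** U) ** diag_real x ** V" by (simp add: * matrix_mul_assoc)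
  then show ?thesis
    using * assms by (simp add: polar_part_svd matrix_mul_assoc)
qed

lemma polar_part_measurable: "polar_part \<in> borel_measurable (restrict_space borel regular_ball)"
proof (rule borel_measurableI)
  fix S :: "'a cmat set" assume "open S"
  define G :: "(('a cmat \<times> 'a cmat) \<times> 'a rvec) set" where "G = (\<lambda>p. fst (fst p) ** snd (fst p)) -` (- S)"
  have "closed G"
    unfolding G_def using \<open>open S\<close>
    by (intro closed_vimage continuous_intros) (simp add: closed_def)
  then have 1: "svd_map ` (((unitary_group \<times> unitary_group) \<times> chamber) \<inter> G) \<in> sets borel"
    by (rule svd_map_closed_borel)
  define A :: "(('a cmat \<times> 'a cmat) \<times> 'a rvec) set" where "A = (unitary_group \<times> unitary_group) \<times> chamber"
  have pp: "polar_part (svd_map q) = fst (fst q) ** snd (fst q)" if "q \<in> A" for q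
    using that by (auto simp: A_def svd_map_def polar_part_svd)
  have "svd_map ` (A \<inter> G) = polar_part -` (- S) \<inter> svd_map ` A"
    using pp by (auto simp: G_def)
  then have "svd_map ` (((unitary_group \<times> unitary_group) \<times> chamber) \<inter> G) = polar_part -` (- S) \<inter> regular_ball"
    unfolding A_def regular_ball_eq .
  then have "polar_part -` S \<inter> regular_ball
      = regular_ball - svd_map ` (((unitary_group \<times> unitary_group) \<times> chamber) \<inter> G)" by blast
  moreover have "\<dots> \<in> sets borel" using 1 borel_regular_ball by (rule sets.Diff[rotated])
  ultimately have "polar_part -` S \<inter> regular_ball \<in> sets borel" by simp
  then show "polar_part -` S \<inter> space (restrict_space borel regular_ball) \<in> sets (restrict_space borel regular_ball)"
    by (simp add: space_restrict_space sets_restrict_space_iff)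
qed

lemma regular_ball_mult_iff:
  fixes Z :: "('n::{finite,linorder}) cmat"
  assumes U: "U \<in> unitary_group" and V: "V \<in> unitary_group"
  shows "U ** Z ** V \<in> regular_ball \<longleftrightarrow> Z \<in> regular_ball"
proof
  assume "U ** Z ** V \<in> regular_ball"
  then have 1: "adj U ** (U ** Z ** V) ** adj V \<in> regular_ball"
    by (rule regular_ball_unitary[OF _ unitary_adj[OF U] unitary_adj[OF V]])
  have "adj U ** (U ** Z ** V) ** adj V = Z"
    by (simp only: matrix_mul_assoc unitary_adj_left[OF U] matrix_mul_lid unitary_adj_right_assoc'[OF V])
  with 1 show "Z \<in> regular_ball" by (simp only:)
qed (rule regular_ball_unitary[OF _ U V])

lemma regular_ball_mult_left_iff:
  "U \<in> unitary_group \<Longrightarrow> U ** Z \<in> regular_ball \<longleftrightarrow> Z \<in> (regular_ball :: ('n::{finite,linorder}) cmat set)"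
  using regular_ball_mult_iff[of U "mat 1" Z] by simp

lemma regular_ball_mult_right_iff:
  "V \<in> unitary_group \<Longrightarrow> Z ** V \<in> regular_ball \<longleftrightarrow> Z \<in> (regular_ball :: ('n::{finite,linorder}) cmat set)"
  using regular_ball_mult_iff[of "mat 1" V Z] by simp

lemma emeasure_lborel_unitary:
  fixes A :: "(complex^'n^'n) set"
  assumes "U \<in> unitary_group" "V \<in> unitary_group" "A \<in> sets borel"
  shows "emeasure lborel ((\<lambda>Z. U ** Z ** V) -` A) = emeasure lborel A"
  using linear_unitary_mult _ assms(3) by (rule emeasure_lborel_linear_isometry) (simp add: assms)

text \<open>
  Lebesgue measure on the regular part of the ball is invariant under left multiplication by
  unitary matrices, and \<open>polar_part\<close> is equivariant, so its normalised image is a left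
  invariant probability measure.
\<close>

lemma unitary_haar_exists: "\<exists>\<mu> :: ('n::{finite,linorder}) cmat measure. is_unitary_haar \<mu>"
proof -
  let ?R = "regular_ball :: 'n cmat set"
  let ?G = "restrict_space borel (unitary_group :: 'n cmat set)"
  define \<nu> where "\<nu> = uniform_measure lborel ?R"
  define \<mu> where "\<mu> = distr \<nu> ?G polar_part"
  have "(polar_part :: 'n cmat \<Rightarrow> _) \<in> borel_measurable borel"
  proof -
    have "(\<lambda>Z :: 'n cmat. if Z \<in> regular_ball then polar_part Z else mat 1) \<in> borel_measurable borel"
      using polar_part_measurable borel_regular_ball
      by (subst measurable_If_restrict_space_iff) auto
    moreover have "(\<lambda>Z :: 'n cmat. if Z \<in> regular_ball then polar_part Z else mat 1) = polar_part"
      by (auto simp: polar_part_def fun_eq_iff)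
    ultimately show ?thesis by simp
  qed
  then have m0: "(polar_part :: 'n cmat \<Rightarrow> _) \<in> borel \<rightarrow>\<^sub>M ?G"
    by (intro measurable_restrict_space2) (auto simp: polar_part_unitary)
  then have m: "polar_part \<in> \<nu> \<rightarrow>\<^sub>M ?G"
    by (simp add: \<nu>_def measurable_def)
  have em: "emeasure \<mu> A = emeasure lborel (?R \<inter> polar_part -` A) / emeasure lborel ?R" if "A \<in> sets ?G" for A
  proof -
    have "polar_part -` A \<in> sets lborel" using measurable_sets[OF m0 that] by simp
    then show ?thesis
      unfolding \<mu>_def using borel_regular_ball
      by (subst emeasure_distr[OF m that]) (simp add: \<nu>_def emeasure_uniform_measure)
  qed
  have sets: "sets \<mu> = sets ?G" by (simp add: \<mu>_def)
  have "unitary_group \<in> sets ?G"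
    using sets.top[of ?G] by (simp add: space_restrict_space)
  then have "emeasure \<mu> unitary_group = 1"
    using emeasure_regular_ball[where 'n = 'n]
    by (subst em) (auto simp: ennreal_divide_self vimage_def less_top polar_part_unitary)
  moreover have "distr \<mu> \<mu> (\<lambda>V. U ** V) = \<mu>" if U: "U \<in> unitary_group" for U
  proof (rule measure_eqI)
    have mU: "(\<lambda>V. U ** V) \<in> \<mu> \<rightarrow>\<^sub>M \<mu>"
    proof -
      have "(\<lambda>V. U ** V) \<in> ?G \<rightarrow>\<^sub>M ?G"
        using U by (intro measurable_restrict_space2 measurable_restrict_space1) (auto simp: space_restrict_space)
      then show ?thesis by (simp add: measurable_cong_sets[OF sets sets])
    qed
    show "sets (distr \<mu> \<mu> (\<lambda>V. U ** V)) = sets \<mu>" by simp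
    fix A assume "A \<in> sets (distr \<mu> \<mu> (\<lambda>V. U ** V))"
    then have A: "A \<in> sets \<mu>" by simp
    have sp: "space \<mu> = unitary_group" by (simp add: \<mu>_def space_restrict_space)
    have A': "(\<lambda>V. U ** V) -` A \<inter> space \<mu> \<in> sets \<mu>" using mU A by (rule measurable_sets)
    have "?R \<inter> polar_part -` ((\<lambda>V. U ** V) -` A \<inter> space \<mu>) = (\<lambda>Z. U ** Z ** mat 1) -` (?R \<inter> polar_part -` A)"
      using U polar_part_mult regular_ball_mult_left_iff[OF U]
      by (auto simp: sp polar_part_unitary)
    moreover have "?R \<inter> polar_part -` A \<in> sets borel"
      using measurable_sets[OF m0] A sets borel_regular_ball by (metis inf_top.right_neutral sets.Int space_borel)
    ultimately have "emeasure lborel (?R \<inter> polar_part -` ((\<lambda>V. U ** V) -` A \<inter> space \<mu>)) = emeasure lborel (?R \<inter> polar_part -` A)"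
      using U by (simp only: emeasure_lborel_unitary unitary_1)
    then show "emeasure (distr \<mu> \<mu> (\<lambda>V. U ** V)) A = emeasure \<mu> A"
      using A A' mU sets by (simp add: emeasure_distr em)
  qed
  ultimately have "is_unitary_haar \<mu>" using sets by (simp add: is_unitary_haar_def)
  then show ?thesis by blast
qed

abbreviation haar :: "('n::{finite,linorder}) cmat measure" where
  "haar \<equiv> unitary_haar"

lemma is_unitary_haar: "is_unitary_haar (haar :: ('n::{finite,linorder}) cmat measure)"
  unfolding unitary_haar_def using unitary_haar_exists by (rule someI_ex)

lemma sets_haar [measurable_cong]: "sets haar = sets (restrict_space borel unitary_group)"
  and emeasure_haar [simp]: "emeasure haar unitary_group = 1"
  and distr_haar: "U \<in> unitary_group \<Longrightarrow> distr haar haar (\<lambda>V. U ** V) = haar"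
  using is_unitary_haar by (auto simp: is_unitary_haar_def)

lemma space_haar [simp]: "space haar = unitary_group"
  using sets_eq_imp_space_eq[OF sets_haar] by (simp add: space_restrict_space)

lemma finite_measure_haar: "finite_measure haar"
  by (rule finite_measureI) (simp add: emeasure_haar)

lemma sigma_finite_haar: "sigma_finite_measure haar"
  using finite_measure_haar by (rule finite_measure.axioms)

lemma measurable_haar: "f \<in> borel \<rightarrow>\<^sub>M N \<Longrightarrow> f \<in> haar \<rightarrow>\<^sub>M N"
  by (simp add: measurable_cong_sets[OF sets_haar refl] measurable_restrict_space1)

lemma measurable_haar_ident [measurable]: "(\<lambda>U. U) \<in> haar \<rightarrow>\<^sub>M borel"
  by (rule measurable_haar) simp

lemma nn_integral_haar_const: "(\<integral>\<^sup>+V. c \<partial>haar) = c"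
  by (simp add: emeasure_haar)

lemma nn_integral_haar_left:
  assumes "U \<in> unitary_group" and f: "f \<in> borel_measurable borel"
  shows "(\<integral>\<^sup>+V. f (U ** V) \<partial>haar) = (\<integral>\<^sup>+V. f V \<partial>haar)"
proof -
  have "(\<lambda>V. U ** V) \<in> haar \<rightarrow>\<^sub>M restrict_space borel unitary_group"
    using assms(1) by (intro measurable_restrict_space2) auto
  then have m: "(\<lambda>V. U ** V) \<in> haar \<rightarrow>\<^sub>M haar" by (simp add: measurable_cong_sets[OF refl sets_haar])
  have "(\<integral>\<^sup>+V. f V \<partial>haar) = (\<integral>\<^sup>+V. f V \<partial>distr haar haar (\<lambda>V. U ** V))"
    using assms by (simp only: distr_haar)
  also have "\<dots> = (\<integral>\<^sup>+V. f (U ** V) \<partial>haar)"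
    by (rule nn_integral_distr[OF m]) (simp add: measurable_haar f)
  finally show ?thesis ..
qed

text \<open>
  Integrate \<open>f (adj U ** V)\<close> over both variables.  Left invariance in \<open>V\<close> gives one side; after
  exchanging the integrals, left invariance in \<open>U\<close> gives the other.  Two-sided invariance
  follows.
\<close>

lemma nn_integral_haar_adj:
  assumes f [measurable]: "f \<in> borel_measurable borel"
  shows "(\<integral>\<^sup>+V. f (adj V) \<partial>haar) = (\<integral>\<^sup>+V. f V \<partial>(haar :: ('n::{finite,linorder}) cmat measure))"
proof -
  interpret pair_sigma_finite haar haar
    by (intro pair_sigma_finite.intro sigma_finite_haar)
  have "(\<integral>\<^sup>+V. f V \<partial>haar) = (\<integral>\<^sup>+U. \<integral>\<^sup>+V. f V \<partial>haar \<partial>(haar :: 'n cmat measure))"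
    by (simp add: nn_integral_haar_const)
  also have "\<dots> = (\<integral>\<^sup>+U. \<integral>\<^sup>+V. f (adj U ** V) \<partial>haar \<partial>haar)"
    by (rule nn_integral_cong) (simp add: nn_integral_haar_left)
  also have "\<dots> = (\<integral>\<^sup>+V. \<integral>\<^sup>+U. f (adj U ** V) \<partial>haar \<partial>haar)"
    by (rule Fubini') measurable
  also have "\<dots> = (\<integral>\<^sup>+V. \<integral>\<^sup>+U. f (adj (adj V ** U)) \<partial>haar \<partial>haar)"
    by (simp add: adj_mult)
  also have "\<dots> = (\<integral>\<^sup>+V. \<integral>\<^sup>+U. f (adj U) \<partial>haar \<partial>(haar :: 'n cmat measure))"
    by (rule nn_integral_cong) (rule nn_integral_haar_left[where f = "\<lambda>U. f (adj U)"], simp_all)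
  also have "\<dots> = (\<integral>\<^sup>+U. f (adj U) \<partial>haar)"
    by (simp add: nn_integral_haar_const)
  finally show ?thesis ..
qed

lemma nn_integral_haar_right:
  assumes U: "U \<in> unitary_group" and f [measurable]: "f \<in> borel_measurable borel"
  shows "(\<integral>\<^sup>+V. f (V ** U) \<partial>haar) = (\<integral>\<^sup>+V. f V \<partial>haar)"
proof -
  have "(\<integral>\<^sup>+V. f (V ** U) \<partial>haar) = (\<integral>\<^sup>+V. f (adj V ** U) \<partial>haar)"
    by (rule nn_integral_haar_adj[symmetric, where f = "\<lambda>V. f (V ** U)"]) simp
  also have "\<dots> = (\<integral>\<^sup>+V. f (adj (adj U ** V)) \<partial>haar)"
    by (simp add: adj_mult)
  also have "\<dots> = (\<integral>\<^sup>+V. f (adj V) \<partial>haar)"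
    by (rule nn_integral_haar_left[where f = "\<lambda>V. f (adj V)"]) (use U in simp_all)
  also have "\<dots> = (\<integral>\<^sup>+V. f V \<partial>haar)" by (rule nn_integral_haar_adj) simp
  finally show ?thesis .
qed

section \<open>Null sets in polar coordinates\<close>

lemma AE_lborel_iff_negligible: "(AE x in lborel. P x) \<longleftrightarrow> negligible {x. \<not> P x}"
  unfolding eventually_ae_filter negligible_iff_borel_null by simp

definition svd_measure :: "((('n::{finite,linorder}) cmat \<times> 'n cmat) \<times> 'n rvec) measure" where
  "svd_measure = (haar \<Otimes>\<^sub>M haar) \<Otimes>\<^sub>M restrict_space lborel chamber"

lemma sets_restrict_lborel [measurable_cong]: "sets (restrict_space lborel S) = sets (restrict_space borel S)"
  by (simp add: sets_restrict_space)

lemma borel_chamber [measurable]: "(chamber :: ('n::{finite,linorder}) rvec set) \<in> sets borel"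
  using open_chamber by (rule borel_open)

lemma sigma_finite_restrict_chamber: "sigma_finite_measure (restrict_space lborel chamber)"
  by (rule sigma_finite_measure_restrict_space) (simp_all add: sigma_finite_lborel)

lemma measurable_restrict_lborel_ident [measurable]: "(\<lambda>x. x) \<in> restrict_space lborel S \<rightarrow>\<^sub>M borel"
  by (simp add: measurable_restrict_space1)

lemma svd_map_measurable [measurable]:
  "(svd_map :: ((('n::{finite,linorder}) cmat \<times> 'n cmat) \<times> 'n rvec) \<Rightarrow> _) \<in> svd_measure \<rightarrow>\<^sub>M borel"
proof -
  have eq: "(svd_map :: (('n cmat \<times> 'n cmat) \<times> 'n rvec) \<Rightarrow> _) = (\<lambda>q. fst (fst q) ** diag_real (snd q) ** snd (fst q))"
    by (auto simp: svd_map_def)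
  have 1: "(\<lambda>q :: ('n cmat \<times> 'n cmat) \<times> 'n rvec. fst (fst q)) \<in> svd_measure \<rightarrow>\<^sub>M borel"
    unfolding svd_measure_def
    by (rule measurable_compose[OF measurable_compose[OF measurable_fst measurable_fst] measurable_haar_ident])
  have 2: "(\<lambda>q :: ('n cmat \<times> 'n cmat) \<times> 'n rvec. snd (fst q)) \<in> svd_measure \<rightarrow>\<^sub>M borel"
    unfolding svd_measure_def
    by (rule measurable_compose[OF measurable_compose[OF measurable_fst measurable_snd] measurable_haar_ident])
  have 3: "(\<lambda>q :: ('n cmat \<times> 'n cmat) \<times> 'n rvec. snd q) \<in> svd_measure \<rightarrow>\<^sub>M borel"
    unfolding svd_measure_def
    by (rule measurable_compose[OF measurable_snd measurable_restrict_lborel_ident])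
  show ?thesis
    unfolding eq by (rule borel_measurable_matrix_mult[OF borel_measurable_matrix_mult[OF 1 borel_measurable_diag_real[OF 3]] 2])
qed

text \<open>
  Let \<open>g(Z)\<close> be the measure of the pairs \<open>(U, V)\<close> with \<open>U Z V \<in> N\<close>.  By Fubini the integral of
  \<open>g\<close> is the Lebesgue measure of \<open>N\<close>, and the integral of \<open>g(D(x))\<close> over the chamber is the
  measure of the preimage of \<open>N\<close>.  Since \<open>g\<close> depends on singular values only, the two integrals
  vanish simultaneously by the comparison of null sets of singular values.
\<close>

lemma null_iff_svd_null:
  fixes N :: "('n::{finite,linorder}) cmat set"
  assumes N [measurable]: "N \<in> sets borel" and NR: "N \<subseteq> regular_ball"
  shows "emeasure lborel N = 0 \<longleftrightarrow> emeasure svd_measure (svd_map -` N \<inter> space svd_measure) = 0"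
proof -
  let ?P = "(haar :: 'n cmat measure) \<Otimes>\<^sub>M (haar :: 'n cmat measure)"
  let ?I = "indicator N :: 'n cmat \<Rightarrow> ennreal"
  interpret HH: pair_sigma_finite "haar :: 'n cmat measure" "haar :: 'n cmat measure"
    by (intro pair_sigma_finite.intro sigma_finite_haar)
  have sP: "sigma_finite_measure ?P" by (rule sigma_finite_pair_measure[OF sigma_finite_haar sigma_finite_haar])
  interpret PL: pair_sigma_finite ?P "lborel :: 'n cmat measure"
    by (intro pair_sigma_finite.intro sP sigma_finite_lborel)
  interpret PC: pair_sigma_finite ?P "restrict_space lborel chamber :: 'n rvec measure"
    by (intro pair_sigma_finite.intro sP sigma_finite_restrict_chamber)
  have "unitary_group \<in> sets (haar :: 'n cmat measure)" using sets.top[of "haar :: 'n cmat measure"] by simp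
  then have "emeasure ?P (unitary_group \<times> unitary_group) = 1"
    by (subst sigma_finite_measure.emeasure_pair_measure_Times[OF sigma_finite_haar]) simp_all
  then have P1: "(\<integral>\<^sup>+p. c \<partial>?P) = c" for c
    by (simp add: space_pair_measure)
  define g where "g Z = (\<integral>\<^sup>+p. ?I (fst p ** Z ** snd p) \<partial>?P)" for Z
  have g_iter: "g Z = (\<integral>\<^sup>+U. \<integral>\<^sup>+V. ?I (U ** Z ** V) \<partial>haar \<partial>haar)" for Z
    unfolding g_def by (subst sigma_finite_measure.nn_integral_fst[OF sigma_finite_haar, symmetric]) simp_all
  have g_meas [measurable]: "g \<in> borel_measurable borel"
    unfolding g_def by measurable
  have "(\<integral>\<^sup>+Z. g Z \<partial>lborel) = (\<integral>\<^sup>+p. \<integral>\<^sup>+Z. ?I (fst p ** Z ** snd p) \<partial>lborel \<partial>?P)"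
    unfolding g_def by (rule PL.Fubini') measurable
  also have "\<dots> = (\<integral>\<^sup>+p. emeasure lborel N \<partial>?P)"
  proof (rule nn_integral_cong)
    fix p assume "p \<in> space ?P"
    then have p: "fst p \<in> unitary_group" "snd p \<in> unitary_group" by (auto simp: space_pair_measure)
    have "(\<integral>\<^sup>+Z. ?I (fst p ** Z ** snd p) \<partial>lborel) = (\<integral>\<^sup>+Z. indicator ((\<lambda>Z. fst p ** Z ** snd p) -` N) Z \<partial>lborel)"
      by (intro nn_integral_cong) (simp add: indicator_def)
    also have "\<dots> = emeasure lborel ((\<lambda>Z. fst p ** Z ** snd p) -` N)"
      by (intro nn_integral_indicator) (simp, rule measurable_sets_borel[OF _ N], measurable)
    finally show "(\<integral>\<^sup>+Z. ?I (fst p ** Z ** snd p) \<partial>lborel) = emeasure lborel N"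
      using emeasure_lborel_unitary[OF p N] by simp
  qed
  also have "\<dots> = emeasure lborel N" by (rule P1)
  finally have "emeasure lborel N = 0 \<longleftrightarrow> (AE Z in lborel. g Z = 0)"
    using nn_integral_0_iff_AE[of g lborel] by simp
  also have "\<dots> \<longleftrightarrow> negligible {Z. g Z \<noteq> 0}" by (rule AE_lborel_iff_negligible)
  also have "{Z. g Z \<noteq> 0} = svd_orbit {x \<in> chamber. g (diag_real x) \<noteq> 0}"
  proof -
    have g_inv: "g (U0 ** Z ** V0) = g Z" if "U0 \<in> unitary_group" "V0 \<in> unitary_group" for U0 V0 Z
    proof -
      have "g (U0 ** Z ** V0) = (\<integral>\<^sup>+U. \<integral>\<^sup>+V. ?I ((U ** U0) ** Z ** (V0 ** V)) \<partial>haar \<partial>haar)"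
        by (simp add: g_iter matrix_mul_assoc)
      also have "\<dots> = (\<integral>\<^sup>+U. \<integral>\<^sup>+V. ?I ((U ** U0) ** Z ** V) \<partial>haar \<partial>haar)"
        by (intro nn_integral_cong nn_integral_haar_left[OF that(2), where f = "\<lambda>V. ?I (_ ** Z ** V)"]) measurable
      also have "\<dots> = g Z"
        unfolding g_iter
        by (rule nn_integral_haar_right[OF that(1), where f = "\<lambda>U. \<integral>\<^sup>+V. ?I (U ** Z ** V) \<partial>haar"]) measurable
      finally show ?thesis .
    qed
    show ?thesis
    proof (intro subset_antisym subsetI)
      fix Z assume "Z \<in> {Z. g Z \<noteq> 0}"
      then have gZ: "g Z \<noteq> 0" by simp
      have "\<exists>p\<in>space ?P. fst p ** Z ** snd p \<in> N"
      proof (rule ccontr)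
        assume *: "\<not> (\<exists>p\<in>space ?P. fst p ** Z ** snd p \<in> N)"
        have "g Z = (\<integral>\<^sup>+p. 0 \<partial>?P)"
          unfolding g_def by (intro nn_integral_cong) (use * in \<open>auto simp: indicator_def\<close>)
        then show False using gZ by simp
      qed
      then obtain U V where "U \<in> unitary_group" "V \<in> unitary_group" "U ** Z ** V \<in> N"
        by (auto simp: space_pair_measure)
      then have "Z \<in> regular_ball" using NR regular_ball_mult_iff by blast
      then obtain U V x where "U \<in> unitary_group" "V \<in> unitary_group" "x \<in> chamber" "Z = U ** diag_real x ** V"
        by (rule svd_exists)
      then show "Z \<in> svd_orbit {x \<in> chamber. g (diag_real x) \<noteq> 0}"
        using gZ unfolding svd_orbit_def by (auto simp: g_inv)
    next
      fix Z assume "Z \<in> svd_orbit {x \<in> chamber. g (diag_real x) \<noteq> 0}"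
      then show "Z \<in> {Z. g Z \<noteq> 0}" unfolding svd_orbit_def by (auto simp: g_inv)
    qed
  qed
  also have "negligible \<dots> \<longleftrightarrow> negligible {x \<in> chamber. g (diag_real x) \<noteq> 0}"
    by (rule negligible_svd_orbit_iff) auto
  also have "\<dots> \<longleftrightarrow> (AE x in lborel. x \<in> chamber \<longrightarrow> g (diag_real x) = 0)"
    unfolding AE_lborel_iff_negligible by simp
  also have "\<dots> \<longleftrightarrow> (AE x in restrict_space lborel chamber. g (diag_real x) = 0)"
    by (rule AE_restrict_space_iff[symmetric]) simp
  also have "\<dots> \<longleftrightarrow> (\<integral>\<^sup>+x. g (diag_real x) \<partial>restrict_space lborel chamber) = 0"
    by (rule nn_integral_0_iff_AE[symmetric]) measurable
  also have "(\<integral>\<^sup>+x. g (diag_real x) \<partial>restrict_space lborel chamber)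
      = (\<integral>\<^sup>+q. ?I (svd_map q) \<partial>svd_measure)"
    unfolding svd_measure_def g_def svd_map_def case_prod_beta
    by (subst PC.nn_integral_snd[symmetric]) (simp_all add: case_prod_beta)
  also have "\<dots> = (\<integral>\<^sup>+q. indicator (svd_map -` N \<inter> space svd_measure) q \<partial>svd_measure)"
    by (intro nn_integral_cong) (simp add: indicator_def)
  also have "\<dots> = emeasure svd_measure (svd_map -` N \<inter> space svd_measure)"
    by (intro nn_integral_indicator measurable_sets[OF svd_map_measurable] N)
  finally show ?thesis .
qed

section \<open>Quotient Borel structures and measurable sections\<close>

definition rep :: "'a set \<Rightarrow> 'a" where
  "rep c = (SOME s. s \<in> c)"

lemma rep_quotient:
  assumes R: "equiv S R" and c: "c \<in> S // R"
  shows "rep c \<in> c" "rep c \<in> S" "cls R (rep c) = c"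
proof -
  obtain s where s: "s \<in> S" "c = R `` {s}" using c by (rule quotientE)
  then have "s \<in> c" using equiv_class_self[OF R s(1)] by simp
  then show 1: "rep c \<in> c" unfolding rep_def by (rule someI)
  then have "(s, rep c) \<in> R" using s by simp
  then show "rep c \<in> S" "cls R (rep c) = c"
    using R s by (auto simp: cls_def equiv_class_eq_iff)
qed

lemma rep_cls_related:
  assumes "equiv S R" "s \<in> S" shows "(s, rep (cls R s)) \<in> R"
proof -
  have "rep (cls R s) \<in> cls R s"
    using assms by (intro rep_quotient(1)[OF assms(1)]) (simp add: cls_def quotientI)
  then show ?thesis by (simp add: cls_def)
qed

lemma space_quotient_borel [simp]: "space (quotient_borel S R) = S // R"
  by (simp add: quotient_borel_def space_measure_of_conv)

lemma measurable_quotientI: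
  assumes f: "f \<in> space M \<rightarrow> S // R"
    and meas: "\<And>E T. E \<subseteq> S // R \<Longrightarrow> open T \<Longrightarrow> \<Union>E = S \<inter> T \<Longrightarrow> f -` E \<inter> space M \<in> sets M"
  shows "f \<in> M \<rightarrow>\<^sub>M quotient_borel S R"
  unfolding quotient_borel_def
proof (rule measurable_measure_of)
  show "{E. E \<subseteq> S // R \<and> openin (top_of_set S) (\<Union>E)} \<subseteq> Pow (S // R)" by auto
  show "f \<in> space M \<rightarrow> S // R" by (rule f)
  fix E assume "E \<in> {E. E \<subseteq> S // R \<and> openin (top_of_set S) (\<Union>E)}"
  then obtain T where "E \<subseteq> S // R" "open T" "\<Union>E = S \<inter> T" by (auto simp: openin_open)
  then show "f -` E \<inter> space M \<in> sets M" by (rule meas)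
qed

lemma cls_in_iff:
  assumes R: "equiv S R" and E: "E \<subseteq> S // R" and s: "s \<in> S"
  shows "cls R s \<in> E \<longleftrightarrow> s \<in> \<Union>E"
proof
  assume "cls R s \<in> E"
  then show "s \<in> \<Union>E" using equiv_class_self[OF R s] unfolding cls_def by blast
next
  assume "s \<in> \<Union>E"
  then obtain c where c: "c \<in> E" "s \<in> c" by blast
  then obtain s' where s': "s' \<in> S" "c = R `` {s'}" using E by (blast elim: quotientE)
  then have "(s', s) \<in> R" using c by simp
  then show "cls R s \<in> E" using R c s' by (metis cls_def equiv_class_eq)
qed

lemma measurable_cls:
  assumes R: "equiv S R" and sp: "space M = S" and id: "(\<lambda>s. s) \<in> M \<rightarrow>\<^sub>M borel"
  shows "cls R \<in> M \<rightarrow>\<^sub>M quotient_borel S R"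
proof (rule measurable_quotientI)
  show "cls R \<in> space M \<rightarrow> S // R" by (auto simp: sp cls_def intro: quotientI)
  fix E T assume E: "E \<subseteq> S // R" "open T" "\<Union>E = S \<inter> T"
  have "cls R -` E \<inter> space M = (\<lambda>s. s) -` T \<inter> space M"
    using cls_in_iff[OF R E(1)] E(3) by (auto simp: sp)
  then show "cls R -` E \<inter> space M \<in> sets M"
    using measurable_sets[OF id borel_open[OF E(2)]] by simp
qed

text \<open>
  Preimages of open sets under an invariant continuous function are saturated open sets, that
  is, generators.  The sections below are built from such functions by measurable operations.
\<close>

lemma measurable_invariant_function:
  fixes \<phi> :: "'a::topological_space \<Rightarrow> 'b::topological_space"
  assumes R: "equiv S R" and cont: "continuous_on S \<phi>" and inv: "\<And>s s'. (s, s') \<in> R \<Longrightarrow> \<phi> s = \<phi> s'"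
  shows "(\<lambda>c. \<phi> (rep c)) \<in> borel_measurable (quotient_borel S R)"
proof (rule borel_measurableI)
  fix T :: "'b set" assume "open T"
  define E where "E = (\<lambda>c. \<phi> (rep c)) -` T \<inter> S // R"
  have "\<Union>E = S \<inter> \<phi> -` T"
  proof (intro subset_antisym subsetI)
    fix s assume "s \<in> \<Union>E"
    then obtain c where c: "c \<in> S // R" "\<phi> (rep c) \<in> T" "s \<in> c" by (auto simp: E_def)
    then obtain s' where s': "s' \<in> S" "c = R `` {s'}" by (blast elim: quotientE)
    then have "(s', s) \<in> R" "(s', rep c) \<in> R" using c rep_quotient(1)[OF R c(1)] by auto
    then have "(rep c, s) \<in> R" using R by (meson equivE symD transD)
    then show "s \<in> S \<inter> \<phi> -` T" using inv c R by (metis IntI equiv_class_eq_iff vimageI)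
  next
    fix s assume s: "s \<in> S \<inter> \<phi> -` T"
    then have "(s, rep (cls R s)) \<in> R" using rep_cls_related[OF R] by blast
    then have "\<phi> (rep (cls R s)) \<in> T" using s inv by force
    moreover have "cls R s \<in> S // R" "s \<in> cls R s"
      using s equiv_class_self[OF R] by (auto simp: cls_def intro: quotientI)
    ultimately show "s \<in> \<Union>E" unfolding E_def by blast
  qed
  then have "openin (top_of_set S) (\<Union>E)"
    using cont \<open>open T\<close> by (simp add: continuous_openin_preimage_gen)
  then have "E \<in> sets (quotient_borel S R)"
    unfolding quotient_borel_def by (subst sets_measure_of) (auto simp: E_def)
  then show "(\<lambda>c. \<phi> (rep c)) -` T \<inter> space (quotient_borel S R) \<in> sets (quotient_borel S R)"
    by (simp add: E_def)
qed

lemma borel_measurable_vec_nth: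
  fixes f :: "'a \<Rightarrow> 'b::euclidean_space^'n"
  assumes "\<And>i. (\<lambda>x. f x $ i) \<in> borel_measurable M"
  shows "f \<in> borel_measurable M"
proof -
  have "(\<lambda>x. f x \<bullet> b) \<in> borel_measurable M" if b: "b \<in> Basis" for b
  proof -
    obtain i u where "b = axis i u" using b by (auto simp: Basis_vec_def)
    then have "(\<lambda>x. f x \<bullet> b) = (\<lambda>x. f x $ i \<bullet> u)" by (simp add: inner_axis)
    then show ?thesis using assms[of i] by simp
  qed
  then show ?thesis by (subst borel_measurable_euclidean_space) blast
qed

definition leads :: "('n::{finite,linorder}) cmat \<Rightarrow> 'n \<Rightarrow> 'n \<Rightarrow> bool" where
  "leads V i k \<longleftrightarrow> V $ i $ k \<noteq> 0 \<and> (\<forall>l<k. V $ i $ l = 0)"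

text \<open>
  The torus element that makes the first nonzero entry of each row of \<open>diag (phase V) ** V\<close>
  positive.  At most one summand is different from zero.
\<close>

definition phase :: "('n::{finite,linorder}) cmat \<Rightarrow> (complex, 'n) vec" where
  "phase V = (\<chi> i. \<Sum>k\<in>UNIV. if leads V i k then cnj (V $ i $ k) / of_real (norm (V $ i $ k)) else 0)"

lemma phase_torus:
  assumes V: "V \<in> unitary_group" shows "phase V \<in> torus"
  unfolding torus_def
proof safe
  fix i
  have "(V ** adj V) $ i $ i = 1" using V by (simp add: mat_def)
  then have "(\<Sum>k\<in>UNIV. V $ i $ k * cnj (V $ i $ k)) = 1" by (simp add: matrix_matrix_mult_def)
  then have "\<exists>k. V $ i $ k \<noteq> 0" by (rule contrapos_pp) simp
  then have "{k. V $ i $ k \<noteq> 0} \<noteq> {}" by blast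
  define m where "m = Min {k. V $ i $ k \<noteq> 0}"
  have "m \<in> {k. V $ i $ k \<noteq> 0}"
    unfolding m_def using \<open>{k. V $ i $ k \<noteq> 0} \<noteq> {}\<close> by (intro Min_in) auto
  moreover have least: "m \<le> k" if "V $ i $ k \<noteq> 0" for k
    unfolding m_def using that by (intro Min_le) auto
  ultimately have m: "V $ i $ m \<noteq> 0" "\<And>k. V $ i $ k \<noteq> 0 \<Longrightarrow> m \<le> k" by auto
  have "leads V i k \<longleftrightarrow> k = m" for k
  proof
    assume "leads V i k"
    then have "V $ i $ k \<noteq> 0" "\<not> m < k" using m(1) by (auto simp: leads_def)
    then show "k = m" using m(2)[of k] by simp
  next
    assume k: "k = m"
    have "V $ i $ l = 0" if "l < m" for l
      using m(2)[of l] that by (meson leD)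
    then show "leads V i k" using m(1) k by (simp add: leads_def)
  qed
  then have "phase V $ i = cnj (V $ i $ m) / of_real (norm (V $ i $ m))"
    by (simp add: phase_def)
  then show "norm (phase V $ i) = 1"
    using \<open>m \<in> {k. V $ i $ k \<noteq> 0}\<close> by (simp add: norm_divide)
qed

lemma torus_norm: "t \<in> torus \<Longrightarrow> norm (t $ i) = 1"
  by (simp add: torus_def)

definition left_section :: "('n::{finite,linorder}) cmat set \<Rightarrow> 'n cmat" where
  "left_section c = diag (phase (rep c)) ** rep c"

definition right_section :: "('n::{finite,linorder}) cmat set \<Rightarrow> 'n cmat" where
  "right_section c = rep c ** diag (phase (transpose (rep c)))"

definition pair_section :: "(('n::{finite,linorder}) cmat \<times> 'n cmat) set \<Rightarrow> 'n cmat \<times> 'n cmat" where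
  "pair_section c = (fst (rep c) ** diag (conj_vec (phase (snd (rep c)))), diag (phase (snd (rep c))) ** snd (rep c))"

lemma left_section:
  assumes c: "c \<in> unitary_group // left_torus_rel"
  shows "left_section c \<in> unitary_group" "cls left_torus_rel (left_section c) = c"
proof -
  have r: "rep c \<in> unitary_group" "cls left_torus_rel (rep c) = c"
    using rep_quotient[OF equiv_left_torus_rel c] by auto
  then show "left_section c \<in> unitary_group" by (simp add: left_section_def phase_torus)
  have "(rep c, left_section c) \<in> left_torus_rel"
    using r(1) phase_torus unfolding left_torus_rel_def left_section_def by blast
  from equiv_class_eq[OF equiv_left_torus_rel this] show "cls left_torus_rel (left_section c) = c"
    using r(2) by (simp add: cls_def)
qed

lemma right_section:
  assumes c: "c \<in> unitary_group // right_torus_rel"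
  shows "right_section c \<in> unitary_group" "cls right_torus_rel (right_section c) = c"
proof -
  have r: "rep c \<in> unitary_group" "cls right_torus_rel (rep c) = c"
    using rep_quotient[OF equiv_right_torus_rel c] by auto
  then show "right_section c \<in> unitary_group" by (simp add: right_section_def phase_torus)
  have "(rep c, right_section c) \<in> right_torus_rel"
    using r(1) phase_torus[OF unitary_transpose] unfolding right_torus_rel_def right_section_def by blast
  from equiv_class_eq[OF equiv_right_torus_rel this] show "cls right_torus_rel (right_section c) = c"
    using r(2) by (simp add: cls_def)
qed

lemma pair_section:
  assumes c: "c \<in> (unitary_group \<times> unitary_group) // pair_torus_rel"
  shows "pair_section c \<in> unitary_group \<times> unitary_group" "cls pair_torus_rel (pair_section c) = c"
proof -
  have r: "rep c \<in> unitary_group \<times> unitary_group" "cls pair_torus_rel (rep c) = c"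
    using rep_quotient[OF equiv_pair_torus_rel c] by auto
  then have r1: "fst (rep c) \<in> unitary_group" "snd (rep c) \<in> unitary_group" by auto
  then show "pair_section c \<in> unitary_group \<times> unitary_group"
    by (simp add: pair_section_def phase_torus torus_conj)
  have "((fst (rep c), snd (rep c)), pair_section c) \<in> pair_torus_rel"
    using r1 phase_torus[OF r1(2)] unfolding pair_torus_rel_def pair_section_def by blast
  from equiv_class_eq[OF equiv_pair_torus_rel this] show "cls pair_torus_rel (pair_section c) = c"
    using r(2) by (simp add: cls_def)
qed

lemma pred_leads:
  assumes "\<And>i k. (\<lambda>c. norm (V c $ i $ k)) \<in> borel_measurable M"
  shows "{c \<in> space M. leads (V c) i k} \<in> sets M"
proof -
  have [measurable]: "\<And>i k. (\<lambda>c. norm (V c $ i $ k)) \<in> borel_measurable M" by (rule assms)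
  have "{c \<in> space M. leads (V c) i k} = {c \<in> space M. norm (V c $ i $ k) \<noteq> 0 \<and> (\<forall>l\<in>{..<k}. norm (V c $ i $ l) = 0)}"
    by (auto simp: leads_def)
  also have "\<dots> \<in> sets M" by measurable
  finally show ?thesis .
qed

text \<open>
  The function \<open>phase (V c)\<close> itself is not invariant; only its products with suitable entries
  are, and these are what the sections consist of.
\<close>

lemma measurable_phase_product:
  fixes V :: "'c \<Rightarrow> ('n::{finite,linorder}) cmat"
  assumes n: "\<And>i k. (\<lambda>c. norm (V c $ i $ k)) \<in> borel_measurable M"
    and a: "\<And>k. (\<lambda>c. a c * cnj (V c $ i $ k)) \<in> borel_measurable M"
  shows "(\<lambda>c. a c * phase (V c) $ i) \<in> borel_measurable M"
proof -
  have eq: "a c * phase (V c) $ i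
      = (\<Sum>k\<in>UNIV. if leads (V c) i k then (a c * cnj (V c $ i $ k)) / of_real (norm (V c $ i $ k)) else 0)" for c
    by (simp add: phase_def sum_distrib_left if_distrib cong: if_cong)
  have [measurable]: "Measurable.pred M (\<lambda>c. leads (V c) i k)" for k
    using pred_leads[OF n] by (simp add: pred_def)
  note n [measurable] a [measurable]
  show ?thesis unfolding eq by measurable
qed

lemma measurable_left_section:
  "left_section \<in> borel_measurable (quotient_borel unitary_group (left_torus_rel :: (('n::{finite,linorder}) cmat \<times> 'n cmat) set))"
proof (intro borel_measurable_vec_nth)
  fix i j :: 'n
  have 1: "(\<lambda>c. norm (rep c $ i $ k)) \<in> borel_measurable (quotient_borel unitary_group (left_torus_rel :: ('n cmat \<times> 'n cmat) set))" for i k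
    by (rule measurable_invariant_function[OF equiv_left_torus_rel, where \<phi> = "\<lambda>V. norm (V $ i $ k)"])
      (auto simp: left_torus_rel_def norm_mult torus_norm intro!: continuous_intros)
  have 2: "(\<lambda>c. rep c $ i $ j * cnj (rep c $ i $ k)) \<in> borel_measurable (quotient_borel unitary_group (left_torus_rel :: ('n cmat \<times> 'n cmat) set))" for k
    by (rule measurable_invariant_function[OF equiv_left_torus_rel, where \<phi> = "\<lambda>V. V $ i $ j * cnj (V $ i $ k)"])
      (auto simp: left_torus_rel_def intro!: continuous_intros, simp add: torus_cnj_mult mult_ac)
  have "(\<lambda>c. rep c $ i $ j * phase (rep c) $ i) \<in> borel_measurable (quotient_borel unitary_group (left_torus_rel :: ('n cmat \<times> 'n cmat) set))"
    using 1 2 by (rule measurable_phase_product)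
  then show "(\<lambda>c. left_section c $ i $ j) \<in> borel_measurable (quotient_borel unitary_group (left_torus_rel :: ('n cmat \<times> 'n cmat) set))"
    by (simp add: left_section_def mult.commute)
qed

lemma measurable_right_section:
  "right_section \<in> borel_measurable (quotient_borel unitary_group (right_torus_rel :: (('n::{finite,linorder}) cmat \<times> 'n cmat) set))"
proof (intro borel_measurable_vec_nth)
  fix i j :: 'n
  have 1: "(\<lambda>c. norm (transpose (rep c) $ i $ k)) \<in> borel_measurable (quotient_borel unitary_group (right_torus_rel :: ('n cmat \<times> 'n cmat) set))" for i k
    unfolding transpose_def vec_lambda_beta
    by (rule measurable_invariant_function[OF equiv_right_torus_rel, where \<phi> = "\<lambda>V. norm (V $ k $ i)"])
      (auto simp: right_torus_rel_def norm_mult torus_norm intro!: continuous_intros)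
  have 2: "(\<lambda>c. rep c $ i $ j * cnj (transpose (rep c) $ j $ k)) \<in> borel_measurable (quotient_borel unitary_group (right_torus_rel :: ('n cmat \<times> 'n cmat) set))" for k
    unfolding transpose_def vec_lambda_beta
    by (rule measurable_invariant_function[OF equiv_right_torus_rel, where \<phi> = "\<lambda>V. V $ i $ j * cnj (V $ k $ j)"])
      (auto simp: right_torus_rel_def intro!: continuous_intros, simp add: torus_cnj_mult mult_ac)
  have "(\<lambda>c. rep c $ i $ j * phase (transpose (rep c)) $ j) \<in> borel_measurable (quotient_borel unitary_group (right_torus_rel :: ('n cmat \<times> 'n cmat) set))"
    using 1 2 by (rule measurable_phase_product)
  then show "(\<lambda>c. right_section c $ i $ j) \<in> borel_measurable (quotient_borel unitary_group (right_torus_rel :: ('n cmat \<times> 'n cmat) set))"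
    by (simp add: right_section_def)
qed

abbreviation pair_quotient :: "(('n::{finite,linorder}) cmat \<times> 'n cmat) set measure" where
  "pair_quotient \<equiv> quotient_borel (unitary_group \<times> unitary_group) pair_torus_rel"

lemma pair_torus_relE:
  assumes "(p, q) \<in> pair_torus_rel"
  obtains t where "t \<in> torus" "fst q = fst p ** diag (conj_vec t)" "snd q = diag t ** snd p"
  using assms unfolding pair_torus_rel_def by force

lemma measurable_pair_section: "pair_section \<in> borel_measurable (pair_quotient :: (('n::{finite,linorder}) cmat \<times> 'n cmat) set measure)"
proof -
  let ?Q = "pair_quotient :: ('n cmat \<times> 'n cmat) set measure"
  have 1: "(\<lambda>c. norm (snd (rep c) $ i $ k)) \<in> borel_measurable ?Q" for i k
    by (rule measurable_invariant_function[OF equiv_pair_torus_rel, where \<phi> = "\<lambda>p. norm (snd p $ i $ k)"])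
      (auto simp: norm_mult torus_norm elim!: pair_torus_relE intro!: continuous_intros)
  have "(\<lambda>c. snd (rep c) $ i $ j * phase (snd (rep c)) $ i) \<in> borel_measurable ?Q" for i j
  proof (rule measurable_phase_product[OF 1])
    fix k
    show "(\<lambda>c. snd (rep c) $ i $ j * cnj (snd (rep c) $ i $ k)) \<in> borel_measurable ?Q"
    proof (rule measurable_invariant_function[OF equiv_pair_torus_rel, where \<phi> = "\<lambda>p. snd p $ i $ j * cnj (snd p $ i $ k)"])
      fix p q :: "'n cmat \<times> 'n cmat" assume "(p, q) \<in> pair_torus_rel"
      then obtain t where t: "t \<in> torus" and q: "snd q = diag t ** snd p" by (rule pair_torus_relE)
      have "snd q $ i $ j * cnj (snd q $ i $ k) = (cnj (t $ i) * t $ i) * (snd p $ i $ j * cnj (snd p $ i $ k))"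
        unfolding q by (simp add: mult_ac)
      then show "snd p $ i $ j * cnj (snd p $ i $ k) = snd q $ i $ j * cnj (snd q $ i $ k)"
        by (simp add: torus_cnj_mult[OF t])
    qed (intro continuous_intros)
  qed
  then have s: "(\<lambda>c. snd (pair_section c)) \<in> borel_measurable ?Q"
    by (intro borel_measurable_vec_nth) (simp add: pair_section_def mult.commute)
  have "(\<lambda>c. cnj (fst (rep c) $ i $ j) * phase (snd (rep c)) $ j) \<in> borel_measurable ?Q" for i j
  proof (rule measurable_phase_product[OF 1])
    fix k
    show "(\<lambda>c. cnj (fst (rep c) $ i $ j) * cnj (snd (rep c) $ j $ k)) \<in> borel_measurable ?Q"
    proof (rule measurable_invariant_function[OF equiv_pair_torus_rel, where \<phi> = "\<lambda>p. cnj (fst p $ i $ j) * cnj (snd p $ j $ k)"])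
      fix p q :: "'n cmat \<times> 'n cmat" assume "(p, q) \<in> pair_torus_rel"
      then obtain t where t: "t \<in> torus" and q: "fst q = fst p ** diag (conj_vec t)" "snd q = diag t ** snd p"
        by (rule pair_torus_relE)
      have "cnj (fst q $ i $ j) * cnj (snd q $ j $ k) = (cnj (t $ j) * t $ j) * (cnj (fst p $ i $ j) * cnj (snd p $ j $ k))"
        unfolding q by (simp add: mult_ac)
      then show "cnj (fst p $ i $ j) * cnj (snd p $ j $ k) = cnj (fst q $ i $ j) * cnj (snd q $ j $ k)"
        by (simp add: torus_cnj_mult[OF t])
    qed (intro continuous_intros)
  qed
  then have "(\<lambda>c. cnj (cnj (fst (rep c) $ i $ j) * phase (snd (rep c)) $ j)) \<in> borel_measurable ?Q" for i j
    by (rule borel_measurable_continuous_on[OF continuous_on_cnj[OF continuous_on_id]])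
  then have f: "(\<lambda>c. fst (pair_section c)) \<in> borel_measurable ?Q"
    by (intro borel_measurable_vec_nth) (simp add: pair_section_def)
  have "(\<lambda>c. (fst (pair_section c), snd (pair_section c))) \<in> borel_measurable ?Q"
    using f s by (rule borel_measurable_Pair)
  then show ?thesis by simp
qed

section \<open>The polar measure space\<close>

abbreviation chamber_measure :: "('n::{finite,linorder}) rvec measure" where
  "chamber_measure \<equiv> restrict_space lborel chamber"

lemma space_chamber_measure [simp]: "space chamber_measure = chamber"
  by (simp add: space_restrict_space)

text \<open>
  The measure whose completion is \<open>polar_measure\<close>.  Measurability is first discussed for Borel
  functions on this space.
\<close>

definition polar_base :: "((('n::{finite,linorder}) cmat \<times> 'n cmat) set \<times> 'n rvec) measure" where
  "polar_base = distr (haar \<Otimes>\<^sub>M haar) pair_quotient (cls pair_torus_rel) \<Otimes>\<^sub>M chamber_measure"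

lemma polar_measure_eq: "polar_measure = completion polar_base"
  by (simp add: polar_measure_def polar_base_def)

lemma space_polar_base [simp]: "space polar_base = polar_domain"
  by (simp add: polar_base_def space_pair_measure polar_domain_def)

lemma sets_polar_base [measurable_cong]: "sets polar_base = sets (pair_quotient \<Otimes>\<^sub>M chamber_measure)"
  unfolding polar_base_def by (rule sets_pair_measure_cong) simp_all

lemma measurable_haar_pair_ident: "(\<lambda>p. p) \<in> (haar \<Otimes>\<^sub>M haar) \<rightarrow>\<^sub>M borel"
proof -
  have "(\<lambda>p. (fst p, snd p)) \<in> borel_measurable (haar \<Otimes>\<^sub>M haar)"
    by (intro borel_measurable_Pair measurable_compose[OF measurable_fst measurable_haar_ident]
        measurable_compose[OF measurable_snd measurable_haar_ident])
  then show ?thesis by simp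
qed

lemma measurable_cls_pair: "cls pair_torus_rel \<in> (haar \<Otimes>\<^sub>M haar) \<rightarrow>\<^sub>M pair_quotient"
  by (rule measurable_cls[OF equiv_pair_torus_rel _ measurable_haar_pair_ident]) (simp add: space_pair_measure)

definition polar_proj :: "((('n::{finite,linorder}) cmat \<times> 'n cmat) \<times> 'n rvec) \<Rightarrow> ('n cmat \<times> 'n cmat) set \<times> 'n rvec" where
  "polar_proj = (\<lambda>(u, x). (cls pair_torus_rel u, x))"

lemma distr_times_chamber:
  assumes "f \<in> M \<rightarrow>\<^sub>M S"
  shows "distr M S f \<Otimes>\<^sub>M chamber_measure = distr (M \<Otimes>\<^sub>M chamber_measure) (S \<Otimes>\<^sub>M chamber_measure) (\<lambda>(u, x). (f u, x))"
proof -
  have "chamber_measure = distr chamber_measure chamber_measure (\<lambda>x. x)" by (simp add: distr_id)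
  then have "distr M S f \<Otimes>\<^sub>M chamber_measure = distr M S f \<Otimes>\<^sub>M distr chamber_measure chamber_measure (\<lambda>x. x)" by simp
  also have "\<dots> = distr (M \<Otimes>\<^sub>M chamber_measure) (S \<Otimes>\<^sub>M chamber_measure) (\<lambda>(u, x). (f u, x))"
    by (rule pair_measure_distr[OF assms]) (simp_all add: distr_id sigma_finite_restrict_chamber)
  finally show ?thesis .
qed

lemma polar_base_eq: "polar_base = distr svd_measure (pair_quotient \<Otimes>\<^sub>M chamber_measure) polar_proj"
  unfolding polar_base_def svd_measure_def polar_proj_def by (rule distr_times_chamber[OF measurable_cls_pair])

lemma measurable_polar_proj: "polar_proj \<in> svd_measure \<rightarrow>\<^sub>M (pair_quotient \<Otimes>\<^sub>M chamber_measure)"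
  unfolding polar_proj_def svd_measure_def case_prod_beta
  by (intro measurable_Pair measurable_compose[OF measurable_fst measurable_cls_pair] measurable_snd)

lemma space_svd_measure [simp]: "space svd_measure = (unitary_group \<times> unitary_group) \<times> chamber"
  by (simp add: svd_measure_def space_pair_measure)

lemma polar_map_proj: "q \<in> space svd_measure \<Longrightarrow> polar_map (polar_proj q) = svd_map q"
  by (auto simp: polar_proj_def svd_map_def polar_map_cls)

lemma polar_proj_in: "q \<in> space svd_measure \<Longrightarrow> polar_proj q \<in> polar_domain"
  by (auto simp: polar_proj_def intro: polar_domainI)

lemma polar_inv_svd_map:
  assumes "q \<in> space svd_measure" shows "polar_inv (svd_map q) = polar_proj q"
  using polar_inv_polar_map[OF polar_proj_in[OF assms]] unfolding polar_map_proj[OF assms] .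

lemma measurable_polar_map: "polar_map \<in> polar_base \<rightarrow>\<^sub>M borel"
proof -
  have "(\<lambda>p. fst (pair_section (fst p)) ** diag_real (snd p) ** snd (pair_section (fst p))) \<in> polar_base \<rightarrow>\<^sub>M borel"
  proof -
    have "(\<lambda>p. pair_section (fst p)) \<in> borel_measurable (pair_quotient \<Otimes>\<^sub>M chamber_measure)"
      by (rule measurable_compose[OF measurable_fst measurable_pair_section])
    then have 1: "(\<lambda>p. fst (pair_section (fst p))) \<in> borel_measurable (pair_quotient \<Otimes>\<^sub>M chamber_measure)"
      "(\<lambda>p. snd (pair_section (fst p))) \<in> borel_measurable (pair_quotient \<Otimes>\<^sub>M chamber_measure)"
      by (auto intro: borel_measurable_continuous_on[OF continuous_on_fst[OF continuous_on_id]]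
          borel_measurable_continuous_on[OF continuous_on_snd[OF continuous_on_id]])
    have 2: "(\<lambda>p. snd p) \<in> borel_measurable (pair_quotient \<Otimes>\<^sub>M chamber_measure)"
      by (rule measurable_compose[OF measurable_snd measurable_restrict_lborel_ident])
    show ?thesis
      using borel_measurable_matrix_mult[OF borel_measurable_matrix_mult[OF 1(1) borel_measurable_diag_real[OF 2]] 1(2)]
      by (simp add: measurable_cong_sets[OF sets_polar_base refl])
  qed
  moreover have "polar_map p = fst (pair_section (fst p)) ** diag_real (snd p) ** snd (pair_section (fst p))"
    if "p \<in> space polar_base" for p
  proof -
    have "fst p \<in> (unitary_group \<times> unitary_group) // pair_torus_rel" using that by (auto simp: polar_domain_def)
    from pair_section[OF this] have "fst (pair_section (fst p)) \<in> unitary_group" "snd (pair_section (fst p)) \<in> unitary_group"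
      "p = (cls pair_torus_rel (fst (pair_section (fst p)), snd (pair_section (fst p))), snd p)" by auto
    from polar_map_cls[OF this(1,2), of "snd p"] this(3) show ?thesis by simp
  qed
  ultimately show ?thesis by (subst measurable_cong) auto
qed

text \<open>
  It suffices to consider the generators of the two factors.  The complement of such a
  generator pulls back to the image of a closed set under \<open>svd_map\<close>, which is Borel.
\<close>

lemma measurable_polar_inv: "(polar_inv :: ('n::{finite,linorder}) cmat \<Rightarrow> _) \<in> restrict_space borel regular_ball \<rightarrow>\<^sub>M polar_base"
proof -
  have sp: "space (restrict_space borel regular_ball) = (regular_ball :: 'n cmat set)" by (simp add: space_restrict_space)
  have closed_image: "regular_ball - svd_map ` (((unitary_group \<times> unitary_group) \<times> chamber) \<inter> G) \<in> sets (restrict_space borel regular_ball)"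
    if "closed G" for G :: "(('n cmat \<times> 'n cmat) \<times> 'n rvec) set"
    using svd_map_closed_borel[OF that] by (auto simp: sets_restrict_space_iff)
  have vim: "{Z \<in> regular_ball. P (polar_inv Z)} = regular_ball - svd_map ` (((unitary_group \<times> unitary_group) \<times> chamber) \<inter> G)"
    if "\<And>q. q \<in> space svd_measure \<Longrightarrow> P (polar_proj q) \<longleftrightarrow> q \<notin> G" for P and G :: "(('n cmat \<times> 'n cmat) \<times> 'n rvec) set"
  proof -
    have "{Z \<in> svd_map ` space svd_measure. P (polar_inv Z)} = svd_map ` space svd_measure - svd_map ` (space svd_measure \<inter> G)"
      using that by (auto simp: polar_inv_svd_map simp del: space_svd_measure)
    then show ?thesis by (simp add: regular_ball_eq)
  qed
  have "(\<lambda>Z :: 'n cmat. fst (polar_inv Z)) \<in> restrict_space borel regular_ball \<rightarrow>\<^sub>M pair_quotient"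
  proof (rule measurable_quotientI)
    show "(\<lambda>Z :: 'n cmat. fst (polar_inv Z)) \<in> space (restrict_space borel regular_ball) \<rightarrow> (unitary_group \<times> unitary_group) // pair_torus_rel"
      using polar_inv_in by (auto simp: sp polar_domain_def mem_Times_iff)
    fix E and T :: "('n cmat \<times> 'n cmat) set"
    assume E: "E \<subseteq> (unitary_group \<times> unitary_group) // pair_torus_rel" "open T" "\<Union>E = unitary_group \<times> unitary_group \<inter> T"
    define G :: "(('n cmat \<times> 'n cmat) \<times> 'n rvec) set" where "G = fst -` (- T)"
    have "closed G" unfolding G_def using E(2) by (intro closed_vimage continuous_intros) (simp add: closed_def)
    have "{Z \<in> regular_ball. fst (polar_inv Z) \<in> E}
        = regular_ball - svd_map ` (((unitary_group \<times> unitary_group) \<times> chamber) \<inter> G)"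
    proof (rule vim)
      fix q :: "('n cmat \<times> 'n cmat) \<times> 'n rvec" assume q: "q \<in> space svd_measure"
      then have q1: "fst q \<in> unitary_group \<times> unitary_group" by (simp add: mem_Times_iff)
      have "cls pair_torus_rel (fst q) \<in> E \<longleftrightarrow> fst q \<in> T"
        unfolding cls_in_iff[OF equiv_pair_torus_rel E(1) q1] E(3) using q1 by (simp only: Int_iff simp_thms)
      then show "fst (polar_proj q) \<in> E \<longleftrightarrow> q \<notin> G"
        by (simp add: polar_proj_def case_prod_beta G_def)
    qed
    moreover have "(\<lambda>Z :: 'n cmat. fst (polar_inv Z)) -` E \<inter> space (restrict_space borel regular_ball) = {Z \<in> regular_ball. fst (polar_inv Z) \<in> E}"
      by (auto simp: sp)
    ultimately show "(\<lambda>Z :: 'n cmat. fst (polar_inv Z)) -` E \<inter> space (restrict_space borel regular_ball) \<in> sets (restrict_space borel regular_ball)"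
      using closed_image[OF \<open>closed G\<close>] by simp
  qed
  moreover have "(\<lambda>Z :: 'n cmat. snd (polar_inv Z)) \<in> restrict_space borel regular_ball \<rightarrow>\<^sub>M chamber_measure"
  proof -
    have "(\<lambda>Z :: 'n cmat. snd (polar_inv Z)) \<in> restrict_space borel regular_ball \<rightarrow>\<^sub>M borel"
    proof (rule borel_measurableI)
      fix T :: "'n rvec set" assume "open T"
      define G :: "(('n cmat \<times> 'n cmat) \<times> 'n rvec) set" where "G = snd -` (- T)"
      have "closed G" unfolding G_def using \<open>open T\<close> by (intro closed_vimage continuous_intros) (simp add: closed_def)
      have "{Z \<in> regular_ball. snd (polar_inv Z) \<in> T}
          = regular_ball - svd_map ` (((unitary_group \<times> unitary_group) \<times> chamber) \<inter> G)"
        by (rule vim) (simp add: polar_proj_def case_prod_beta G_def)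
      moreover have "(\<lambda>Z :: 'n cmat. snd (polar_inv Z)) -` T \<inter> space (restrict_space borel regular_ball) = {Z \<in> regular_ball. snd (polar_inv Z) \<in> T}"
        by (auto simp: sp)
      ultimately show "(\<lambda>Z :: 'n cmat. snd (polar_inv Z)) -` T \<inter> space (restrict_space borel regular_ball) \<in> sets (restrict_space borel regular_ball)"
        using closed_image[OF \<open>closed G\<close>] by simp
    qed
    then have "(\<lambda>Z :: 'n cmat. snd (polar_inv Z)) \<in> restrict_space borel regular_ball \<rightarrow>\<^sub>M restrict_space borel chamber"
      using polar_inv_in by (intro measurable_restrict_space2) (auto simp: sp polar_domain_def mem_Times_iff)
    then show ?thesis by (simp add: measurable_cong_sets[OF refl sets_restrict_lborel])
  qed
  ultimately have "(\<lambda>Z :: 'n cmat. (fst (polar_inv Z), snd (polar_inv Z))) \<in> restrict_space borel regular_ball \<rightarrow>\<^sub>M (pair_quotient \<Otimes>\<^sub>M chamber_measure)"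
    by (rule measurable_Pair)
  then show ?thesis by (simp add: measurable_cong_sets[OF refl sets_polar_base])
qed

lemma polar_image_eq:
  assumes "E \<subseteq> polar_domain"
  shows "polar_map ` E = polar_inv -` E \<inter> regular_ball"
proof (intro subset_antisym subsetI)
  fix Z assume "Z \<in> polar_map ` E"
  then obtain p where p: "p \<in> E" "Z = polar_map p" by blast
  then have "p \<in> polar_domain" using assms by blast
  then show "Z \<in> polar_inv -` E \<inter> regular_ball"
    using p by (simp add: polar_inv_polar_map polar_map_in)
next
  fix Z assume "Z \<in> polar_inv -` E \<inter> regular_ball"
  then have "Z = polar_map (polar_inv Z)" "polar_inv Z \<in> E" by (auto simp: polar_map_polar_inv)
  then show "Z \<in> polar_map ` E" by (rule image_eqI)
qed

lemma polar_image_borel: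
  assumes "E \<in> sets polar_base" shows "polar_map ` E \<in> sets borel"
proof -
  have "E \<subseteq> polar_domain" using sets.sets_into_space[OF assms] by simp
  moreover have "polar_inv -` E \<inter> regular_ball \<in> sets borel"
    using measurable_sets[OF measurable_polar_inv assms] by (simp add: space_restrict_space sets_restrict_space_iff)
  ultimately show ?thesis by (simp add: polar_image_eq)
qed

lemma null_sets_polar_base_iff:
  assumes E: "E \<in> sets polar_base"
  shows "E \<in> null_sets polar_base \<longleftrightarrow> polar_map ` E \<in> null_sets lborel"
proof -
  have Ed: "E \<subseteq> polar_domain" using sets.sets_into_space[OF E] by simp
  have "polar_map ` E \<subseteq> regular_ball" using Ed polar_map_in by blast
  then have "emeasure lborel (polar_map ` E) = 0 \<longleftrightarrow> emeasure svd_measure (svd_map -` (polar_map ` E) \<inter> space svd_measure) = 0"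
    by (rule null_iff_svd_null[OF polar_image_borel[OF E]])
  also have "svd_map -` (polar_map ` E) \<inter> space svd_measure = polar_proj -` E \<inter> space svd_measure"
  proof (intro subset_antisym subsetI)
    fix q assume q: "q \<in> svd_map -` (polar_map ` E) \<inter> space svd_measure"
    then have "polar_inv (svd_map q) \<in> E" using polar_image_eq[OF Ed] by blast
    then show "q \<in> polar_proj -` E \<inter> space svd_measure"
      using q polar_inv_svd_map[of q] by (simp del: space_svd_measure)
  next
    fix q assume q: "q \<in> polar_proj -` E \<inter> space svd_measure"
    then show "q \<in> svd_map -` (polar_map ` E) \<inter> space svd_measure"
      by (auto simp: polar_map_proj[symmetric] simp del: space_svd_measure)
  qed
  also have "emeasure svd_measure (polar_proj -` E \<inter> space svd_measure) = emeasure polar_base E"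
    unfolding polar_base_eq using E sets_polar_base by (subst emeasure_distr[OF measurable_polar_proj]) auto
  finally show ?thesis using E polar_image_borel[OF E] by (auto simp: null_sets_def)
qed

text \<open>
  Equality almost everywhere can be tested on either side of the polar map; this holds for
  arbitrary predicates, as a null set is by definition contained in a measurable one.
\<close>

lemma AE_polar_base_iff:
  "(AE p in polar_base. P p) \<longleftrightarrow> (AE Z in lborel. Z \<in> regular_ball \<longrightarrow> P (polar_inv Z))"
proof
  assume "AE p in polar_base. P p"
  then obtain N where N: "N \<in> null_sets polar_base" "{p \<in> polar_domain. \<not> P p} \<subseteq> N"
    unfolding eventually_ae_filter by auto
  then have "polar_map ` N \<in> null_sets lborel" using null_sets_polar_base_iff[OF null_setsD2] by blast
  moreover have "{Z \<in> space lborel. \<not> (Z \<in> regular_ball \<longrightarrow> P (polar_inv Z))} \<subseteq> polar_map ` N"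
  proof
    fix Z assume "Z \<in> {Z \<in> space lborel. \<not> (Z \<in> regular_ball \<longrightarrow> P (polar_inv Z))}"
    then have Z: "Z \<in> regular_ball" "\<not> P (polar_inv Z)" by auto
    then have "polar_inv Z \<in> N" using N(2) polar_inv_in by blast
    then show "Z \<in> polar_map ` N" using polar_map_polar_inv[OF Z(1)] by (intro image_eqI[of _ _ "polar_inv Z"]) auto
  qed
  ultimately show "AE Z in lborel. Z \<in> regular_ball \<longrightarrow> P (polar_inv Z)" by (rule AE_I')
next
  assume "AE Z in lborel. Z \<in> regular_ball \<longrightarrow> P (polar_inv Z)"
  then obtain N where N: "N \<in> null_sets lborel" "{Z. \<not> (Z \<in> regular_ball \<longrightarrow> P (polar_inv Z))} \<subseteq> N"
    unfolding eventually_ae_filter by auto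
  define E where "E = polar_map -` N \<inter> space polar_base"
  have E: "E \<in> sets polar_base"
    unfolding E_def using measurable_polar_map by (rule measurable_sets) (use N in \<open>auto dest: null_setsD2\<close>)
  have "polar_map ` E \<subseteq> N" by (auto simp: E_def)
  then have "polar_map ` E \<in> null_sets lborel"
    using null_sets_subset[OF N(1) _ \<open>polar_map ` E \<subseteq> N\<close>] polar_image_borel[OF E] by simp
  then have "E \<in> null_sets polar_base" using null_sets_polar_base_iff[OF E] by blast
  moreover have "{p \<in> space polar_base. \<not> P p} \<subseteq> E"
  proof
    fix p assume p: "p \<in> {p \<in> space polar_base. \<not> P p}"
    then have "polar_map p \<in> N" using N(2) polar_map_in[of p] polar_inv_polar_map[of p] by auto
    then show "p \<in> E" using p by (simp add: E_def)
  qed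
  ultimately show "AE p in polar_base. P p" by (rule AE_I')
qed

lemma AE_polar_iff: "(AE p in polar_measure. P p) \<longleftrightarrow> (AE Z in lborel. Z \<in> regular_ball \<longrightarrow> P (polar_inv Z))"
  unfolding polar_measure_eq AE_completion_iff by (rule AE_polar_base_iff)

lemma AE_regular: "AE Z in lborel. Z \<in> (matrix_ball :: ('n::{finite,linorder}) cmat set) \<longleftrightarrow> Z \<in> regular_ball"
proof -
  have "{Z. Z \<notin> (regular_matrices :: 'n cmat set)} = - regular_matrices" by auto
  then have "AE Z in lborel. Z \<in> (regular_matrices :: 'n cmat set)"
    using negligible_not_regular unfolding AE_lborel_iff_negligible by (simp only:)
  then show ?thesis by eventually_elim (simp add: regular_ball_def)
qed

lemma lebesgue_matrix_ball: "(matrix_ball :: ('n::{finite,linorder}) cmat set) \<in> sets lebesgue"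
proof -
  have "AE Z in lebesgue. Z \<in> (regular_ball :: 'n cmat set) \<longleftrightarrow> Z \<in> matrix_ball"
    using AE_regular[where 'n = 'n] unfolding AE_completion_iff by eventually_elim simp
  moreover have "(regular_ball :: 'n cmat set) \<in> sets lebesgue" using borel_regular_ball by simp
  ultimately show ?thesis by (rule completion.in_sets_AE) simp
qed

lemma AE_ball_iff:
  "(AE Z in (ball_measure :: ('n::{finite,linorder}) cmat measure). P Z) \<longleftrightarrow> (AE Z in lborel. Z \<in> regular_ball \<longrightarrow> P Z)"
proof -
  have "(AE Z in (ball_measure :: 'n cmat measure). P Z) \<longleftrightarrow> (AE Z in lebesgue. Z \<in> matrix_ball \<longrightarrow> P Z)"
    using lebesgue_matrix_ball by (intro AE_restrict_space_iff) simp
  also have "\<dots> \<longleftrightarrow> (AE Z in lborel. Z \<in> matrix_ball \<longrightarrow> P Z)" by (rule AE_completion_iff)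
  also have "\<dots> \<longleftrightarrow> (AE Z in lborel. Z \<in> regular_ball \<longrightarrow> P Z)"
  proof (rule iffI)
    assume "AE Z in lborel. Z \<in> matrix_ball \<longrightarrow> P Z"
    with AE_regular show "AE Z in lborel. Z \<in> regular_ball \<longrightarrow> P Z" by eventually_elim blast
  next
    assume "AE Z in lborel. Z \<in> regular_ball \<longrightarrow> P Z"
    with AE_regular show "AE Z in lborel. Z \<in> matrix_ball \<longrightarrow> P Z" by eventually_elim blast
  qed
  finally show ?thesis .
qed

section \<open>Borel versions of measurable functions\<close>

lemma completion_ex_borel_measurable_complex:
  fixes f :: "'a \<Rightarrow> complex"
  assumes "f \<in> borel_measurable (completion M)"
  obtains g where "g \<in> borel_measurable M" "AE x in M. f x = g x"
proof -
  have "(\<lambda>x. Re (f x)) \<in> borel_measurable (completion M)" "(\<lambda>x. Im (f x)) \<in> borel_measurable (completion M)"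
    using assms by measurable
  from completion_ex_borel_measurable_real[OF this(1)] completion_ex_borel_measurable_real[OF this(2)]
  obtain u v where uv: "u \<in> borel_measurable M" "v \<in> borel_measurable M"
      "AE x in M. Re (f x) = u x" "AE x in M. Im (f x) = v x"
    by blast
  have "(\<lambda>x. Complex (u x) (v x)) = (\<lambda>x. of_real (u x) + \<i> * of_real (v x))" by (simp add: Complex_eq)
  then have "(\<lambda>x. Complex (u x) (v x)) \<in> borel_measurable M" using uv(1,2) by simp
  moreover have "AE x in M. f x = Complex (u x) (v x)"
    using uv(3,4) by eventually_elim (simp add: complex_eq_iff)
  ultimately show ?thesis by (rule that)
qed

text \<open>
  Together with the preceding lemma, this reduces statements on completed measures to Borel
  functions and almost everywhere equality.
\<close>

lemma AE_eq_measurable_completion: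
  assumes g: "g \<in> M \<rightarrow>\<^sub>M N" and eq: "AE x in M. f x = g x" and sp: "f \<in> space M \<rightarrow> space N"
  shows "f \<in> completion M \<rightarrow>\<^sub>M N"
proof (rule measurableI)
  fix x assume "x \<in> space (completion M)" then show "f x \<in> space N" using sp by auto
next
  fix A assume A: "A \<in> sets N"
  have "g -` A \<inter> space M \<in> sets (completion M)" using measurable_sets[OF g A] by simp
  moreover have "AE x in completion M. x \<in> g -` A \<inter> space M \<longleftrightarrow> x \<in> f -` A \<inter> space M"
    unfolding AE_completion_iff using eq by eventually_elim simp
  ultimately show "f -` A \<inter> space (completion M) \<in> sets (completion M)"
    using completion.in_sets_AE[of "g -` A \<inter> space M" "f -` A \<inter> space M" M] by simp
qed

text \<open>
  The regular part is conull in the ball, so a Borel version has to agree with the function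
  only there, and the polar map transports it.
\<close>

lemma borel_measurable_ball_iff:
  fixes a :: "('n::{finite,linorder}) cmat \<Rightarrow> complex"
  shows "a \<in> borel_measurable ball_measure \<longleftrightarrow>
    (\<exists>g\<in>borel_measurable borel. AE Z in lborel. Z \<in> regular_ball \<longrightarrow> a Z = g Z)"
proof
  define a' where "a' Z = (if Z \<in> matrix_ball then a Z else 0)" for Z
  assume "a \<in> borel_measurable ball_measure"
  then have "a' \<in> borel_measurable lebesgue"
    unfolding a'_def using lebesgue_matrix_ball by (subst measurable_If_restrict_space_iff) auto
  then obtain g where g: "g \<in> borel_measurable lborel" "AE Z in lborel. a' Z = g Z"
    by (rule completion_ex_borel_measurable_complex)
  from g(2) have "AE Z in lborel. Z \<in> regular_ball \<longrightarrow> a Z = g Z"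
    by eventually_elim (auto simp: a'_def regular_ball_def)
  then show "\<exists>g\<in>borel_measurable borel. AE Z in lborel. Z \<in> regular_ball \<longrightarrow> a Z = g Z" using g(1) by auto
next
  define a' where "a' Z = (if Z \<in> matrix_ball then a Z else 0)" for Z
  assume "\<exists>g\<in>borel_measurable borel. AE Z in lborel. Z \<in> regular_ball \<longrightarrow> a Z = g Z"
  then obtain g where g [measurable]: "g \<in> borel_measurable borel" and eq: "AE Z in lborel. Z \<in> regular_ball \<longrightarrow> a Z = g Z" by blast
  have "(\<lambda>Z. if Z \<in> (regular_ball :: 'n cmat set) then g Z else 0) \<in> borel_measurable lborel"
    using g borel_regular_ball by (intro measurable_If) auto
  moreover have "AE Z in lborel. a' Z = (if Z \<in> regular_ball then g Z else 0)"
    using eq AE_regular by eventually_elim (simp add: a'_def)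
  ultimately have "a' \<in> borel_measurable lebesgue" by (rule AE_eq_measurable_completion) simp
  then have "a' \<in> borel_measurable ball_measure" by (rule measurable_restrict_space1)
  then show "a \<in> borel_measurable ball_measure"
    by (rule measurable_cong[THEN iffD1, rotated]) (simp add: a'_def space_restrict_space)
qed

lemma equiv_ae_rel: "equiv (ess_bounded M) (ae_rel M)"
proof (rule equivI)
  show "ae_rel M \<subseteq> ess_bounded M \<times> ess_bounded M" by (auto simp: ae_rel_def)
  show "refl_on (ess_bounded M) (ae_rel M)" by (rule refl_onI) (simp add: ae_rel_def)
  show "sym (ae_rel M)" by (rule symI) (auto simp: ae_rel_def elim: eventually_mono)
  show "trans (ae_rel M)"
    by (rule transI) (auto simp: ae_rel_def elim: eventually_elim2)
qed

lemma ess_boundedI: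
  assumes f: "f \<in> borel_measurable M" and g: "g \<in> ess_bounded M'" and 1: "\<And>C. AE x in M'. norm (g x) \<le> C \<Longrightarrow> AE x in M. norm (f x) \<le> C"
  shows "f \<in> ess_bounded M"
  using assms unfolding ess_bounded_def by blast

lemma polar_comp_measurable:
  fixes a :: "('n::{finite,linorder}) cmat \<Rightarrow> complex"
  assumes "a \<in> borel_measurable ball_measure"
  shows "a \<circ> polar_map \<in> borel_measurable polar_measure"
proof -
  obtain g where g: "g \<in> borel_measurable borel" "AE Z in lborel. Z \<in> regular_ball \<longrightarrow> a Z = g Z"
    using assms unfolding borel_measurable_ball_iff by blast
  have "(\<lambda>p. g (polar_map p)) \<in> borel_measurable polar_base"
    using measurable_polar_map g(1) by (rule measurable_compose)
  moreover have "AE p in polar_base. (a \<circ> polar_map) p = g (polar_map p)"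
    unfolding AE_polar_base_iff using g(2) by eventually_elim (simp add: polar_map_polar_inv)
  ultimately show ?thesis
    unfolding polar_measure_eq by (rule AE_eq_measurable_completion) simp
qed

lemma AE_polar_comp_iff:
  "(AE p in polar_measure. P (polar_map p)) \<longleftrightarrow> (AE Z in ball_measure. P Z)"
  unfolding AE_polar_iff AE_ball_iff by (intro AE_cong) (simp add: polar_map_polar_inv)

lemma polar_comp_ess_bounded:
  fixes a :: "('n::{finite,linorder}) cmat \<Rightarrow> complex"
  assumes "a \<in> ess_bounded ball_measure"
  shows "a \<circ> polar_map \<in> ess_bounded polar_measure"
proof (rule ess_boundedI[OF _ assms])
  show "a \<circ> polar_map \<in> borel_measurable polar_measure"
    using assms by (intro polar_comp_measurable) (simp add: ess_bounded_def)
  show "AE p in polar_measure. norm ((a \<circ> polar_map) p) \<le> C" if "AE Z in ball_measure. norm (a Z) \<le> C" for C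
    using that AE_polar_comp_iff[of "\<lambda>Z. norm (a Z) \<le> C"] by simp
qed

section \<open>Invariant symbols for an abstract action\<close>

text \<open>
  Left and right invariance at the same time.  Here \<open>act W\<close> is multiplication by \<open>W\<close> on the
  side in question, \<open>N\<close> the measure on the quotient (before completion), \<open>\<rho>\<close> the projection and
  \<open>sec\<close> a measurable section of it, and \<open>sec_orbit\<close> says that \<open>\<rho>\<close> identifies only points of one
  orbit.
\<close>

locale polar_quotient =
  fixes N :: "(('n::{finite,linorder}) cmat set \<times> 'n rvec) measure"
    and \<rho> :: "('n cmat \<times> 'n cmat) set \<times> 'n rvec \<Rightarrow> 'n cmat set \<times> 'n rvec"
    and act :: "'n cmat \<Rightarrow> 'n cmat \<Rightarrow> 'n cmat"
    and sec :: "'n cmat set \<times> 'n rvec \<Rightarrow> ('n cmat \<times> 'n cmat) set \<times> 'n rvec"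
  assumes \<rho>_measurable: "\<rho> \<in> polar_base \<rightarrow>\<^sub>M N"
    and distr_\<rho>: "distr polar_base N \<rho> = N"
    and sec_measurable: "sec \<in> N \<rightarrow>\<^sub>M polar_base"
    and sec_orbit: "\<And>p. p \<in> polar_domain \<Longrightarrow> \<exists>W\<in>unitary_group. polar_map (sec (\<rho> p)) = act W (polar_map p)"
    and act_regular: "\<And>W Z. W \<in> unitary_group \<Longrightarrow> act W Z \<in> regular_ball \<longleftrightarrow> Z \<in> regular_ball"
    and \<rho>_act: "\<And>W Z. W \<in> unitary_group \<Longrightarrow> Z \<in> regular_ball \<Longrightarrow> \<rho> (polar_inv (act W Z)) = \<rho> (polar_inv Z)"
    and act_measurable: "(\<lambda>q. act (fst q) (snd q)) \<in> borel_measurable borel"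
    and act_null: "\<And>W S. W \<in> unitary_group \<Longrightarrow> S \<in> null_sets lborel \<Longrightarrow> act W -` S \<in> null_sets lborel"
    and act_haar: "\<And>W Z. W \<in> unitary_group \<Longrightarrow>
      distr haar borel (\<lambda>V. act V (act W Z)) = distr haar borel (\<lambda>V. act V Z)"
begin

definition invariant_symbol :: "('n cmat \<Rightarrow> complex) \<Rightarrow> bool" where
  "invariant_symbol a \<longleftrightarrow> (\<forall>W\<in>unitary_group. \<forall>Z\<in>matrix_ball. a (act W Z) = a Z)"

definition fibre_constant :: "(('n cmat \<times> 'n cmat) set \<times> 'n rvec \<Rightarrow> complex) \<Rightarrow> bool" where
  "fibre_constant b \<longleftrightarrow> (\<forall>p\<in>polar_domain. \<forall>p'\<in>polar_domain. \<rho> p = \<rho> p' \<longrightarrow> b p = b p')"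

lemma AE_act:
  assumes W: "W \<in> unitary_group" and P: "AE Z in lborel. P Z"
  shows "AE Z in lborel. P (act W Z)"
proof -
  obtain S where S: "S \<in> null_sets lborel" "{Z. \<not> P Z} \<subseteq> S"
    using P unfolding eventually_ae_filter by auto
  have "{Z \<in> space lborel. \<not> P (act W Z)} \<subseteq> act W -` S" using S(2) by auto
  then show ?thesis using act_null[OF W S(1)] by (rule AE_I'[rotated])
qed

lemma act_measurable2: "f \<in> borel_measurable M \<Longrightarrow> g \<in> borel_measurable M \<Longrightarrow> (\<lambda>x. act (f x) (g x)) \<in> borel_measurable M"
  using measurable_compose[OF borel_measurable_Pair act_measurable, of f M g] by simp

lemma AE_\<rho>: "AE y in N. P y \<Longrightarrow> AE p in polar_base. P (\<rho> p)"
  using AE_distrD[OF \<rho>_measurable, of P] unfolding distr_\<rho> .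

text \<open>
  Because \<open>f\<close> is measurable only for the completion, it has to be replaced by a Borel version
  before the image measure can be used.
\<close>

lemma AE_\<rho>_converse:
  assumes f: "f \<in> borel_measurable (completion N)" and Q: "{z :: complex. Q z} \<in> sets borel"
    and AE: "AE p in polar_base. Q (f (\<rho> p))"
  shows "AE y in N. Q (f y)"
proof -
  obtain g where g: "g \<in> borel_measurable N" "AE y in N. f y = g y"
    using f by (rule completion_ex_borel_measurable_complex)
  from AE AE_\<rho>[OF g(2)] have "AE p in polar_base. Q (g (\<rho> p))" by eventually_elim simp
  moreover have "{y \<in> space N. Q (g y)} \<in> sets N"
    using measurable_sets[OF g(1) Q] by (simp add: vimage_def Int_def conj_commute)
  ultimately have "AE y in distr polar_base N \<rho>. Q (g y)"
    by (subst AE_distr_iff[OF \<rho>_measurable])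
  then have "AE y in N. Q (g y)" unfolding distr_\<rho> .
  then show ?thesis using g(2) by eventually_elim simp
qed

lemma symbol_of_eq: "symbol_of \<rho> f Z = (if Z \<in> regular_ball then f (\<rho> (polar_inv Z)) else 0)"
  by (simp add: symbol_of_def regular_ball_def)

lemma symbol_of_measurable:
  assumes "f \<in> borel_measurable (completion N)"
  shows "symbol_of \<rho> f \<in> borel_measurable ball_measure"
proof -
  obtain g where g: "g \<in> borel_measurable N" "AE y in N. f y = g y"
    using assms by (rule completion_ex_borel_measurable_complex)
  have meas: "(\<lambda>Z. g (\<rho> (polar_inv Z))) \<in> borel_measurable (restrict_space borel regular_ball)"
    by (rule measurable_compose[OF measurable_compose[OF measurable_polar_inv \<rho>_measurable] g(1)])
  define G where "G Z = (if Z \<in> regular_ball then g (\<rho> (polar_inv Z)) else 0)" for Z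
  have "G \<in> borel_measurable borel"
    unfolding G_def[abs_def] using meas borel_regular_ball by (subst measurable_If_restrict_space_iff) auto
  moreover have "AE Z in lborel. Z \<in> regular_ball \<longrightarrow> symbol_of \<rho> f Z = G Z"
    using AE_\<rho>[OF g(2)] unfolding AE_polar_base_iff by eventually_elim (simp add: symbol_of_eq G_def)
  ultimately show ?thesis unfolding borel_measurable_ball_iff by blast
qed

lemma AE_symbol_of_iff:
  "(AE Z in ball_measure. P Z (symbol_of \<rho> f Z)) \<longleftrightarrow> (AE p in polar_base. P (polar_map p) (f (\<rho> p)))"
  unfolding AE_ball_iff AE_polar_base_iff by (intro AE_cong) (simp add: symbol_of_eq polar_map_polar_inv)

lemma invariant_symbol_of: "invariant_symbol (symbol_of \<rho> f)"
  unfolding invariant_symbol_def symbol_of_eq by (simp add: act_regular \<rho>_act)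

lemma symbol_of_ess_bounded:
  assumes "f \<in> ess_bounded (completion N)"
  shows "symbol_of \<rho> f \<in> ess_bounded ball_measure"
proof (rule ess_boundedI[OF _ assms])
  show "symbol_of \<rho> f \<in> borel_measurable ball_measure"
    using assms by (intro symbol_of_measurable) (simp add: ess_bounded_def)
  fix C assume "AE y in completion N. norm (f y) \<le> C"
  then have "AE p in polar_base. norm (f (\<rho> p)) \<le> C" unfolding AE_completion_iff by (rule AE_\<rho>)
  then show "AE Z in ball_measure. norm (symbol_of \<rho> f Z) \<le> C"
    using AE_symbol_of_iff[of "\<lambda>_ z. norm z \<le> C" f] by blast
qed

lemma fibre_constant_imp_ae_invariant:
  assumes "holds_mod_ae polar_measure fibre_constant (a \<circ> polar_map)" and W: "W \<in> unitary_group"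
  shows "AE Z in ball_measure. a (act W Z) = a Z"
proof -
  obtain b where b: "AE p in polar_measure. (a \<circ> polar_map) p = b p" "fibre_constant b"
    using assms(1) unfolding holds_mod_ae_def ae_rel_def by blast
  have 1: "AE Z in lborel. Z \<in> regular_ball \<longrightarrow> (a \<circ> polar_map) (polar_inv Z) = b (polar_inv Z)"
    using b(1) unfolding AE_polar_iff .
  from 1 AE_act[OF W 1] show ?thesis unfolding AE_ball_iff
  proof eventually_elim
    case (elim Z)
    show ?case
    proof
      assume Z: "Z \<in> regular_ball"
      then have Z': "act W Z \<in> regular_ball" using act_regular[OF W] by blast
      have "b (polar_inv (act W Z)) = b (polar_inv Z)"
        using b(2) polar_inv_in[OF Z] polar_inv_in[OF Z'] \<rho>_act[OF W Z] unfolding fibre_constant_def by blast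
      then show "a (act W Z) = a Z"
        using elim Z Z' by (simp add: polar_map_polar_inv)
    qed
  qed
qed

text \<open>
  The function \<open>F\<close> is the average of a bounded Borel version \<open>h\<close> of \<open>a\<close> over the orbit of \<open>Z\<close>.
  Invariance of the Haar measure makes \<open>F\<close> invariant everywhere, so evaluating it along the
  section gives a function on the quotient whose pull-back is \<open>F\<close>.  Fubini exchanges the
  quantifiers in the assumption and shows that \<open>F = h\<close> almost everywhere.
\<close>

lemma ae_invariant_imp_factor:
  assumes a: "a \<in> ess_bounded ball_measure"
    and inv: "\<And>W. W \<in> unitary_group \<Longrightarrow> AE Z in ball_measure. a (act W Z) = a Z"
  obtains f where "f \<in> borel_measurable (completion N)" "AE p in polar_measure. (a \<circ> polar_map) p = (f \<circ> \<rho>) p"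
proof -
  obtain C where C: "AE Z in ball_measure. norm (a Z) \<le> C" and am: "a \<in> borel_measurable ball_measure"
    using a by (auto simp: ess_bounded_def)
  obtain a' where a' [measurable]: "a' \<in> borel_measurable borel" and aa': "AE Z in lborel. Z \<in> regular_ball \<longrightarrow> a Z = a' Z"
    using am unfolding borel_measurable_ball_iff by blast
  \<comment> \<open>The cut-off makes the Borel version bounded and gives it the value zero outside the invariant set \<open>regular_ball\<close>.\<close>
  define h where "h Z = (if Z \<in> regular_ball then (if norm (a' Z) \<le> C then a' Z else 0) else 0)" for Z
  have h [measurable]: "h \<in> borel_measurable borel"
  proof -
    have "(\<lambda>Z. if norm (a' Z) \<le> C then a' Z else 0) \<in> borel_measurable borel"
      using a' by (intro measurable_If) auto
    then show ?thesis unfolding h_def[abs_def] using borel_regular_ball by (intro measurable_If) auto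
  qed
  have hb: "norm (h Z) \<le> \<bar>C\<bar>" for Z by (auto simp: h_def)
  have ah: "AE Z in lborel. Z \<in> regular_ball \<longrightarrow> a Z = h Z"
    using C[unfolded AE_ball_iff] aa' by eventually_elim (simp add: h_def)
  have h_inv: "AE Z in lborel. h (act W Z) = h Z" if W: "W \<in> unitary_group" for W
    using inv[OF W, unfolded AE_ball_iff] ah AE_act[OF W ah]
  proof eventually_elim
    case (elim Z)
    show ?case
    proof (cases "Z \<in> regular_ball")
      case True then show ?thesis using elim act_regular[OF W] by simp
    next
      case False then show ?thesis using act_regular[OF W] by (simp add: h_def)
    qed
  qed
  interpret HL: pair_sigma_finite "haar :: 'n cmat measure" "lborel :: 'n cmat measure"
    by (intro pair_sigma_finite.intro sigma_finite_haar sigma_finite_lborel)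
  have fm: "(\<lambda>q. fst q) \<in> borel_measurable (haar \<Otimes>\<^sub>M (lborel :: 'n cmat measure))"
    by (rule measurable_compose[OF measurable_fst measurable_haar_ident])
  have sm: "(\<lambda>q. snd q) \<in> borel_measurable ((haar :: 'n cmat measure) \<Otimes>\<^sub>M (lborel :: 'n cmat measure))"
    using measurable_snd[of haar lborel] by simp
  have "(\<lambda>q. h (act (fst q) (snd q)) - h (snd q)) \<in> borel_measurable (haar \<Otimes>\<^sub>M lborel)"
    by (intro borel_measurable_diff measurable_compose[OF act_measurable2[OF fm sm] h] measurable_compose[OF sm h])
  from measurable_sets[OF this, of "{0}"]
  have "{q \<in> space (haar \<Otimes>\<^sub>M lborel). h (act (fst q) (snd q)) = h (snd q)} \<in> sets (haar \<Otimes>\<^sub>M lborel)"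
    by (simp add: vimage_def Int_def conj_commute)
  from HL.AE_commute[OF this] have "(AE W in haar. AE Z in lborel. h (act W Z) = h Z) \<longleftrightarrow>
    (AE Z in lborel. AE W in haar. h (act W Z) = h Z)" .
  moreover have "AE W in haar. AE Z in lborel. h (act W Z) = h Z"
    by (rule AE_I2) (simp add: h_inv)
  ultimately have AE_h: "AE Z in lborel. AE W in haar. h (act W Z) = h Z" by blast
  have act1: "(\<lambda>W. act W Z) \<in> haar \<rightarrow>\<^sub>M borel" for Z
    by (rule act_measurable2[OF measurable_haar_ident]) simp
  define F where "F Z = (LINT W|haar. h (act W Z))" for Z
  have F_eq: "AE Z in lborel. F Z = h Z"
    using AE_h
  proof eventually_elim
    case (elim Z)
    have "F Z = (LINT W|(haar :: 'n cmat measure). h Z)"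
      unfolding F_def by (rule Bochner_Integration.integral_cong_AE) (use elim measurable_compose[OF act1 h] in auto)
    also have "\<dots> = h Z" by (simp add: measure_def)
    finally show ?case .
  qed
  have F_meas: "F \<in> borel_measurable borel"
  proof -
    have "(\<lambda>q. h (act (snd q) (fst q))) \<in> borel_measurable (borel \<Otimes>\<^sub>M haar)"
      by (intro measurable_compose[OF act_measurable2 h] measurable_fst measurable_compose[OF measurable_snd measurable_haar_ident])
    then show ?thesis
      unfolding F_def[abs_def]
      by (intro sigma_finite_measure.borel_measurable_lebesgue_integral[OF sigma_finite_haar]) (simp add: case_prod_beta)
  qed
  have F_inv: "F (act W Z) = F Z" if W: "W \<in> unitary_group" for W Z
  proof -
    have "F Y = integral\<^sup>L (distr haar borel (\<lambda>V. act V Y)) h" for Y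
      unfolding F_def using act1 h by (rule integral_distr[symmetric])
    then show ?thesis by (simp add: act_haar[OF W])
  qed
  define f where "f y = F (polar_map (sec y))" for y
  have "f \<in> borel_measurable N"
    unfolding f_def[abs_def]
    by (rule measurable_compose[OF measurable_compose[OF sec_measurable measurable_polar_map] F_meas])
  then have "f \<in> borel_measurable (completion N)" by (rule measurable_completion)
  moreover have "AE p in polar_measure. (a \<circ> polar_map) p = (f \<circ> \<rho>) p"
    unfolding AE_polar_iff using ah F_eq
  proof eventually_elim
    case (elim Z)
    show ?case
    proof
      assume Z: "Z \<in> regular_ball"
      obtain W where W: "W \<in> unitary_group" "polar_map (sec (\<rho> (polar_inv Z))) = act W (polar_map (polar_inv Z))"
        using sec_orbit[OF polar_inv_in[OF Z]] by blast
      then show "(a \<circ> polar_map) (polar_inv Z) = (f \<circ> \<rho>) (polar_inv Z)"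
        using elim Z by (simp add: f_def polar_map_polar_inv F_inv)
    qed
  qed
  ultimately show ?thesis by (rule that)
qed

lemma factor_imp_symbol:
  assumes a: "a \<in> ess_bounded ball_measure" and f: "f \<in> borel_measurable (completion N)"
    and eq: "AE p in polar_measure. (a \<circ> polar_map) p = (f \<circ> \<rho>) p"
  shows "(a, symbol_of \<rho> f) \<in> ae_rel ball_measure"
proof -
  have "AE p in polar_base. a (polar_map p) = f (\<rho> p)"
    using eq[unfolded polar_measure_eq AE_completion_iff] by simp
  then have 1: "AE Z in ball_measure. a Z = symbol_of \<rho> f Z"
    using AE_symbol_of_iff[of "\<lambda>Z z. a Z = z" f] by blast
  have "symbol_of \<rho> f \<in> ess_bounded ball_measure"
  proof (rule ess_boundedI[OF symbol_of_measurable[OF f] a])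
    fix C assume "AE Z in ball_measure. norm (a Z) \<le> C"
    with 1 show "AE Z in ball_measure. norm (symbol_of \<rho> f Z) \<le> C" by eventually_elim simp
  qed
  then show ?thesis using 1 a by (simp add: ae_rel_def)
qed

lemma invariant_imp_fibre_constant:
  assumes "holds_mod_ae ball_measure invariant_symbol a"
  shows "holds_mod_ae polar_measure fibre_constant (a \<circ> polar_map)"
proof -
  obtain g where g: "a \<in> ess_bounded ball_measure" "g \<in> ess_bounded ball_measure"
      "AE Z in ball_measure. a Z = g Z" "invariant_symbol g"
    using assms unfolding holds_mod_ae_def ae_rel_def by blast
  have "AE p in polar_measure. (a \<circ> polar_map) p = (g \<circ> polar_map) p"
    using g(3) AE_polar_comp_iff[of "\<lambda>Z. a Z = g Z"] by simp
  then have "(a \<circ> polar_map, g \<circ> polar_map) \<in> ae_rel polar_measure"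
    using g by (simp add: ae_rel_def polar_comp_ess_bounded)
  moreover have sec: "g (polar_map p) = g (polar_map (sec (\<rho> p)))" if p: "p \<in> polar_domain" for p
  proof -
    obtain W where "W \<in> unitary_group" "polar_map (sec (\<rho> p)) = act W (polar_map p)"
      using sec_orbit[OF p] by blast
    moreover have "polar_map p \<in> matrix_ball" using polar_map_in[OF p] by (simp add: regular_ball_def)
    ultimately show ?thesis using g(4) by (simp add: invariant_symbol_def)
  qed
  have "fibre_constant (g \<circ> polar_map)"
    unfolding fibre_constant_def
  proof (intro ballI impI)
    fix p p' assume "p \<in> polar_domain" "p' \<in> polar_domain" "\<rho> p = \<rho> p'"
    then show "(g \<circ> polar_map) p = (g \<circ> polar_map) p'" using sec[of p] sec[of p'] by simp
  qed
  ultimately show ?thesis unfolding holds_mod_ae_def by blast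
qed

lemma factor_imp_invariant:
  assumes "a \<in> ess_bounded ball_measure" "f \<in> borel_measurable (completion N)"
    "AE p in polar_measure. (a \<circ> polar_map) p = (f \<circ> \<rho>) p"
  shows "holds_mod_ae ball_measure invariant_symbol a"
  unfolding holds_mod_ae_def using factor_imp_symbol[OF assms] invariant_symbol_of by blast

text \<open>
  A cycle of four implications through the weakest form of invariance.
\<close>

theorem invariance_equivalences:
  assumes a: "a \<in> ess_bounded ball_measure"
  shows "holds_mod_ae ball_measure invariant_symbol a
      \<longleftrightarrow> (\<forall>W\<in>unitary_group. AE Z in ball_measure. a (act W Z) = a Z)"
    and "holds_mod_ae ball_measure invariant_symbol a
      \<longleftrightarrow> holds_mod_ae polar_measure fibre_constant (a \<circ> polar_map)"
    and "holds_mod_ae polar_measure fibre_constant (a \<circ> polar_map)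
      \<longleftrightarrow> (\<exists>f \<in> borel_measurable (completion N). AE p in polar_measure. (a \<circ> polar_map) p = (f \<circ> \<rho>) p)"
proof -
  let ?P0 = "\<forall>W\<in>unitary_group. AE Z in ball_measure. a (act W Z) = a Z"
  let ?P1 = "holds_mod_ae ball_measure invariant_symbol a"
  let ?P2 = "holds_mod_ae polar_measure fibre_constant (a \<circ> polar_map)"
  let ?P3 = "\<exists>f \<in> borel_measurable (completion N). AE p in polar_measure. (a \<circ> polar_map) p = (f \<circ> \<rho>) p"
  have 1: "?P1 \<Longrightarrow> ?P2" by (rule invariant_imp_fibre_constant)
  have 2: "?P2 \<Longrightarrow> ?P0" using fibre_constant_imp_ae_invariant by blast
  have 3: "?P3" if p0: "?P0"
  proof (rule ae_invariant_imp_factor[OF a])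
    show "AE Z in ball_measure. a (act W Z) = a Z" if "W \<in> unitary_group" for W
      using p0 that by (rule bspec)
    fix f assume "f \<in> borel_measurable (completion N)" "AE p in polar_measure. (a \<circ> polar_map) p = (f \<circ> \<rho>) p"
    then show ?P3 by (intro bexI[of _ f])
  qed
  have 4: "?P3 \<Longrightarrow> ?P1" using factor_imp_invariant[OF a] by blast
  show "?P1 \<longleftrightarrow> ?P0" "?P1 \<longleftrightarrow> ?P2" "?P2 \<longleftrightarrow> ?P3" using 1 2 3 4 by argo+
qed

lemma symbol_of_ae_rel_iff:
  assumes f: "f \<in> ess_bounded (completion N)" and g: "g \<in> ess_bounded (completion N)"
  shows "(symbol_of \<rho> f, symbol_of \<rho> g) \<in> ae_rel ball_measure \<longleftrightarrow> (f, g) \<in> ae_rel (completion N)"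
proof -
  have fg: "(\<lambda>y. f y - g y) \<in> borel_measurable (completion N)"
    using f g by (auto simp: ess_bounded_def)
  have "(AE Z in ball_measure. symbol_of \<rho> f Z = symbol_of \<rho> g Z)
      \<longleftrightarrow> (AE p in polar_base. f (\<rho> p) = g (\<rho> p))"
    unfolding AE_ball_iff AE_polar_base_iff by (intro AE_cong) (simp add: symbol_of_eq)
  also have "\<dots> \<longleftrightarrow> (AE y in N. f y = g y)"
    using AE_\<rho>[of "\<lambda>y. f y = g y"] AE_\<rho>_converse[OF fg, of "\<lambda>z. z = 0"] by auto
  finally show ?thesis
    using f g by (simp add: ae_rel_def symbol_of_ess_bounded AE_completion_iff)
qed

text \<open>
  Injectivity holds because \<open>\<rho>\<close> preserves measures, so that equality almost everywhere descends
  from the polar space to the quotient; surjectivity is the factorisation of invariant symbols.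
\<close>

theorem symbol_correspondence:
  "\<exists>\<Phi>. (\<forall>f \<in> ess_bounded (completion N).
        \<Phi> (cls (ae_rel (completion N)) f) = cls (ae_rel ball_measure) (symbol_of \<rho> f))
     \<and> bij_betw \<Phi> (L_infty (completion N)) {A \<in> L_infty ball_measure. \<exists>a\<in>A. invariant_symbol a}"
proof (intro exI conjI ballI)
  let ?M = "completion N" and ?B = "ball_measure :: 'n cmat measure"
  define \<Phi> where "\<Phi> A = cls (ae_rel ?B) (symbol_of \<rho> (SOME f. f \<in> A))" for A
  have \<Phi>: "\<Phi> (cls (ae_rel ?M) f) = cls (ae_rel ?B) (symbol_of \<rho> f)" if f: "f \<in> ess_bounded ?M" for f
  proof -
    define g where "g = (SOME g. g \<in> cls (ae_rel ?M) f)"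
    have "f \<in> cls (ae_rel ?M) f" using equiv_class_self[OF equiv_ae_rel f] by (simp add: cls_def)
    then have "g \<in> cls (ae_rel ?M) f" unfolding g_def by (rule someI[of "\<lambda>g. g \<in> cls (ae_rel ?M) f"])
    then have fg: "(f, g) \<in> ae_rel ?M" by (simp add: cls_def)
    then have "g \<in> ess_bounded ?M" by (simp add: ae_rel_def)
    then have "(symbol_of \<rho> f, symbol_of \<rho> g) \<in> ae_rel ?B" using fg f symbol_of_ae_rel_iff by blast
    from equiv_class_eq[OF equiv_ae_rel this] show ?thesis by (simp add: \<Phi>_def cls_def g_def)
  qed
  then show "\<And>f. f \<in> ess_bounded ?M \<Longrightarrow> \<Phi> (cls (ae_rel ?M) f) = cls (ae_rel ?B) (symbol_of \<rho> f)" .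
  have LM: "L_infty ?M = cls (ae_rel ?M) ` ess_bounded ?M" and LB: "L_infty ?B = cls (ae_rel ?B) ` ess_bounded ?B"
    by (auto simp: L_infty_def cls_def quotient_def)
  show "bij_betw \<Phi> (L_infty ?M) {A \<in> L_infty ?B. \<exists>a\<in>A. invariant_symbol a}"
  proof (rule bij_betw_imageI)
    show "inj_on \<Phi> (L_infty ?M)"
    proof (rule inj_onI)
      fix A B assume "A \<in> L_infty ?M" "B \<in> L_infty ?M" and eq: "\<Phi> A = \<Phi> B"
      then obtain f g where f: "f \<in> ess_bounded ?M" "A = cls (ae_rel ?M) f" and g: "g \<in> ess_bounded ?M" "B = cls (ae_rel ?M) g"
        unfolding LM by blast
      have "cls (ae_rel ?B) (symbol_of \<rho> f) = cls (ae_rel ?B) (symbol_of \<rho> g)"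
        using eq f g \<Phi> by simp
      then have "(symbol_of \<rho> f, symbol_of \<rho> g) \<in> ae_rel ?B"
        unfolding cls_def using symbol_of_ess_bounded[OF g(1)] by (rule eq_equiv_class[OF _ equiv_ae_rel])
      then have "(f, g) \<in> ae_rel ?M" using symbol_of_ae_rel_iff f g by blast
      from equiv_class_eq[OF equiv_ae_rel this] show "A = B" using f g by (simp add: cls_def)
    qed
    show "\<Phi> ` L_infty ?M = {A \<in> L_infty ?B. \<exists>a\<in>A. invariant_symbol a}"
    proof (intro subset_antisym subsetI)
      fix A assume "A \<in> \<Phi> ` L_infty ?M"
      then obtain f where f: "f \<in> ess_bounded ?M" "A = cls (ae_rel ?B) (symbol_of \<rho> f)"
        unfolding LM using \<Phi> by auto
      then have s: "symbol_of \<rho> f \<in> ess_bounded ?B" by (intro symbol_of_ess_bounded)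
      then have "symbol_of \<rho> f \<in> A" using equiv_class_self[OF equiv_ae_rel s] f by (simp add: cls_def)
      then show "A \<in> {A \<in> L_infty ?B. \<exists>a\<in>A. invariant_symbol a}"
        using f(2) s invariant_symbol_of unfolding LB by blast
    next
      fix A assume A: "A \<in> {A \<in> L_infty ?B. \<exists>a\<in>A. invariant_symbol a}"
      then obtain a a0 where a: "a \<in> A" "invariant_symbol a" and a0: "a0 \<in> ess_bounded ?B" "A = cls (ae_rel ?B) a0"
        unfolding LB by blast
      then have a0a: "(a0, a) \<in> ae_rel ?B" by (simp add: cls_def)
      then have ab: "a \<in> ess_bounded ?B" by (simp add: ae_rel_def)
      have "holds_mod_ae ?B invariant_symbol a"
        using ab a(2) by (auto simp: holds_mod_ae_def ae_rel_def)
      then obtain f where f: "f \<in> borel_measurable ?M" "AE p in polar_measure. (a \<circ> polar_map) p = (f \<circ> \<rho>) p"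
        using invariance_equivalences[OF ab] by blast
      have "f \<in> ess_bounded ?M"
      proof (rule ess_boundedI[OF f(1) polar_comp_ess_bounded[OF ab]])
        fix C assume "AE p in polar_measure. norm ((a \<circ> polar_map) p) \<le> C"
        with f(2) have "AE p in polar_measure. norm (f (\<rho> p)) \<le> C" by eventually_elim simp
        then have "AE p in polar_base. norm (f (\<rho> p)) \<le> C" unfolding polar_measure_eq AE_completion_iff .
        moreover have "{z :: complex. norm z \<le> C} \<in> sets borel"
          by (intro borel_closed closed_Collect_le continuous_intros)
        ultimately have "AE y in N. norm (f y) \<le> C" using AE_\<rho>_converse[OF f(1), of "\<lambda>z. norm z \<le> C"] by blast
        then show "AE y in ?M. norm (f y) \<le> C" unfolding AE_completion_iff .
      qed
      moreover have "A = cls (ae_rel ?B) (symbol_of \<rho> f)"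
        using equiv_class_eq[OF equiv_ae_rel a0a] equiv_class_eq[OF equiv_ae_rel factor_imp_symbol[OF ab f]] a0(2)
        by (simp add: cls_def)
      ultimately show "A \<in> \<Phi> ` L_infty ?M" unfolding LM using \<Phi> by (metis imageI)
    qed
  qed
qed

end

section \<open>The left and the right quotient\<close>

abbreviation left_quotient :: "('n::{finite,linorder}) cmat set measure" where
  "left_quotient \<equiv> quotient_borel unitary_group left_torus_rel"

abbreviation right_quotient :: "('n::{finite,linorder}) cmat set measure" where
  "right_quotient \<equiv> quotient_borel unitary_group right_torus_rel"

definition left_base :: "(('n::{finite,linorder}) cmat set \<times> 'n rvec) measure" where
  "left_base = distr haar left_quotient (cls left_torus_rel) \<Otimes>\<^sub>M chamber_measure"

definition right_base :: "(('n::{finite,linorder}) cmat set \<times> 'n rvec) measure" where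
  "right_base = distr haar right_quotient (cls right_torus_rel) \<Otimes>\<^sub>M chamber_measure"

lemma left_quotient_measure_eq: "left_quotient_measure = completion left_base"
  by (simp add: left_quotient_measure_def left_base_def)

lemma right_quotient_measure_eq: "right_quotient_measure = completion right_base"
  by (simp add: right_quotient_measure_def right_base_def)

lemma sets_left_base: "sets left_base = sets (left_quotient \<Otimes>\<^sub>M chamber_measure)"
  unfolding left_base_def by (rule sets_pair_measure_cong) simp_all

lemma sets_right_base: "sets right_base = sets (right_quotient \<Otimes>\<^sub>M chamber_measure)"
  unfolding right_base_def by (rule sets_pair_measure_cong) simp_all

lemma unitary_in_sets_haar: "unitary_group \<in> sets (haar :: ('n::{finite,linorder}) cmat measure)"
  using sets.top[of "haar :: 'n cmat measure"] by simp

lemma distr_haar_pair_fst: "distr (haar \<Otimes>\<^sub>M (haar :: ('n::{finite,linorder}) cmat measure)) haar fst = (haar :: ('n::{finite,linorder}) cmat measure)"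
proof (rule measure_eqI)
  fix A assume "A \<in> sets (distr (haar \<Otimes>\<^sub>M (haar :: 'n cmat measure)) (haar :: 'n cmat measure) fst)"
  then have A: "A \<in> sets (haar :: 'n cmat measure)" by simp
  have "fst -` A \<inter> space (haar \<Otimes>\<^sub>M (haar :: 'n cmat measure)) = A \<times> unitary_group"
    using sets.sets_into_space[OF A] by (auto simp: space_pair_measure)
  then show "emeasure (distr (haar \<Otimes>\<^sub>M (haar :: 'n cmat measure)) haar fst) A = emeasure haar A"
    using A by (simp add: emeasure_distr sigma_finite_measure.emeasure_pair_measure_Times[OF sigma_finite_haar] unitary_in_sets_haar)
qed simp

lemma distr_haar_pair_snd: "distr ((haar :: ('n::{finite,linorder}) cmat measure) \<Otimes>\<^sub>M haar) haar snd = (haar :: ('n::{finite,linorder}) cmat measure)"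
proof (rule measure_eqI)
  fix A assume "A \<in> sets (distr ((haar :: 'n cmat measure) \<Otimes>\<^sub>M haar) (haar :: 'n cmat measure) snd)"
  then have A: "A \<in> sets (haar :: 'n cmat measure)" by simp
  have "snd -` A \<inter> space ((haar :: 'n cmat measure) \<Otimes>\<^sub>M haar) = unitary_group \<times> A"
    using sets.sets_into_space[OF A] by (auto simp: space_pair_measure)
  then show "emeasure (distr ((haar :: 'n cmat measure) \<Otimes>\<^sub>M haar) haar snd) A = emeasure haar A"
    using A by (simp add: emeasure_distr sigma_finite_measure.emeasure_pair_measure_Times[OF sigma_finite_haar] unitary_in_sets_haar)
qed simp

lemma emeasure_distr_haar:
  assumes m: "g \<in> haar \<rightarrow>\<^sub>M borel" and A: "A \<in> sets borel"
  shows "emeasure (distr haar borel g) A = (\<integral>\<^sup>+V. indicator A (g V) \<partial>haar)"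
proof -
  have "(\<integral>\<^sup>+V. indicator A (g V) \<partial>haar) = (\<integral>\<^sup>+x. indicator A x \<partial>distr haar borel g)"
    using A by (intro nn_integral_distr[OF m, symmetric]) simp
  also have "\<dots> = emeasure (distr haar borel g) A"
    using A by (intro nn_integral_indicator) simp
  finally show ?thesis ..
qed

lemma distr_haar_action:
  assumes h: "h \<in> borel \<rightarrow>\<^sub>M borel" and g: "g \<in> borel \<rightarrow>\<^sub>M borel"
    and inv: "\<And>f. f \<in> borel_measurable borel \<Longrightarrow> (\<integral>\<^sup>+V. f (h V) \<partial>haar) = (\<integral>\<^sup>+V. f V \<partial>haar)"
  shows "distr haar borel (\<lambda>V. g (h V)) = distr haar borel (\<lambda>V. g V)"
proof (rule measure_eqI)
  fix A assume "A \<in> sets (distr haar borel (\<lambda>V. g (h V)))"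
  then have A: "A \<in> sets borel" by simp
  have gh: "(\<lambda>V. g (h V)) \<in> haar \<rightarrow>\<^sub>M borel" and g': "(\<lambda>V. g V) \<in> haar \<rightarrow>\<^sub>M borel"
    by (rule measurable_haar, rule measurable_compose[OF h g]) (rule measurable_haar[OF g])
  show "emeasure (distr haar borel (\<lambda>V. g (h V))) A = emeasure (distr haar borel (\<lambda>V. g V)) A"
    unfolding emeasure_distr_haar[OF gh A] emeasure_distr_haar[OF g' A]
    by (rule inv[of "\<lambda>V. indicator A (g V)"])
      (rule measurable_compose[OF g borel_measurable_indicator[OF A]])
qed simp

lemma null_sets_unitary:
  fixes S :: "(complex^'n^'n) set"
  assumes "U \<in> unitary_group" "V \<in> unitary_group" "S \<in> null_sets lborel"
  shows "(\<lambda>Z. U ** Z ** V) -` S \<in> null_sets lborel"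
proof -
  have S: "S \<in> sets borel" using null_setsD2[OF assms(3)] by simp
  have "(\<lambda>Z. U ** Z ** V) \<in> borel \<rightarrow>\<^sub>M borel" by measurable
  then have "(\<lambda>Z. U ** Z ** V) -` S \<in> sets borel" using S by (rule measurable_sets_borel)
  then show ?thesis
    using emeasure_lborel_unitary[OF assms(1,2) S] null_setsD1[OF assms(3)] by (simp add: null_sets_def)
qed

lemma measurable_cls_restrict:
  assumes R: "equiv S R"
  shows "cls R \<in> restrict_space borel S \<rightarrow>\<^sub>M quotient_borel S R"
  by (rule measurable_cls[OF R]) (simp_all add: space_restrict_space measurable_restrict_space1)

lemma polar_domain_section:
  assumes "p \<in> polar_domain"
  shows "fst (pair_section (fst p)) \<in> unitary_group" "snd (pair_section (fst p)) \<in> unitary_group"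
    "p = (cls pair_torus_rel (fst (pair_section (fst p)), snd (pair_section (fst p))), snd p)"
proof -
  have "fst p \<in> (unitary_group \<times> unitary_group) // pair_torus_rel" using assms by (auto simp: polar_domain_def)
  from pair_section[OF this] show "fst (pair_section (fst p)) \<in> unitary_group" "snd (pair_section (fst p)) \<in> unitary_group"
    "p = (cls pair_torus_rel (fst (pair_section (fst p)), snd (pair_section (fst p))), snd p)"
    by auto
qed

lemma measurable_pair_section_unitary:
  "(\<lambda>p. fst (pair_section (fst p))) \<in> polar_base \<rightarrow>\<^sub>M restrict_space borel unitary_group"
  "(\<lambda>p. snd (pair_section (fst p))) \<in> polar_base \<rightarrow>\<^sub>M restrict_space borel unitary_group"
proof -
  have s: "(\<lambda>p. pair_section (fst p)) \<in> borel_measurable polar_base"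
    unfolding measurable_cong_sets[OF sets_polar_base refl] by (rule measurable_compose[OF measurable_fst measurable_pair_section])
  have "(\<lambda>p. fst (pair_section (fst p))) \<in> borel_measurable polar_base"
    by (rule borel_measurable_continuous_on[OF continuous_on_fst[OF continuous_on_id] s])
  then show "(\<lambda>p. fst (pair_section (fst p))) \<in> polar_base \<rightarrow>\<^sub>M restrict_space borel unitary_group"
    by (intro measurable_restrict_space2) (auto simp: polar_domain_section)
  have "(\<lambda>p. snd (pair_section (fst p))) \<in> borel_measurable polar_base"
    by (rule borel_measurable_continuous_on[OF continuous_on_snd[OF continuous_on_id] s])
  then show "(\<lambda>p. snd (pair_section (fst p))) \<in> polar_base \<rightarrow>\<^sub>M restrict_space borel unitary_group"
    by (intro measurable_restrict_space2) (auto simp: polar_domain_section)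
qed

lemma measurable_rho_left: "rho_left \<in> polar_base \<rightarrow>\<^sub>M left_base"
proof -
  have "(\<lambda>p. (cls left_torus_rel (snd (pair_section (fst p))), snd p)) \<in> polar_base \<rightarrow>\<^sub>M (left_quotient \<Otimes>\<^sub>M chamber_measure)"
  proof (rule measurable_Pair)
    show "(\<lambda>p. cls left_torus_rel (snd (pair_section (fst p)))) \<in> polar_base \<rightarrow>\<^sub>M left_quotient"
      by (rule measurable_compose[OF measurable_pair_section_unitary(2) measurable_cls_restrict[OF equiv_left_torus_rel]])
    show "(\<lambda>p. snd p) \<in> polar_base \<rightarrow>\<^sub>M chamber_measure"
      unfolding measurable_cong_sets[OF sets_polar_base refl] by (rule measurable_snd)
  qed
  moreover have "rho_left p = (cls left_torus_rel (snd (pair_section (fst p))), snd p)" if "p \<in> space polar_base" for p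
  proof -
    have p: "p \<in> polar_domain" using that by simp
    from rho_left_cls[OF polar_domain_section(1,2)[OF p], of "snd p"] show ?thesis
      unfolding polar_domain_section(3)[OF p, symmetric] .
  qed
  ultimately show ?thesis
    unfolding measurable_cong_sets[OF refl sets_left_base] by (rule measurable_cong[THEN iffD2, rotated])
qed

lemma measurable_rho_right: "rho_right \<in> polar_base \<rightarrow>\<^sub>M right_base"
proof -
  have "(\<lambda>p. (cls right_torus_rel (fst (pair_section (fst p))), snd p)) \<in> polar_base \<rightarrow>\<^sub>M (right_quotient \<Otimes>\<^sub>M chamber_measure)"
  proof (rule measurable_Pair)
    show "(\<lambda>p. cls right_torus_rel (fst (pair_section (fst p)))) \<in> polar_base \<rightarrow>\<^sub>M right_quotient"
      by (rule measurable_compose[OF measurable_pair_section_unitary(1) measurable_cls_restrict[OF equiv_right_torus_rel]])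
    show "(\<lambda>p. snd p) \<in> polar_base \<rightarrow>\<^sub>M chamber_measure"
      unfolding measurable_cong_sets[OF sets_polar_base refl] by (rule measurable_snd)
  qed
  moreover have "rho_right p = (cls right_torus_rel (fst (pair_section (fst p))), snd p)" if "p \<in> space polar_base" for p
  proof -
    have p: "p \<in> polar_domain" using that by simp
    from rho_right_cls[OF polar_domain_section(1,2)[OF p], of "snd p"] show ?thesis
      unfolding polar_domain_section(3)[OF p, symmetric] .
  qed
  ultimately show ?thesis
    unfolding measurable_cong_sets[OF refl sets_right_base] by (rule measurable_cong[THEN iffD2, rotated])
qed

text \<open>
  On representatives the projection acts on the matrix component alone, so the image of the
  product measure can be computed before passing to classes.
\<close>

lemma distr_polar_base:
  assumes \<rho>: "\<rho> \<in> polar_base \<rightarrow>\<^sub>M (Q \<Otimes>\<^sub>M chamber_measure)" and f: "f \<in> (haar \<Otimes>\<^sub>M haar) \<rightarrow>\<^sub>M Q"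
    and eq: "\<And>u x. u \<in> unitary_group \<times> unitary_group \<Longrightarrow> x \<in> chamber \<Longrightarrow> \<rho> (cls pair_torus_rel u, x) = (f u, x)"
  shows "distr polar_base (Q \<Otimes>\<^sub>M chamber_measure) \<rho> = distr (haar \<Otimes>\<^sub>M haar) Q f \<Otimes>\<^sub>M chamber_measure"
proof -
  have \<rho>': "\<rho> \<in> (pair_quotient \<Otimes>\<^sub>M chamber_measure) \<rightarrow>\<^sub>M (Q \<Otimes>\<^sub>M chamber_measure)"
    using \<rho> unfolding measurable_cong_sets[OF sets_polar_base refl] .
  have "distr polar_base (Q \<Otimes>\<^sub>M chamber_measure) \<rho> = distr svd_measure (Q \<Otimes>\<^sub>M chamber_measure) (\<rho> \<circ> polar_proj)"
    unfolding polar_base_eq by (rule distr_distr[OF \<rho>' measurable_polar_proj])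
  also have "\<dots> = distr svd_measure (Q \<Otimes>\<^sub>M chamber_measure) (\<lambda>(u, x). (f u, x))"
    by (rule distr_cong) (auto simp: polar_proj_def eq)
  also have "\<dots> = distr (haar \<Otimes>\<^sub>M haar) Q f \<Otimes>\<^sub>M chamber_measure"
    unfolding svd_measure_def by (rule distr_times_chamber[OF f, symmetric])
  finally show ?thesis .
qed

lemma measurable_cls_haar:
  assumes "equiv unitary_group R"
  shows "cls R \<in> haar \<rightarrow>\<^sub>M quotient_borel unitary_group R"
  by (rule measurable_cls[OF assms _ measurable_haar_ident]) simp

lemma distr_rho_left: "distr polar_base left_base rho_left = (left_base :: (('n::{finite,linorder}) cmat set \<times> 'n rvec) measure)"
proof -
  let ?Q = "left_quotient :: 'n cmat set measure"
  have c: "cls left_torus_rel \<in> haar \<rightarrow>\<^sub>M ?Q" by (rule measurable_cls_haar[OF equiv_left_torus_rel])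
  have "distr polar_base left_base rho_left = distr polar_base (?Q \<Otimes>\<^sub>M chamber_measure) rho_left"
    by (rule distr_cong) (simp_all add: sets_left_base)
  also have "\<dots> = distr ((haar :: 'n cmat measure) \<Otimes>\<^sub>M haar) ?Q (cls left_torus_rel \<circ> snd) \<Otimes>\<^sub>M chamber_measure"
  proof (rule distr_polar_base)
    show "rho_left \<in> polar_base \<rightarrow>\<^sub>M (?Q \<Otimes>\<^sub>M chamber_measure)"
      using measurable_rho_left unfolding measurable_cong_sets[OF refl sets_left_base] .
    show "cls left_torus_rel \<circ> snd \<in> ((haar :: 'n cmat measure) \<Otimes>\<^sub>M haar) \<rightarrow>\<^sub>M ?Q"
      by (rule measurable_comp[OF measurable_snd c])
  qed (auto simp: rho_left_cls)
  also have "distr ((haar :: 'n cmat measure) \<Otimes>\<^sub>M haar) ?Q (cls left_torus_rel \<circ> snd) = distr haar ?Q (cls left_torus_rel)"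
    using distr_distr[OF c measurable_snd, of "haar :: 'n cmat measure"] unfolding distr_haar_pair_snd by simp
  finally show ?thesis by (simp only: left_base_def)
qed

lemma distr_rho_right: "distr polar_base right_base rho_right = (right_base :: (('n::{finite,linorder}) cmat set \<times> 'n rvec) measure)"
proof -
  let ?Q = "right_quotient :: 'n cmat set measure"
  have c: "cls right_torus_rel \<in> haar \<rightarrow>\<^sub>M ?Q" by (rule measurable_cls_haar[OF equiv_right_torus_rel])
  have "distr polar_base right_base rho_right = distr polar_base (?Q \<Otimes>\<^sub>M chamber_measure) rho_right"
    by (rule distr_cong) (simp_all add: sets_right_base)
  also have "\<dots> = distr (haar \<Otimes>\<^sub>M (haar :: 'n cmat measure)) ?Q (cls right_torus_rel \<circ> fst) \<Otimes>\<^sub>M chamber_measure"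
  proof (rule distr_polar_base)
    show "rho_right \<in> polar_base \<rightarrow>\<^sub>M (?Q \<Otimes>\<^sub>M chamber_measure)"
      using measurable_rho_right unfolding measurable_cong_sets[OF refl sets_right_base] .
    show "cls right_torus_rel \<circ> fst \<in> (haar \<Otimes>\<^sub>M (haar :: 'n cmat measure)) \<rightarrow>\<^sub>M ?Q"
      by (rule measurable_comp[OF measurable_fst c])
  qed (auto simp: rho_right_cls)
  also have "distr (haar \<Otimes>\<^sub>M (haar :: 'n cmat measure)) ?Q (cls right_torus_rel \<circ> fst) = distr haar ?Q (cls right_torus_rel)"
    using distr_distr[OF c measurable_fst, of "haar :: 'n cmat measure"] unfolding distr_haar_pair_fst by simp
  finally show ?thesis by (simp only: right_base_def)
qed

text \<open>
  A representative with trivial \<open>U\<close>: the class \<open>[V]\<close> is lifted to \<open>[1, V]\<close>.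
\<close>

definition left_lift :: "('n::{finite,linorder}) cmat set \<times> 'n rvec \<Rightarrow> ('n cmat \<times> 'n cmat) set \<times> 'n rvec" where
  "left_lift y = (cls pair_torus_rel (mat 1, left_section (fst y)), snd y)"

definition right_lift :: "('n::{finite,linorder}) cmat set \<times> 'n rvec \<Rightarrow> ('n cmat \<times> 'n cmat) set \<times> 'n rvec" where
  "right_lift y = (cls pair_torus_rel (right_section (fst y), mat 1), snd y)"

lemma measurable_left_lift: "(left_lift :: ('n::{finite,linorder}) cmat set \<times> 'n rvec \<Rightarrow> _) \<in> left_base \<rightarrow>\<^sub>M polar_base"
proof -
  have "(\<lambda>c :: 'n cmat set. (mat 1 :: 'n cmat, left_section c)) \<in> left_quotient \<rightarrow>\<^sub>M borel"
    by (intro borel_measurable_Pair measurable_left_section) simp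
  then have 1: "(\<lambda>c :: 'n cmat set. (mat 1 :: 'n cmat, left_section c)) \<in> left_quotient \<rightarrow>\<^sub>M restrict_space borel (unitary_group \<times> unitary_group)"
    by (intro measurable_restrict_space2) (auto simp: left_section)
  have "(left_lift :: 'n cmat set \<times> 'n rvec \<Rightarrow> _) \<in> (left_quotient \<Otimes>\<^sub>M chamber_measure) \<rightarrow>\<^sub>M (pair_quotient \<Otimes>\<^sub>M chamber_measure)"
    unfolding left_lift_def[abs_def]
  proof (rule measurable_Pair[OF _ measurable_snd])
    show "(\<lambda>y :: 'n cmat set \<times> 'n rvec. cls pair_torus_rel (mat 1, left_section (fst y))) \<in> (left_quotient \<Otimes>\<^sub>M chamber_measure) \<rightarrow>\<^sub>M pair_quotient"
      by (rule measurable_compose[OF measurable_fst measurable_compose[OF 1 measurable_cls_restrict[OF equiv_pair_torus_rel]]])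
  qed
  then show ?thesis unfolding measurable_cong_sets[OF sets_left_base sets_polar_base] .
qed

lemma measurable_right_lift: "(right_lift :: ('n::{finite,linorder}) cmat set \<times> 'n rvec \<Rightarrow> _) \<in> right_base \<rightarrow>\<^sub>M polar_base"
proof -
  have "(\<lambda>c :: 'n cmat set. (right_section c, mat 1 :: 'n cmat)) \<in> right_quotient \<rightarrow>\<^sub>M borel"
    by (intro borel_measurable_Pair measurable_right_section) simp
  then have 1: "(\<lambda>c :: 'n cmat set. (right_section c, mat 1 :: 'n cmat)) \<in> right_quotient \<rightarrow>\<^sub>M restrict_space borel (unitary_group \<times> unitary_group)"
    by (intro measurable_restrict_space2) (auto simp: right_section)
  have "(right_lift :: 'n cmat set \<times> 'n rvec \<Rightarrow> _) \<in> (right_quotient \<Otimes>\<^sub>M chamber_measure) \<rightarrow>\<^sub>M (pair_quotient \<Otimes>\<^sub>M chamber_measure)"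
    unfolding right_lift_def[abs_def]
  proof (rule measurable_Pair[OF _ measurable_snd])
    show "(\<lambda>y :: 'n cmat set \<times> 'n rvec. cls pair_torus_rel (right_section (fst y), mat 1)) \<in> (right_quotient \<Otimes>\<^sub>M chamber_measure) \<rightarrow>\<^sub>M pair_quotient"
      by (rule measurable_compose[OF measurable_fst measurable_compose[OF 1 measurable_cls_restrict[OF equiv_pair_torus_rel]]])
  qed
  then show ?thesis unfolding measurable_cong_sets[OF sets_right_base sets_polar_base] .
qed

lemma diag_commute_diag_real: "diag_real x ** diag t = diag t ** diag_real x"
  unfolding diag_real_def diag_mult by (simp add: mult.commute)

text \<open>
  Passing from \<open>[U, V]\<close> to \<open>[1, t V]\<close> multiplies \<open>U D(x) V\<close> from the left by \<open>D(t) adj U\<close>,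
  since \<open>D(t)\<close> commutes with \<open>D(x)\<close>.
\<close>

lemma left_lift_orbit:
  assumes "p \<in> polar_domain"
  shows "\<exists>W\<in>unitary_group. polar_map (left_lift (rho_left p)) = W ** polar_map p"
proof -
  obtain U V x where UV: "U \<in> unitary_group" "V \<in> unitary_group" "x \<in> chamber" and p: "p = (cls pair_torus_rel (U, V), x)"
    using assms by (rule polar_domainE)
  define s where "s = left_section (cls left_torus_rel V)"
  have "cls left_torus_rel V \<in> unitary_group // left_torus_rel" using UV by (simp add: cls_def quotientI)
  from left_section[OF this] have s: "s \<in> unitary_group" "cls left_torus_rel s = cls left_torus_rel V"
    by (auto simp: s_def)
  have "(V, s) \<in> left_torus_rel"
    using s(2) by (intro eq_equiv_class[OF _ equiv_left_torus_rel s(1)]) (simp add: cls_def)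
  then obtain t where t: "t \<in> torus" "s = diag t ** V" by (auto simp: left_torus_rel_def)
  have "polar_map (left_lift (rho_left p)) = diag_real x ** s"
    using UV s by (simp add: p rho_left_cls left_lift_def polar_map_cls flip: s_def)
  also have "\<dots> = diag t ** (diag_real x ** V)"
    unfolding t(2) matrix_mul_assoc diag_commute_diag_real ..
  also have "\<dots> = diag t ** adj U ** (U ** (diag_real x ** V))"
    unfolding matrix_mul_assoc[symmetric] unitary_adj_left_assoc[OF UV(1)] ..
  also have "\<dots> = (diag t ** adj U) ** polar_map p"
    using UV by (simp add: p polar_map_cls matrix_mul_assoc)
  finally have "polar_map (left_lift (rho_left p)) = (diag t ** adj U) ** polar_map p" .
  moreover have "diag t ** adj U \<in> unitary_group" using t UV by simp
  ultimately show ?thesis by blast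
qed

lemma right_lift_orbit:
  assumes "p \<in> polar_domain"
  shows "\<exists>W\<in>unitary_group. polar_map (right_lift (rho_right p)) = polar_map p ** W"
proof -
  obtain U V x where UV: "U \<in> unitary_group" "V \<in> unitary_group" "x \<in> chamber" and p: "p = (cls pair_torus_rel (U, V), x)"
    using assms by (rule polar_domainE)
  define s where "s = right_section (cls right_torus_rel U)"
  have "cls right_torus_rel U \<in> unitary_group // right_torus_rel" using UV by (simp add: cls_def quotientI)
  from right_section[OF this] have s: "s \<in> unitary_group" "cls right_torus_rel s = cls right_torus_rel U"
    by (auto simp: s_def)
  have "(U, s) \<in> right_torus_rel"
    using s(2) by (intro eq_equiv_class[OF _ equiv_right_torus_rel s(1)]) (simp add: cls_def)
  then obtain t where t: "t \<in> torus" "s = U ** diag t" by (auto simp: right_torus_rel_def)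
  have "polar_map (right_lift (rho_right p)) = s ** diag_real x"
    using UV s by (simp add: p rho_right_cls right_lift_def polar_map_cls flip: s_def)
  also have "\<dots> = U ** diag_real x ** diag t"
    unfolding t(2) matrix_mul_assoc[symmetric] diag_commute_diag_real ..
  also have "\<dots> = U ** diag_real x ** V ** adj V ** diag t"
    unfolding unitary_adj_right_assoc'[OF UV(2)] ..
  also have "\<dots> = polar_map p ** (adj V ** diag t)"
    using UV by (simp add: p polar_map_cls matrix_mul_assoc)
  finally have "polar_map (right_lift (rho_right p)) = polar_map p ** (adj V ** diag t)" .
  moreover have "adj V ** diag t \<in> unitary_group" using t UV by simp
  ultimately show ?thesis by blast
qed

lemma polar_inv_svd:
  assumes "U \<in> unitary_group" "V \<in> unitary_group" "x \<in> chamber"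
  shows "polar_inv (U ** diag_real x ** V) = (cls pair_torus_rel (U, V), x)"
  using polar_inv_polar_map[OF polar_domainI[OF assms]] by (simp add: polar_map_cls assms)

interpretation left: polar_quotient left_base rho_left "(**)" left_lift
proof
  show "rho_left \<in> polar_base \<rightarrow>\<^sub>M left_base" by (rule measurable_rho_left)
  show "distr polar_base left_base rho_left = left_base" by (rule distr_rho_left)
  show "left_lift \<in> left_base \<rightarrow>\<^sub>M polar_base" by (rule measurable_left_lift)
  show "\<exists>W\<in>unitary_group. polar_map (left_lift (rho_left p)) = W ** polar_map p" if "p \<in> polar_domain"
    for p :: "('a cmat \<times> 'a cmat) set \<times> 'a rvec"
    using that by (rule left_lift_orbit)
  show "(\<lambda>q. fst q ** snd q) \<in> borel_measurable (borel :: ('a cmat \<times> 'a cmat) measure)"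
    by (intro borel_measurable_continuous_onI continuous_intros)
  fix W Z :: "'a cmat" assume W: "W \<in> unitary_group"
  show "W ** Z \<in> regular_ball \<longleftrightarrow> Z \<in> regular_ball" using W by (rule regular_ball_mult_left_iff)
  show "rho_left (polar_inv (W ** Z)) = rho_left (polar_inv Z)" if Zr: "Z \<in> regular_ball"
  proof -
    obtain U V x where *: "U \<in> unitary_group" "V \<in> unitary_group" "x \<in> chamber" "Z = U ** diag_real x ** V"
      using Zr by (rule svd_exists)
    have "W ** Z = (W ** U) ** diag_real x ** V" unfolding *(4) by (simp only: matrix_mul_assoc)
    then show ?thesis using * W by (simp add: polar_inv_svd rho_left_cls)
  qed
  show "(**) W -` S \<in> null_sets lborel" if "S \<in> null_sets lborel" for S :: "'a cmat set"
    using null_sets_unitary[OF W unitary_1 that] by simp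
  show "distr haar borel (\<lambda>V. V ** (W ** Z)) = distr haar borel (\<lambda>V. V ** Z)"
    using distr_haar_action[of "\<lambda>V. V ** W" "\<lambda>V. V ** Z", OF _ _ nn_integral_haar_right[OF W]]
    by (simp add: matrix_mul_assoc)
qed

interpretation right: polar_quotient right_base rho_right "\<lambda>V Z. Z ** V" right_lift
proof
  show "rho_right \<in> polar_base \<rightarrow>\<^sub>M right_base" by (rule measurable_rho_right)
  show "distr polar_base right_base rho_right = right_base" by (rule distr_rho_right)
  show "right_lift \<in> right_base \<rightarrow>\<^sub>M polar_base" by (rule measurable_right_lift)
  show "\<exists>W\<in>unitary_group. polar_map (right_lift (rho_right p)) = polar_map p ** W" if "p \<in> polar_domain"
    for p :: "('a cmat \<times> 'a cmat) set \<times> 'a rvec"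
    using that by (rule right_lift_orbit)
  show "(\<lambda>q. snd q ** fst q) \<in> borel_measurable (borel :: ('a cmat \<times> 'a cmat) measure)"
    by (intro borel_measurable_continuous_onI continuous_intros)
  fix W Z :: "'a cmat" assume W: "W \<in> unitary_group"
  show "Z ** W \<in> regular_ball \<longleftrightarrow> Z \<in> regular_ball" using W by (rule regular_ball_mult_right_iff)
  show "rho_right (polar_inv (Z ** W)) = rho_right (polar_inv Z)" if Zr: "Z \<in> regular_ball"
  proof -
    obtain U V x where *: "U \<in> unitary_group" "V \<in> unitary_group" "x \<in> chamber" "Z = U ** diag_real x ** V"
      using Zr by (rule svd_exists)
    have "Z ** W = U ** diag_real x ** (V ** W)" unfolding *(4) by (simp only: matrix_mul_assoc)
    then show ?thesis using * W by (simp add: polar_inv_svd rho_right_cls)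
  qed
  show "(\<lambda>Z. Z ** W) -` S \<in> null_sets lborel" if "S \<in> null_sets lborel" for S :: "'a cmat set"
    using null_sets_unitary[OF unitary_1 W that] by simp
  show "distr haar borel (\<lambda>V. (Z ** W) ** V) = distr haar borel (\<lambda>V. Z ** V)"
    using distr_haar_action[of "\<lambda>V. W ** V" "\<lambda>V. Z ** V", OF _ _ nn_integral_haar_left[OF W]]
    by (simp add: matrix_mul_assoc)
qed

lemma left_invariant_eq: "left.invariant_symbol = left_invariant"
  by (simp add: fun_eq_iff left.invariant_symbol_def left_invariant_def)

lemma right_invariant_eq: "right.invariant_symbol = right_invariant"
  by (simp add: fun_eq_iff right.invariant_symbol_def right_invariant_def)

text \<open>
  A torus element can be moved from one factor to the other; so independence of \<open>U\<close> includes
  independence of the representative of \<open>[V]\<close>.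
\<close>

lemma cls_pair_shift:
  assumes "U \<in> unitary_group" "V \<in> unitary_group" "t \<in> torus"
  shows "cls pair_torus_rel (U, diag t ** V) = cls pair_torus_rel (U ** diag t, V)"
proof -
  have "U ** diag t ** diag (conj_vec t) = U"
    unfolding matrix_mul_assoc[symmetric] diag_conj_cancel(2)[OF assms(3)] by simp
  then have "((U ** diag t, V), (U, diag t ** V)) \<in> pair_torus_rel"
    using assms unfolding pair_torus_rel_def by (auto intro!: bexI[of _ t])
  from equiv_class_eq[OF equiv_pair_torus_rel this] show ?thesis by (simp add: cls_def)
qed

lemma independent_of_U_eq: "left.fibre_constant = (independent_of_U :: ((('n::{finite,linorder}) cmat \<times> 'n cmat) set \<times> 'n rvec \<Rightarrow> complex) \<Rightarrow> bool)"
proof (intro ext iffI)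
  fix b :: "('n cmat \<times> 'n cmat) set \<times> 'n rvec \<Rightarrow> complex"
  assume b: "left.fibre_constant b"
  show "independent_of_U b"
    unfolding independent_of_U_def
  proof (intro ballI)
    fix U U' V :: "'n cmat" and x :: "'n rvec"
    assume *: "U \<in> unitary_group" "U' \<in> unitary_group" "V \<in> unitary_group" "x \<in> chamber"
    then have "rho_left (cls pair_torus_rel (U, V), x) = rho_left (cls pair_torus_rel (U', V), x)"
      by (simp add: rho_left_cls)
    then show "b (cls pair_torus_rel (U, V), x) = b (cls pair_torus_rel (U', V), x)"
      using b polar_domainI[OF *(1,3,4)] polar_domainI[OF *(2,3,4)] unfolding left.fibre_constant_def by blast
  qed
next
  fix b :: "('n cmat \<times> 'n cmat) set \<times> 'n rvec \<Rightarrow> complex"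
  assume b: "independent_of_U b"
  show "left.fibre_constant b"
    unfolding left.fibre_constant_def
  proof (intro ballI impI)
    fix p p' :: "('n cmat \<times> 'n cmat) set \<times> 'n rvec"
    assume "p \<in> polar_domain" "p' \<in> polar_domain" and eq: "rho_left p = rho_left p'"
    then obtain U V x U' V' x' where p: "U \<in> unitary_group" "V \<in> unitary_group" "x \<in> chamber" "p = (cls pair_torus_rel (U, V), x)"
      and p': "U' \<in> unitary_group" "V' \<in> unitary_group" "x' \<in> chamber" "p' = (cls pair_torus_rel (U', V'), x')"
      by (elim polar_domainE)
    have "cls left_torus_rel V = cls left_torus_rel V'" and x: "x = x'"
      using eq p p' by (simp_all add: rho_left_cls)
    then have "(V, V') \<in> left_torus_rel"
      by (intro eq_equiv_class[OF _ equiv_left_torus_rel p'(2)]) (simp add: cls_def)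
    then obtain t where t: "t \<in> torus" "V' = diag t ** V" by (auto simp: left_torus_rel_def)
    have "p' = (cls pair_torus_rel (U' ** diag t, V), x)"
      using cls_pair_shift[OF p'(1) p(2) t(1)] by (simp add: p' t x)
    moreover have "U' ** diag t \<in> unitary_group" using p' t by simp
    ultimately show "b p = b p'" using b p unfolding independent_of_U_def by blast
  qed
qed

lemma independent_of_V_eq: "right.fibre_constant = (independent_of_V :: ((('n::{finite,linorder}) cmat \<times> 'n cmat) set \<times> 'n rvec \<Rightarrow> complex) \<Rightarrow> bool)"
proof (intro ext iffI)
  fix b :: "('n cmat \<times> 'n cmat) set \<times> 'n rvec \<Rightarrow> complex"
  assume b: "right.fibre_constant b"
  show "independent_of_V b"
    unfolding independent_of_V_def
  proof (intro ballI)
    fix U V V' :: "'n cmat" and x :: "'n rvec"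
    assume *: "U \<in> unitary_group" "V \<in> unitary_group" "V' \<in> unitary_group" "x \<in> chamber"
    then have "rho_right (cls pair_torus_rel (U, V), x) = rho_right (cls pair_torus_rel (U, V'), x)"
      by (simp add: rho_right_cls)
    then show "b (cls pair_torus_rel (U, V), x) = b (cls pair_torus_rel (U, V'), x)"
      using b polar_domainI[OF *(1,2,4)] polar_domainI[OF *(1,3,4)] unfolding right.fibre_constant_def by blast
  qed
next
  fix b :: "('n cmat \<times> 'n cmat) set \<times> 'n rvec \<Rightarrow> complex"
  assume b: "independent_of_V b"
  show "right.fibre_constant b"
    unfolding right.fibre_constant_def
  proof (intro ballI impI)
    fix p p' :: "('n cmat \<times> 'n cmat) set \<times> 'n rvec"
    assume "p \<in> polar_domain" "p' \<in> polar_domain" and eq: "rho_right p = rho_right p'"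
    then obtain U V x U' V' x' where p: "U \<in> unitary_group" "V \<in> unitary_group" "x \<in> chamber" "p = (cls pair_torus_rel (U, V), x)"
      and p': "U' \<in> unitary_group" "V' \<in> unitary_group" "x' \<in> chamber" "p' = (cls pair_torus_rel (U', V'), x')"
      by (elim polar_domainE)
    have "cls right_torus_rel U = cls right_torus_rel U'" and x: "x = x'"
      using eq p p' by (simp_all add: rho_right_cls)
    then have "(U, U') \<in> right_torus_rel"
      by (intro eq_equiv_class[OF _ equiv_right_torus_rel p'(1)]) (simp add: cls_def)
    then obtain t where t: "t \<in> torus" "U' = U ** diag t" by (auto simp: right_torus_rel_def)
    have "p' = (cls pair_torus_rel (U, diag t ** V'), x)"
      using cls_pair_shift[OF p(1) p'(2) t(1)] by (simp add: p' t x)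
    moreover have "diag t ** V' \<in> unitary_group" using p' t by simp
    ultimately show "b p = b p'" using b p unfolding independent_of_V_def by blast
  qed
qed

theorem proposition3p12:
  fixes a :: "('n::{finite,linorder}) cmat \<Rightarrow> complex"
  assumes "a \<in> ess_bounded ball_measure"
  shows
    "(holds_mod_ae ball_measure left_invariant a
        \<longleftrightarrow> (\<forall>U\<in>unitary_group. AE Z in ball_measure. a (U ** Z) = a Z))
     \<and> (holds_mod_ae ball_measure left_invariant a
        \<longleftrightarrow> holds_mod_ae polar_measure independent_of_U (a \<circ> polar_map))
     \<and> (holds_mod_ae polar_measure independent_of_U (a \<circ> polar_map)
        \<longleftrightarrow> (\<exists>f \<in> borel_measurable left_quotient_measure.
               AE p in polar_measure. (a \<circ> polar_map) p = (f \<circ> rho_left) p))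
     \<and> (holds_mod_ae ball_measure right_invariant a
        \<longleftrightarrow> (\<forall>V\<in>unitary_group. AE Z in ball_measure. a (Z ** V) = a Z))
     \<and> (holds_mod_ae ball_measure right_invariant a
        \<longleftrightarrow> holds_mod_ae polar_measure independent_of_V (a \<circ> polar_map))
     \<and> (holds_mod_ae polar_measure independent_of_V (a \<circ> polar_map)
        \<longleftrightarrow> (\<exists>f \<in> borel_measurable right_quotient_measure.
               AE p in polar_measure. (a \<circ> polar_map) p = (f \<circ> rho_right) p))
     \<and> (\<exists>\<Phi>. (\<forall>f \<in> ess_bounded (left_quotient_measure
                   :: ('n cmat set \<times> 'n rvec) measure).
               \<Phi> (cls (ae_rel left_quotient_measure) f)
                 = cls (ae_rel ball_measure) (symbol_of rho_left f))
            \<and> bij_betw \<Phi> (L_infty left_quotient_measure) left_invariant_classes)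
     \<and> (\<exists>\<Phi>. (\<forall>f \<in> ess_bounded (right_quotient_measure
                   :: ('n cmat set \<times> 'n rvec) measure).
               \<Phi> (cls (ae_rel right_quotient_measure) f)
                 = cls (ae_rel ball_measure) (symbol_of rho_right f))
            \<and> bij_betw \<Phi> (L_infty right_quotient_measure) right_invariant_classes)"
  unfolding left_invariant_classes_def right_invariant_classes_def
    left_quotient_measure_eq right_quotient_measure_eq
    left_invariant_eq[symmetric] right_invariant_eq[symmetric]
    independent_of_U_eq[symmetric] independent_of_V_eq[symmetric]
  by (intro conjI left.invariance_equivalences[OF assms] right.invariance_equivalences[OF assms]
      left.symbol_correspondence right.symbol_correspondence)

end
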